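(* Let $\alpha\in(0,2]$, $\beta\in(0,1)$, $\nu>0$, and let $d\ge1$ be an integer with $d<\min\{2,\beta^{-1}\}\alpha$. Suppose there exist a non-negative function $J$ on $\mathbb{R}^d$ and finite positive constants $Lip_\sigma$, $K$ such that $\sigma(0,h)=0$ and $|\sigma(x,h)-\sigma(y,h)|\le J(h)Lip_\sigma|x-y|$ for all $x,y\in\mathbb{R}$, $h\in\mathbb{R}^d$, and $\int_{\mathbb{R}^d}J(h)^2\mu(dh)\le K$. Let $\gamma>0$ and let $u$ be a predictable random field solution of $$\frac{\partial^\beta u}{\partial t^\beta}+\nu(-\Delta)^{\alpha/2}u=I_t^{1-\beta}\Big[\int_{\mathbb{R}^d}\sigma(u(t,x),h)\,\dot{\tilde N}(t,x,h)\Big]$$ with $\|u\|_{2,\gamma}<\infty$. Then there exists a positive constant $C^{**}$ such that $$\|\mathcal{A}u\|_{2,\gamma}\le C^{**}\|u\|_{2,\gamma},\qquad\text{where } C^{**}=Lip_\sigma\sqrt{\frac{C^*K\,\Gamma(1-\frac{\beta d}{\alpha})}{\gamma^{1+\frac{\beta d}{\alpha}}}},$$ and $(\mathcal{A}u)(t,x):=\int_0^t\int_{\mathbb{R}^d}\int_{\mathbb{R}^d}G(t-s,y-x)\sigma(u(s,y),h)\,\tilde N(ds\,dy\,dh)$.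
   Context: Noise: $\mu$ is a Lévy measure on $\mathbb{R}^d$, i.e. $\int_{\mathbb{R}^d}(1\wedge|h|^2)\mu(dh)<\infty$. $N$ is a Poisson random measure on $\mathbb{R}_+\times\mathbb{R}^d\times\mathbb{R}^d$ with intensity $dt\,dx\,\mu(dh)$, and $\tilde N(ds\,dx\,dh)=N(ds\,dx\,dh)-ds\,dx\,\mu(dh)$ is the compensated Poisson random measure. Predictability is with respect to the filtration generated by $N$. For predictable $X$ with $\int_0^T\int\int \mathbb{E}|X(s,x,h)|^2\,ds\,dx\,\mu(dh)<\infty$, the integral $\int_0^T\int\int X\,d\tilde N$ is defined and satisfies $\mathbb{E}|\int X\,d\tilde N|^2=\int_0^T\int\int\mathbb{E}X^2\,ds\,dx\,\mu(dh)$. The coefficient is a function $\sigma:\mathbb{R}\times\mathbb{R}^d\to\mathbb{R}$. Operators: $\partial_t^\beta f(t)=\frac{1}{\Gamma(1-\beta)}\frac{d}{dt}\int_0^t(t-s)^{-\beta}(f(s)-f(0))\,ds$ is the Caputo derivative, $I_t^{1-\beta}$ is the fractional integral of order $1-\beta$ in time, and $-(-\Delta)^{\alpha/2}$ is the fractional Laplacian. Kernel: $G_t(x)=G(t,x)=\int_0^\infty p_{X(s)}(x)f_{E_t}(s)\,ds$ is the fundamental solution of $\partial_t^\beta G_t=-\nu(-\Delta)^{\alpha/2}G_t$. Here $p_{X(s)}$ is the density with Fourier transform $\widehat{p_{X(s)}}(\xi)=e^{-s\nu|\xi|^\alpha}$ (isotropic $\alpha$-stable process on $\mathbb{R}^d$),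 and $f_{E_t}(s)=t\beta^{-1}s^{-1-1/\beta}g_\beta(ts^{-1/\beta})$ is the density of the inverse $\beta$-stable subordinator $E_t$, $g_\beta$ being the density of $D_1$ for the $\beta$-stable subordinator $D$ with $\mathbb{E}e^{-\lambda D_1}=e^{-\lambda^\beta}$. Constant: $C^*=\frac{\nu^{-d/\alpha}2\pi^{d/2}}{\alpha\Gamma(d/2)}\frac{1}{(2\pi)^d}\int_0^\infty z^{d/\alpha-1}(E_\beta(-z))^2\,dz$, with $E_\beta(z)=\sum_{k\ge0}z^k/\Gamma(1+\beta k)$ the Mittag-Leffler function; for $d<2\alpha$ one has $\int_{\mathbb{R}^d}G_t(x)^2dx=C^*t^{-\beta d/\alpha}$. Norm: $\|u\|_{2,\gamma}:=\{\sup_{t>0}\sup_{x\in\mathbb{R}^d}e^{-\gamma t}\mathbb{E}|u(t,x)|^2\}^{1/2}$. Solution: a random field solution of the equation with measurable bounded initial function $u_0$ is a random field satisfying, a.s., $u(t,x)=\int_{\mathbb{R}^d}G(t,x-y)u_0(y)\,dy+(\mathcal{A}u)(t,x)$, and $\sup_{0\le t\le T}\sup_{x\in\mathbb{R}^d}\mathbb{E}|u(t,x)|^2<\infty$ for all $T>0$.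
   Formalization: The exponent of γ in C** is 1−βd/α instead of the printed 1+βd/α; the printed bound fails for γ>1 (e.g. linear σ, μ a unit point mass, u₀=1), and for γ≤1 it follows from the corrected one. *)

theory Defs
  imports "HOL-Probability.Probability"
begin

section \<open>Levy measures and Poisson random measures\<close>

text \<open>
  Sigma-finiteness is the usual convention on the mass at the origin, in a weak form: off the
  origin it follows from the integrability condition, so it only excludes an infinite atom at 0
  (the customary requirement is that there is no atom at 0 at all).
\<close>

definition levy_measure :: "'a::euclidean_space measure \<Rightarrow> bool" where
  "levy_measure \<mu> \<longleftrightarrow>
     sets \<mu> = sets borel \<and> sigma_finite_measure \<mu> \<and>
     (\<integral>\<^sup>+ h. ennreal (min 1 ((norm h)\<^sup>2)) \<partial>\<mu>) < \<infinity>"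

definition space_mark_measure ::
  "'a::euclidean_space measure \<Rightarrow> ('a \<times> 'a) measure" where
  "space_mark_measure \<mu> = lborel \<Otimes>\<^sub>M \<mu>"

definition intensity :: "'a::euclidean_space measure \<Rightarrow> (real \<times> 'a \<times> 'a) measure" where
  "intensity \<mu> = restrict_space lborel {0..} \<Otimes>\<^sub>M space_mark_measure \<mu>"

definition poisson_random_measure ::
  "'w measure \<Rightarrow> 's measure \<Rightarrow> ('w \<Rightarrow> 's measure) \<Rightarrow> bool" where
  "poisson_random_measure M \<Lambda> N \<longleftrightarrow>
     (\<forall>\<omega>\<in>space M. sets (N \<omega>) = sets \<Lambda>) \<and>
     (\<forall>A\<in>sets \<Lambda>. (\<lambda>\<omega>. emeasure (N \<omega>) A) \<in> borel_measurable M) \<and>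
     (\<forall>A\<in>sets \<Lambda>. emeasure \<Lambda> A < \<infinity> \<longrightarrow>
        (\<forall>k::nat. measure M {\<omega>\<in>space M. emeasure (N \<omega>) A = of_nat k} =
           (measure \<Lambda> A) ^ k / fact k * exp (- measure \<Lambda> A))) \<and>
     (\<forall>A::nat \<Rightarrow> 's set. range A \<subseteq> sets \<Lambda> \<longrightarrow> disjoint_family A \<longrightarrow>
        prob_space.indep_vars M (\<lambda>_. borel) (\<lambda>i \<omega>. emeasure (N \<omega>) (A i)) UNIV)"


section \<open>Filtration, predictability, stochastic integral\<close>

definition noise_filtration ::
  "'w measure \<Rightarrow> 'a::euclidean_space measure \<Rightarrow> ('w \<Rightarrow> (real \<times> 'a \<times> 'a) measure) \<Rightarrow>
     real \<Rightarrow> 'w measure" where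
  "noise_filtration M \<mu> N t = sigma (space M)
     {{\<omega>\<in>space M. emeasure (N \<omega>) A \<in> B} | A B.
        A \<in> sets (intensity \<mu>) \<and> A \<subseteq> {0..t} \<times> UNIV \<and> B \<in> sets borel}"

definition predictable_algebra ::
  "'w measure \<Rightarrow> 'a::euclidean_space measure \<Rightarrow> ('w \<Rightarrow> (real \<times> 'a \<times> 'a) measure) \<Rightarrow>
     (real \<times> 'w) measure" where
  "predictable_algebra M \<mu> N = sigma ({0..} \<times> space M)
     ({{0} \<times> F | F. F \<in> sets (noise_filtration M \<mu> N 0)} \<union>
      {{s<..t} \<times> F | s t F. 0 \<le> s \<and> s \<le> t \<and> F \<in> sets (noise_filtration M \<mu> N s)})"

definition predictable_field ::
  "'w measure \<Rightarrow> 'a::euclidean_space measure \<Rightarrow> ('w \<Rightarrow> (real \<times> 'a \<times> 'a) measure) \<Rightarrow>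
     (real \<Rightarrow> 'a \<Rightarrow> 'w \<Rightarrow> real) \<Rightarrow> bool" where
  "predictable_field M \<mu> N u \<longleftrightarrow>
     (\<lambda>((t, \<omega>), x). u t x \<omega>) \<in> borel_measurable (predictable_algebra M \<mu> N \<Otimes>\<^sub>M borel)"

definition predictable_integrand ::
  "'w measure \<Rightarrow> 'a::euclidean_space measure \<Rightarrow> ('w \<Rightarrow> (real \<times> 'a \<times> 'a) measure) \<Rightarrow>
     (real \<Rightarrow> 'a \<Rightarrow> 'a \<Rightarrow> 'w \<Rightarrow> real) \<Rightarrow> bool" where
  "predictable_integrand M \<mu> N X \<longleftrightarrow>
     (\<lambda>((s, \<omega>), (y, h)). X s y h \<omega>)
        \<in> borel_measurable (predictable_algebra M \<mu> N \<Otimes>\<^sub>M (borel \<Otimes>\<^sub>M borel))"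

definition sq_norm_integrand ::
  "'w measure \<Rightarrow> 'a::euclidean_space measure \<Rightarrow> (real \<Rightarrow> 'a \<Rightarrow> 'a \<Rightarrow> 'w \<Rightarrow> real) \<Rightarrow> ennreal" where
  "sq_norm_integrand M \<mu> X =
     (\<integral>\<^sup>+ (s, y, h). (\<integral>\<^sup>+ \<omega>. ennreal ((X s y h \<omega>)\<^sup>2) \<partial>M) \<partial>intensity \<mu>)"

text \<open>
  A list of tuples \<open>(c, F, s, t, D)\<close> encodes the simple predictable integrand given by the sum
  of the terms \<open>c * indicator F * indicator {s<..t} * indicator D\<close>, where \<open>D\<close> is a set of pairs
  (space point, mark).
\<close>

type_synonym ('w, 'a) simple_integrand =
  "(real \<times> 'w set \<times> real \<times> real \<times> ('a \<times> 'a) set) list"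

definition simple_predictable ::
  "'w measure \<Rightarrow> 'a::euclidean_space measure \<Rightarrow> ('w \<Rightarrow> (real \<times> 'a \<times> 'a) measure) \<Rightarrow>
     ('w, 'a) simple_integrand \<Rightarrow> bool" where
  "simple_predictable M \<mu> N S \<longleftrightarrow>
     (\<forall>(c, F, s, t, D)\<in>set S. 0 \<le> s \<and> s \<le> t \<and> F \<in> sets (noise_filtration M \<mu> N s) \<and>
        D \<in> sets (space_mark_measure \<mu>) \<and> emeasure (space_mark_measure \<mu>) D < \<infinity>)"

definition simple_value ::
  "('w, 'a) simple_integrand \<Rightarrow> real \<Rightarrow> 'a \<Rightarrow> 'a \<Rightarrow> 'w \<Rightarrow> real" where
  "simple_value S r y h \<omega> =
     (\<Sum>(c, F, s, t, D)\<leftarrow>S. c * indicator F \<omega> * indicator {s<..t} r * indicator D (y, h))"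

definition simple_integral ::
  "'a::euclidean_space measure \<Rightarrow> ('w \<Rightarrow> (real \<times> 'a \<times> 'a) measure) \<Rightarrow>
     ('w, 'a) simple_integrand \<Rightarrow> 'w \<Rightarrow> real" where
  "simple_integral \<mu> N S \<omega> =
     (\<Sum>(c, F, s, t, D)\<leftarrow>S. c * indicator F \<omega> *
        (measure (N \<omega>) ({s<..t} \<times> D) - measure (intensity \<mu>) ({s<..t} \<times> D)))"

definition has_stoch_integral ::
  "'w measure \<Rightarrow> 'a::euclidean_space measure \<Rightarrow> ('w \<Rightarrow> (real \<times> 'a \<times> 'a) measure) \<Rightarrow>
     (real \<Rightarrow> 'a \<Rightarrow> 'a \<Rightarrow> 'w \<Rightarrow> real) \<Rightarrow> ('w \<Rightarrow> real) \<Rightarrow> bool" where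
  "has_stoch_integral M \<mu> N X Y \<longleftrightarrow>
     predictable_integrand M \<mu> N X \<and> sq_norm_integrand M \<mu> X < \<infinity> \<and>
     Y \<in> borel_measurable M \<and>
     (\<exists>S. (\<forall>n::nat. simple_predictable M \<mu> N (S n)) \<and>
        (\<lambda>n. sq_norm_integrand M \<mu> (\<lambda>s y h \<omega>. X s y h \<omega> - simple_value (S n) s y h \<omega>))
           \<longlonglongrightarrow> 0 \<and>
        (\<lambda>n. \<integral>\<^sup>+ \<omega>. ennreal ((Y \<omega> - simple_integral \<mu> N (S n) \<omega>)\<^sup>2) \<partial>M) \<longlonglongrightarrow> 0)"

text \<open>The integral over all of \<open>[0,\<infinity>)\<close> against the compensated measure; it is determined by
  \<open>has_stoch_integral\<close> up to almost sure equality, and an arbitrary version is chosen.\<close>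

definition stoch_integral ::
  "'w measure \<Rightarrow> 'a::euclidean_space measure \<Rightarrow> ('w \<Rightarrow> (real \<times> 'a \<times> 'a) measure) \<Rightarrow>
     (real \<Rightarrow> 'a \<Rightarrow> 'a \<Rightarrow> 'w \<Rightarrow> real) \<Rightarrow> 'w \<Rightarrow> real" where
  "stoch_integral M \<mu> N X = (SOME Y. has_stoch_integral M \<mu> N X Y)"


section \<open>The kernel\<close>

text \<open>
  The density of the isotropic stable process at time \<open>s\<close>, in its continuous version (unique,
  since the characteristic function is integrable). Prescribing the version makes the
  integral over \<open>s\<close> in \<open>green_kernel\<close> unambiguous.
\<close>

definition stable_density ::
  "real \<Rightarrow> real \<Rightarrow> (real \<Rightarrow> 'a::euclidean_space \<Rightarrow> real) \<Rightarrow> bool" where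
  "stable_density \<alpha> \<nu> p \<longleftrightarrow>
     (\<forall>s>0. continuous_on UNIV (p s) \<and> (\<forall>x. 0 \<le> p s x) \<and> integrable lborel (p s) \<and>
        (\<forall>\<xi>. (LINT x|lborel. iexp (\<xi> \<bullet> x) * complex_of_real (p s x)) =
              complex_of_real (exp (- s * \<nu> * norm \<xi> powr \<alpha>))))"

definition subordinator_density :: "real \<Rightarrow> (real \<Rightarrow> real) \<Rightarrow> bool" where
  "subordinator_density \<beta> g \<longleftrightarrow>
     g \<in> borel_measurable borel \<and> (\<forall>r. 0 \<le> g r) \<and>
     (\<forall>l\<ge>0. (\<integral>\<^sup>+ r\<in>{0<..}. ennreal (exp (- l * r) * g r) \<partial>lborel) =
              ennreal (exp (- (l powr \<beta>))))"

definition inverse_subordinator_density ::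
  "real \<Rightarrow> (real \<Rightarrow> real) \<Rightarrow> real \<Rightarrow> real \<Rightarrow> real" where
  "inverse_subordinator_density \<beta> g t s =
     t * inverse \<beta> * s powr (- 1 - 1 / \<beta>) * g (t * s powr (- 1 / \<beta>))"

definition green_kernel ::
  "real \<Rightarrow> (real \<Rightarrow> 'a::euclidean_space \<Rightarrow> real) \<Rightarrow> (real \<Rightarrow> real) \<Rightarrow> real \<Rightarrow> 'a \<Rightarrow> real" where
  "green_kernel \<beta> p g t x =
     (LINT s:{0<..}|lborel. p s x * inverse_subordinator_density \<beta> g t s)"


section \<open>Mild solutions\<close>

text \<open>\<open>stoch_conv M \<mu> N \<sigma> G u\<close> is the random field written \<open>\<A>u\<close> in the literature, and
  \<open>indicator {0..t}\<close> restricts the time integration to \<open>[0,t]\<close>.\<close>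

definition stoch_conv ::
  "'w measure \<Rightarrow> 'a::euclidean_space measure \<Rightarrow> ('w \<Rightarrow> (real \<times> 'a \<times> 'a) measure) \<Rightarrow>
     (real \<Rightarrow> 'a \<Rightarrow> real) \<Rightarrow> (real \<Rightarrow> 'a \<Rightarrow> real) \<Rightarrow>
     (real \<Rightarrow> 'a \<Rightarrow> 'w \<Rightarrow> real) \<Rightarrow> real \<Rightarrow> 'a \<Rightarrow> 'w \<Rightarrow> real" where
  "stoch_conv M \<mu> N \<sigma> G u t x =
     stoch_integral M \<mu> N
       (\<lambda>s y h \<omega>. indicator {0..t} s * (G (t - s) (y - x) * \<sigma> (u s y \<omega>) h))"

text \<open>
  At \<open>t = 0\<close> the fundamental solution is the Dirac mass, so the mild equation reads
  \<open>u 0 x = u0 x\<close>; the pointwise formula \<open>green_kernel\<close> would give 0 there.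
\<close>

definition random_field_solution ::
  "'w measure \<Rightarrow> 'a::euclidean_space measure \<Rightarrow> ('w \<Rightarrow> (real \<times> 'a \<times> 'a) measure) \<Rightarrow>
     (real \<Rightarrow> 'a \<Rightarrow> real) \<Rightarrow> (real \<Rightarrow> 'a \<Rightarrow> real) \<Rightarrow> ('a \<Rightarrow> real) \<Rightarrow>
     (real \<Rightarrow> 'a \<Rightarrow> 'w \<Rightarrow> real) \<Rightarrow> bool" where
  "random_field_solution M \<mu> N \<sigma> G u0 u \<longleftrightarrow>
     (\<forall>t\<ge>0. \<forall>x. u t x \<in> borel_measurable M) \<and>
     (\<forall>x. AE \<omega> in M. u 0 x \<omega> = u0 x) \<and>
     (\<forall>t>0. \<forall>x. AE \<omega> in M.
        u t x \<omega> = (LINT y|lborel. G t (x - y) * u0 y) + stoch_conv M \<mu> N \<sigma> G u t x \<omega>) \<and>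
     (\<forall>T>0. (SUP t\<in>{0..T}. SUP x. \<integral>\<^sup>+ \<omega>. ennreal ((u t x \<omega>)\<^sup>2) \<partial>M) < \<infinity>)"


section \<open>Norm and constants\<close>

definition ennsqrt :: "ennreal \<Rightarrow> ennreal" where
  "ennsqrt a = (if a = \<infinity> then \<infinity> else ennreal (sqrt (enn2real a)))"

definition field_norm ::
  "'w measure \<Rightarrow> real \<Rightarrow> (real \<Rightarrow> 'a::euclidean_space \<Rightarrow> 'w \<Rightarrow> real) \<Rightarrow> ennreal" where
  "field_norm M \<gamma> u =
     ennsqrt (SUP t\<in>{0<..}. SUP x.
       ennreal (exp (- \<gamma> * t)) * (\<integral>\<^sup>+ \<omega>. ennreal ((u t x \<omega>)\<^sup>2) \<partial>M))"

definition mittag_leffler :: "real \<Rightarrow> real \<Rightarrow> real" where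
  "mittag_leffler \<beta> z = (\<Sum>k. z ^ k / Gamma (1 + \<beta> * real k))"

definition C_star :: "nat \<Rightarrow> real \<Rightarrow> real \<Rightarrow> real \<Rightarrow> real" where
  "C_star d \<alpha> \<beta> \<nu> =
     \<nu> powr (- (real d / \<alpha>)) * 2 * pi powr (real d / 2) / (\<alpha> * Gamma (real d / 2)) *
     (1 / (2 * pi) ^ d) *
     (LINT z:{0<..}|lborel. z powr (real d / \<alpha> - 1) * (mittag_leffler \<beta> (- z))\<^sup>2)"

text \<open>
  The power of \<open>\<gamma>\<close> is that of the Laplace transform of \<open>r powr (- \<beta> * d / \<alpha>)\<close> at \<open>\<gamma>\<close>, which is
  \<open>Gamma (1 - \<beta> * d / \<alpha>) / \<gamma> powr (1 - \<beta> * d / \<alpha>)\<close>. The source prints \<open>1 + \<beta> * d / \<alpha>\<close> for this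
  exponent; with that sign the estimate is false for every \<open>\<gamma> > 1\<close> (already for linear
  \<open>\<sigma>\<close> and \<open>u0 = 1\<close>), while for \<open>\<gamma> \<le> 1\<close> it is implied by the one below.
\<close>

definition C_star_star ::
  "nat \<Rightarrow> real \<Rightarrow> real \<Rightarrow> real \<Rightarrow> real \<Rightarrow> real \<Rightarrow> real \<Rightarrow> real" where
  "C_star_star d \<alpha> \<beta> \<nu> \<gamma> Lip K =
     Lip * sqrt (C_star d \<alpha> \<beta> \<nu> * K * Gamma (1 - \<beta> * real d / \<alpha>)
                 / \<gamma> powr (1 - \<beta> * real d / \<alpha>))"

end

theory Submission
  imports Defs
begin

text \<open>
  By the Ito isometry and the Lipschitz bound \<open>|\<sigma> v h| \<le> J h * Lip * |v|\<close>, the second moment of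
  \<open>\<A>u(t,x)\<close> is at most \<open>Lip\<^sup>2 K\<close> times the integral over \<open>s < t\<close> of
  \<open>\<parallel>G (t - s)\<parallel>\<^sub>2\<^sup>2 * sup\<^sub>y E |u s y|\<^sup>2\<close>. The supremum is at most \<open>exp (\<gamma> s)\<close> times the squared field
  norm and \<open>\<parallel>G r\<parallel>\<^sub>2\<^sup>2 \<le> C\<^sup>* r powr (- \<beta> d / \<alpha>)\<close>, so what remains is a Laplace transform, i.e. a Gamma integral.

  The kernel bound: the change of variables \<open>s = (t / r) powr \<beta>\<close> turns the density of \<open>E\<^sub>t\<close> into the law
  of \<open>D\<^sub>1\<close>, Fourier inversion gives \<open>\<integral> p\<^sub>s p\<^sub>s\<^sub>'\<close> as a multiple of \<open>(s + s') powr (- d / \<alpha>)\<close>, and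
  \<open>E\<^sub>\<beta>(- z) = E exp (- z D\<^sub>1 powr (- \<beta>))\<close> by comparison of the negative moments of \<open>D\<^sub>1\<close> with the series.

  Since \<open>stoch_integral\<close> is a choice, the existence of the integral has to be proved as well: simple
  integrands are dense in \<open>L\<^sup>2\<close> of the predictable algebra (Dynkin's lemma), and the isometry for them rests on
  the independence of the noise on disjoint regions, which is derived from the independence of the counts of a disjoint sequence.
\<close>

section \<open>Gamma-type integrals\<close>

text \<open>Write \<open>d\<close> for the dimension. Its two upper bounds act at different places.
  From \<open>d < \<alpha> / \<beta>\<close> comes \<open>\<beta> * d / \<alpha> < 1\<close>, so the
  power of \<open>t - s\<close> left by the kernel is integrable at \<open>s = t\<close>. From
  \<open>d < 2 * \<alpha>\<close> comes the convergence of the integral in \<open>C_star\<close>: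
  squaring a Laplace transform brings in a second independent copy of D_1, and finiteness reduces to
  that of a positive moment of D_1 of order below \<open>\<beta>\<close>. This matters because
  \<open>C_star\<close> contains a Bochner integral: under divergence its value would be 0, and a
  zero constant can neither bound the kernel nor be positive. Everything is an upper bound. Hence
  \<open>green_kernel\<close> may take the default value 0 at points where its integral diverges,
  and the moment bound is proved for every \<open>Y\<close> with \<open>has_stoch_integral\<close>,
  whichever one the choice returns. The constant 1 of the isometry has to survive the passage to the
  limit, though, since \<open>C_star_star\<close> leaves no room for an extra factor.\<close>

lemma nn_integral_exp_substitution:
  fixes f :: "real \<Rightarrow> ennreal"
  assumes [measurable]: "f \<in> borel_measurable borel"
  shows "(\<integral>\<^sup>+x\<in>{0<..}. f x \<partial>lborel) = (\<integral>\<^sup>+w. f (exp w) * exp w \<partial>lborel)"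
proof -
  \<comment> \<open>The substitution rule is applied on compact intervals that exhaust both sides,
    and monotone convergence passes to the limit. \<open>Suc n\<close> keeps the intervals
    nondegenerate.\<close>
  define A where "A n = {exp (- real (Suc n))..exp (real (Suc n))}" for n
  define B where "B n = {- real (Suc n)..real (Suc n)}" for n
  have incA: "incseq (\<lambda>n x. f x * indicator (A n) x)"
  proof -
    have "A m \<subseteq> A n" if "m \<le> n" for m n
      unfolding A_def using that by (intro atLeastatMost_subset_iff[THEN iffD2]) auto
    then show ?thesis by (auto simp: incseq_def le_fun_def split: split_indicator)
  qed
  have incB: "incseq (\<lambda>n x. f (exp x) * exp x * indicator (B n) x)"
  proof -
    have "B m \<subseteq> B n" if "m \<le> n" for m n
      unfolding B_def using that by auto
    then show ?thesis by (auto simp: incseq_def le_fun_def split: split_indicator)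
  qed
  have supA: "(SUP n. f x * indicator (A n) x) = f x * indicator {0<..} x" for x
  proof (cases "x > 0")
    case True
    obtain n where n: "real n > \<bar>ln x\<bar>" using reals_Archimedean2 by blast
    have "x \<in> A n"
    proof -
      have "exp (- real (Suc n)) \<le> exp (ln x)" "exp (ln x) \<le> exp (real (Suc n))" using n by auto
      then show ?thesis using True by (auto simp: A_def)
    qed
    then have "f x * indicator (A n) x = f x" by simp
    then have "f x \<le> (SUP n. f x * indicator (A n) x)" by (metis SUP_upper UNIV_I)
    moreover have "(SUP n. f x * indicator (A n) x) \<le> f x"
      by (auto intro!: SUP_least split: split_indicator)
    ultimately show ?thesis using True by auto
  next
    case False
    then have "x \<notin> A n" for n using exp_gt_zero[of "- real (Suc n)"] by (auto simp: A_def simp del: exp_gt_zero)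
    then show ?thesis using False by auto
  qed
  have supB: "(SUP n. f (exp x) * exp x * indicator (B n) x) = f (exp x) * exp x" for x
  proof -
    obtain n where n: "real n > \<bar>x\<bar>" using reals_Archimedean2 by blast
    have "x \<in> B n" using n by (auto simp: B_def)
    then have "f (exp x) * exp x * indicator (B n) x = f (exp x) * exp x" by simp
    then have "f (exp x) * exp x \<le> (SUP n. f (exp x) * exp x * indicator (B n) x)" by (metis SUP_upper UNIV_I)
    moreover have "(SUP n. f (exp x) * exp x * indicator (B n) x) \<le> f (exp x) * exp x"
      by (auto intro!: SUP_least split: split_indicator)
    ultimately show ?thesis by auto
  qed
  have "(\<integral>\<^sup>+x. f x * indicator (A n) x \<partial>lborel) = (\<integral>\<^sup>+x. f (exp x) * exp x * indicator (B n) x \<partial>lborel)" for n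
    unfolding A_def B_def
    by (rule nn_integral_substitution_aux) (auto intro!: derivative_eq_intros continuous_intros)
  then have "(SUP n. (\<integral>\<^sup>+x. f x * indicator (A n) x \<partial>lborel)) = (SUP n. (\<integral>\<^sup>+x. f (exp x) * exp x * indicator (B n) x \<partial>lborel))" by simp
  moreover have "(SUP n. (\<integral>\<^sup>+x. f x * indicator (A n) x \<partial>lborel)) = (\<integral>\<^sup>+x. (SUP n. f x * indicator (A n) x) \<partial>lborel)"
    by (rule nn_integral_monotone_convergence_SUP[symmetric]) (use incA in \<open>auto simp: A_def\<close>)
  moreover have "(SUP n. (\<integral>\<^sup>+x. f (exp x) * exp x * indicator (B n) x \<partial>lborel)) = (\<integral>\<^sup>+x. (SUP n. f (exp x) * exp x * indicator (B n) x) \<partial>lborel)"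
    by (rule nn_integral_monotone_convergence_SUP[symmetric]) (use incB in \<open>auto simp: B_def\<close>)
  ultimately show ?thesis unfolding supA supB by simp
qed

text \<open>In the coordinate \<open>w = ln x\<close> a power map is affine with slope
  \<open>a\<close>, so increasing and decreasing powers are treated alike. The decreasing case
  \<open>a = - \<beta>\<close> is the one behind the law of E_t.\<close>

lemma nn_integral_powr_substitution:
  fixes f :: "real \<Rightarrow> ennreal"
  assumes [measurable]: "f \<in> borel_measurable borel" and a: "a \<noteq> 0" and c: "c > 0"
  shows "(\<integral>\<^sup>+x\<in>{0<..}. f x \<partial>lborel) =
    (\<integral>\<^sup>+y\<in>{0<..}. f (c * y powr a) * ennreal (c * \<bar>a\<bar> * y powr (a - 1)) \<partial>lborel)"
proof -
  have "(\<integral>\<^sup>+x\<in>{0<..}. f x \<partial>lborel) = (\<integral>\<^sup>+w. f (exp w) * exp w \<partial>lborel)"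
    by (rule nn_integral_exp_substitution) simp
  also have "\<dots> = \<bar>a\<bar> * (\<integral>\<^sup>+w. f (exp (ln c + a * w)) * exp (ln c + a * w) \<partial>lborel)"
    by (rule nn_integral_real_affine) (use a in auto)
  also have "\<dots> = (\<integral>\<^sup>+w. \<bar>a\<bar> * (f (exp (ln c + a * w)) * exp (ln c + a * w)) \<partial>lborel)"
    by (rule nn_integral_cmult[symmetric]) simp
  also have "\<dots> = (\<integral>\<^sup>+w. (f (c * exp w powr a) * ennreal (c * \<bar>a\<bar> * exp w powr (a - 1))) * exp w \<partial>lborel)"
  proof (intro nn_integral_cong)
    fix w
    have 1: "exp (ln c + a * w) = c * exp w powr a" using c by (simp add: exp_add powr_def mult.commute)
    have 2: "ennreal (c * \<bar>a\<bar> * exp w powr (a - 1)) * exp w = ennreal (\<bar>a\<bar> * (c * exp w powr a))"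
      using c by (simp add: ennreal_mult'[symmetric] powr_def exp_diff[symmetric] exp_add[symmetric] algebra_simps)
    show "\<bar>a\<bar> * (f (exp (ln c + a * w)) * exp (ln c + a * w)) =
       (f (c * exp w powr a) * ennreal (c * \<bar>a\<bar> * exp w powr (a - 1))) * exp w"
      unfolding mult.assoc[of "f (c * exp w powr a)"] 2 unfolding 1 using c by (simp add: ennreal_mult' mult.left_commute)
  qed
  also have "\<dots> = (\<integral>\<^sup>+y\<in>{0<..}. f (c * y powr a) * ennreal (c * \<bar>a\<bar> * y powr (a - 1)) \<partial>lborel)"
    by (rule nn_integral_exp_substitution[symmetric]) simp
  finally show ?thesis .
qed

text \<open>Read from right to left, it writes a negative power of \<open>c\<close> as a mixture of
  exponentials in \<open>c\<close>; this is how powers of D_1 are brought to its Laplace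
  transform.\<close>

lemma nn_integral_Gamma:
  assumes "0 < (q::real)" "0 < c"
  shows "(\<integral>\<^sup>+z\<in>{0<..}. ennreal (z powr (q - 1) * exp (- (c * z))) \<partial>lborel) = ennreal (Gamma q * c powr (- q))"
proof -
  have "ennreal (Gamma q) = (\<integral>\<^sup>+z. ennreal (indicator {0..} z * z powr (q - 1) / exp z) \<partial>lborel)"
    by (rule Gamma_conv_nn_integral_real) fact
  also have "\<dots> = (\<integral>\<^sup>+z\<in>{0<..}. ennreal (z powr (q - 1) * exp (- z)) \<partial>lborel)"
    by (intro nn_integral_cong_AE AE_I[of _ _ "{0}"])
       (auto simp: exp_minus field_simps split: split_indicator)
  also have "\<dots> = (\<integral>\<^sup>+z\<in>{0<..}. ennreal ((c * z powr 1) powr (q - 1) * exp (- (c * z powr 1))) * ennreal (c * \<bar>1\<bar> * z powr (1 - 1)) \<partial>lborel)"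
    by (rule nn_integral_powr_substitution) (use assms in auto)
  also have "\<dots> = (\<integral>\<^sup>+z\<in>{0<..}. ennreal (c powr q) * ennreal (z powr (q - 1) * exp (- (c * z))) \<partial>lborel)"
  proof (intro nn_integral_cong)
    fix z :: real
    show "ennreal ((c * z powr 1) powr (q - 1) * exp (- (c * z powr 1))) * ennreal (c * \<bar>1\<bar> * z powr (1 - 1)) * indicator {0<..} z
      = ennreal (c powr q) * ennreal (z powr (q - 1) * exp (- (c * z))) * indicator {0<..} z"
    proof (cases "z > 0")
      case True
      then have "(c * z) powr (q - 1) * exp (- (c * z)) * c = c powr q * (z powr (q - 1) * exp (- (c * z)))"
        using assms by (simp add: powr_mult powr_diff)
      then show ?thesis using True assms by (simp add: ennreal_mult'[symmetric] ennreal_mult''[symmetric])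
    qed simp
  qed
  also have "\<dots> = ennreal (c powr q) * (\<integral>\<^sup>+z\<in>{0<..}. ennreal (z powr (q - 1) * exp (- (c * z))) \<partial>lborel)"
    by (simp add: mult.assoc nn_integral_cmult)
  finally have *: "ennreal (Gamma q) = ennreal (c powr q) * (\<integral>\<^sup>+z\<in>{0<..}. ennreal (z powr (q - 1) * exp (- (c * z))) \<partial>lborel)" .
  have "ennreal (Gamma q * c powr (- q)) = ennreal (c powr (- q)) * ennreal (Gamma q)"
    by (simp add: ennreal_mult'[symmetric] ennreal_mult''[symmetric] mult.commute)
  also have "\<dots> = ennreal (c powr (- q) * c powr q) * (\<integral>\<^sup>+z\<in>{0<..}. ennreal (z powr (q - 1) * exp (- (c * z))) \<partial>lborel)"
    unfolding * by (simp add: ennreal_mult' mult.assoc)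
  also have "c powr (- q) * c powr q = 1" using assms by (simp add: powr_minus)
  finally show ?thesis by simp
qed

text \<open>The substitution \<open>y = z powr b\<close> reduces to the case \<open>b = 1\<close>.
  It serves twice: with \<open>b = \<beta>\<close> for the negative moments of D_1, whose Laplace
  transform is a stretched exponential, and with \<open>b = \<alpha>\<close> for the integral of the
  stable characteristic function.\<close>

lemma nn_integral_stretched_Gamma:
  assumes "0 < (q::real)" "0 < c" "0 < b"
  shows "(\<integral>\<^sup>+z\<in>{0<..}. ennreal (z powr (q - 1) * exp (- (c * z powr b))) \<partial>lborel) =
    ennreal (Gamma (q / b) / b * c powr (- (q / b)))"
proof -
  have "(\<integral>\<^sup>+z\<in>{0<..}. ennreal (z powr (q - 1) * exp (- (c * z powr b))) \<partial>lborel)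
    = (\<integral>\<^sup>+y\<in>{0<..}. ennreal ((1 * y powr (1/b)) powr (q - 1) * exp (- (c * (1 * y powr (1/b)) powr b))) *
       ennreal (1 * \<bar>1/b\<bar> * y powr (1/b - 1)) \<partial>lborel)"
    by (rule nn_integral_powr_substitution) (use assms in auto)
  also have "\<dots> = (\<integral>\<^sup>+y\<in>{0<..}. ennreal (1/b) * ennreal (y powr (q / b - 1) * exp (- (c * y))) \<partial>lborel)"
  proof (intro nn_integral_cong)
    fix y :: real
    show "ennreal ((1 * y powr (1/b)) powr (q - 1) * exp (- (c * (1 * y powr (1/b)) powr b))) *
       ennreal (1 * \<bar>1/b\<bar> * y powr (1/b - 1)) * indicator {0<..} y =
       ennreal (1/b) * ennreal (y powr (q / b - 1) * exp (- (c * y))) * indicator {0<..} y"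
    proof (cases "y > 0")
      case True
      have "y powr (1/b * (q-1)) * y powr (1/b - 1) = y powr (q / b - 1)"
        unfolding powr_add[symmetric] by (rule arg_cong[where f="(powr) y"]) (use assms in \<open>simp add: field_simps\<close>)
      then show ?thesis using assms True
        by (simp add: ennreal_mult'[symmetric] ennreal_mult''[symmetric] powr_powr field_simps)
    qed simp
  qed
  also have "\<dots> = ennreal (1/b) * (\<integral>\<^sup>+y\<in>{0<..}. ennreal (y powr (q / b - 1) * exp (- (c * y))) \<partial>lborel)"
    by (simp add: mult.assoc nn_integral_cmult)
  also have "\<dots> = ennreal (1/b) * ennreal (Gamma (q / b) * c powr (- (q / b)))"
    by (subst nn_integral_Gamma) (use assms in auto)
  also have "\<dots> = ennreal (Gamma (q / b) / b * c powr (- (q / b)))"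
    using assms by (simp add: ennreal_mult'[symmetric])
  finally show ?thesis .
qed

section \<open>The law of the stable subordinator and the Mittag-Leffler function\<close>

text \<open>Apart from sign and measurability, \<open>subordinator_density\<close> says nothing
  about \<open>g\<close> on the non-positive half-line; the indicator discards that part, and what
  remains is the law of D_1.\<close>

definition subordinator_law :: "(real \<Rightarrow> real) \<Rightarrow> real measure" where
  "subordinator_law g = density lborel (\<lambda>r. ennreal (g r) * indicator {0<..} r)"

lemma space_subordinator_law [simp]: "space (subordinator_law g) = UNIV"
  and sets_subordinator_law [simp, measurable_cong]: "sets (subordinator_law g) = sets borel"
  by (auto simp: subordinator_law_def)

lemma nn_integral_subordinator_law:
  assumes "g \<in> borel_measurable borel" "F \<in> borel_measurable borel"
  shows "(\<integral>\<^sup>+r. F r \<partial>subordinator_law g) = (\<integral>\<^sup>+r\<in>{0<..}. F r * ennreal (g r) \<partial>lborel)"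
  using assms unfolding subordinator_law_def
  by (subst nn_integral_density) (auto intro!: nn_integral_cong simp: ac_simps)

locale subordinator =
  fixes \<beta> :: real and g :: "real \<Rightarrow> real"
  assumes beta: "0 < \<beta>" "\<beta> < 1" and g: "subordinator_density \<beta> g"
begin

lemma g_meas [measurable]: "g \<in> borel_measurable borel"
  and g_nonneg: "0 \<le> g r"
  using g by (auto simp: subordinator_density_def)

lemma subordinator_law_Laplace:
  assumes "0 \<le> l"
  shows "(\<integral>\<^sup>+r. ennreal (exp (- l * r)) \<partial>subordinator_law g) = ennreal (exp (- (l powr \<beta>)))"
proof -
  have "(\<integral>\<^sup>+r. ennreal (exp (- l * r)) \<partial>subordinator_law g) = (\<integral>\<^sup>+ r\<in>{0<..}. ennreal (exp (- l * r) * g r) \<partial>lborel)"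
    by (subst nn_integral_subordinator_law) (simp_all add: ennreal_mult' )
  then show ?thesis using g assms by (simp add: subordinator_density_def)
qed

lemma prob_space_subordinator_law: "prob_space (subordinator_law g)"
proof
  \<comment> \<open>The Laplace transform at 0 is the total mass, and
    \<open>0 powr \<beta> = 0\<close>.\<close>
  show "emeasure (subordinator_law g) (space (subordinator_law g)) = 1"
    using subordinator_law_Laplace[of 0] by simp
qed

sublocale law: prob_space "subordinator_law g"
  by (rule prob_space_subordinator_law)

lemma AE_subordinator_law_pos: "AE r in subordinator_law g. 0 < r"
  unfolding subordinator_law_def by (subst AE_density) (auto split: split_indicator_asm)

text \<open>Express \<open>Gamma q * r powr (- q)\<close> by the integral of
  \<open>z powr (q - 1) * exp (- (r * z))\<close> and exchange with the expectation: the Laplace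
  transform \<open>exp (- (z powr \<beta>))\<close> appears, and a stretched Gamma integral is
  left.\<close>

lemma nn_integral_subordinator_law_neg_moment:
  assumes q: "0 < q"
  shows "(\<integral>\<^sup>+r. ennreal (r powr (- q)) \<partial>subordinator_law g) = ennreal (Gamma (q / \<beta>) / (\<beta> * Gamma q))"
proof -
  have "ennreal (Gamma q) * (\<integral>\<^sup>+r. ennreal (r powr (- q)) \<partial>subordinator_law g)
     = (\<integral>\<^sup>+r. ennreal (Gamma q * r powr (- q)) \<partial>subordinator_law g)"
    using q by (simp add: ennreal_mult' nn_integral_cmult)
  also have "\<dots> = (\<integral>\<^sup>+r. (\<integral>\<^sup>+z. ennreal (z powr (q - 1) * exp (- (r * z))) * indicator {0<..} z \<partial>lborel) \<partial>subordinator_law g)"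
    by (rule nn_integral_cong_AE) (use AE_subordinator_law_pos q in \<open>auto simp: nn_integral_Gamma\<close>)
  also have "\<dots> = (\<integral>\<^sup>+z. (\<integral>\<^sup>+r. ennreal (z powr (q - 1) * exp (- (r * z))) * indicator {0<..} z \<partial>subordinator_law g) \<partial>lborel)"
    by (rule pair_sigma_finite.Fubini') (auto intro!: pair_sigma_finite.intro law.sigma_finite_measure_axioms lborel.sigma_finite_measure_axioms)
  also have "\<dots> = (\<integral>\<^sup>+z\<in>{0<..}. ennreal (z powr (q - 1) * exp (- (1 * z powr \<beta>))) \<partial>lborel)"
  proof (intro nn_integral_cong)
    fix z :: real
    show "(\<integral>\<^sup>+r. ennreal (z powr (q - 1) * exp (- (r * z))) * indicator {0<..} z \<partial>subordinator_law g)
      = ennreal (z powr (q - 1) * exp (- (1 * z powr \<beta>))) * indicator {0<..} z"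
    proof (cases "z > 0")
      case True
      have "(\<integral>\<^sup>+r. ennreal (exp (- (r * z))) \<partial>subordinator_law g) = ennreal (exp (- (z powr \<beta>)))"
        using subordinator_law_Laplace[of z] True by (simp add: mult.commute)
      then show ?thesis using True by (simp add: ennreal_mult' nn_integral_cmult)
    qed simp
  qed
  also have "\<dots> = ennreal (Gamma (q / \<beta>) / \<beta>)"
    using nn_integral_stretched_Gamma[of q 1 \<beta>] q beta by simp
  finally have *: "ennreal (Gamma q) * (\<integral>\<^sup>+r. ennreal (r powr (- q)) \<partial>subordinator_law g) = ennreal (Gamma (q / \<beta>) / \<beta>)" .
  have G: "Gamma q > 0" using q by simp
  have "(\<integral>\<^sup>+r. ennreal (r powr (- q)) \<partial>subordinator_law g) = ennreal (1 / Gamma q) * (ennreal (Gamma q) * (\<integral>\<^sup>+r. ennreal (r powr (- q)) \<partial>subordinator_law g))"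
    using G by (simp add: mult.assoc[symmetric] ennreal_mult'[symmetric] del: Gamma_real_pos)
  also have "\<dots> = ennreal (Gamma (q / \<beta>) / (\<beta> * Gamma q))"
    unfolding * using G by (simp add: ennreal_mult'[symmetric] mult.commute)
  finally show ?thesis .
qed

text \<open>Integrating \<open>1 - exp (- r z)\<close> against \<open>z powr (- p - 1) * exp (- z)\<close> dominates \<open>r powr p\<close> for
  \<open>r \<ge> 1\<close>, because \<open>1 - exp (- x) \<ge> x * exp (- x)\<close>; the expectation of this integral is known from
  the Laplace transform. Only Gamma integrals occur.\<close>

lemma nn_integral_subordinator_law_pos_moment:
  assumes p: "0 < p" "p < \<beta>"
  shows "(\<integral>\<^sup>+r. ennreal (r powr p) \<partial>subordinator_law g) < \<infinity>"
proof -
  define W where "W r = (\<integral>\<^sup>+z\<in>{0<..}. ennreal (z powr (- p - 1) * exp (- z) * (1 - exp (- (r * z)))) \<partial>lborel)" for r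
  \<comment> \<open>For \<open>r \<ge> 1\<close> one has \<open>1 + r \<le> 2 * r\<close>, and
    \<open>p - 1\<close> is negative, so \<open>(1 + r) powr (p - 1)\<close> is at least
    \<open>(2 * r) powr (p - 1)\<close>; the factor \<open>r\<close> in front then completes
    \<open>r powr p\<close>.\<close>
  define c where "c = Gamma (1 - p) * 2 powr (p - 1)"
  have c: "c > 0" using p beta by (auto simp: c_def)
  have Wm [measurable]: "W \<in> borel_measurable borel" unfolding W_def by measurable
  have lower: "ennreal (c * r powr p) \<le> W r" if r: "r \<ge> 1" for r
  proof -
    have "ennreal (r * (Gamma (1 - p) * (1 + r) powr (- (1 - p)))) =
       ennreal r * (\<integral>\<^sup>+z\<in>{0<..}. ennreal (z powr (1 - p - 1) * exp (- ((1 + r) * z))) \<partial>lborel)"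
      using r p beta by (subst nn_integral_Gamma) (simp_all add: ennreal_mult'[symmetric])
    also have "\<dots> = (\<integral>\<^sup>+z\<in>{0<..}. ennreal (r * (z powr (1 - p - 1) * exp (- ((1 + r) * z)))) \<partial>lborel)"
      using r by (subst nn_integral_cmult[symmetric]) (simp_all add: ennreal_mult' mult.assoc)
    also have "\<dots> \<le> W r"
      unfolding W_def
    proof (intro nn_integral_mono)
      fix z :: real
      show "ennreal (r * (z powr (1 - p - 1) * exp (- ((1 + r) * z)))) * indicator {0<..} z
        \<le> ennreal (z powr (- p - 1) * exp (- z) * (1 - exp (- (r * z)))) * indicator {0<..} z"
      proof (cases "z > 0")
        case True
        have "1 + r * z \<le> exp (r * z)" by (rule exp_ge_add_one_self)
        then have "(r * z) * exp (- (r * z)) \<le> 1 - exp (- (r * z))"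
          by (simp add: exp_minus field_simps)
        then have "z powr (- p - 1) * exp (- z) * ((r * z) * exp (- (r * z))) \<le> z powr (- p - 1) * exp (- z) * (1 - exp (- (r * z)))"
          by (intro mult_left_mono) auto
        moreover have "z powr (- p - 1) * exp (- z) * ((r * z) * exp (- (r * z))) = r * (z powr (1 - p - 1) * exp (- ((1 + r) * z)))"
        proof -
          have 1: "z powr (- p - 1) * z = z powr (1 - p - 1)"
            using True by (simp add: powr_diff powr_minus)
          have 2: "exp (- z) * exp (- (r * z)) = exp (- ((1 + r) * z))"
            by (simp add: exp_add[symmetric] algebra_simps)
          show ?thesis unfolding 1[symmetric] 2[symmetric] by (simp add: ac_simps)
        qed
        ultimately show ?thesis using True by (simp add: ennreal_leI)
      qed simp
    qed
    finally have 1: "ennreal (r * (Gamma (1 - p) * (1 + r) powr (- (1 - p)))) \<le> W r" .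
    have "(2 * r) powr (p - 1) \<le> (1 + r) powr (p - 1)"
      using r p beta by (intro powr_mono2') auto
    then have "r * (Gamma (1 - p) * (2 * r) powr (p - 1)) \<le> r * (Gamma (1 - p) * (1 + r) powr (- (1 - p)))"
      using r p beta by (intro mult_left_mono) auto
    moreover have "r * (Gamma (1 - p) * (2 * r) powr (p - 1)) = c * r powr p"
      using r by (simp add: c_def powr_mult powr_diff)
    ultimately show ?thesis using 1 by (metis ennreal_leI order_trans)
  qed
  have "(\<integral>\<^sup>+r. W r \<partial>subordinator_law g) =
    (\<integral>\<^sup>+z. (\<integral>\<^sup>+r. ennreal (z powr (- p - 1) * exp (- z) * (1 - exp (- (r * z)))) * indicator {0<..} z \<partial>subordinator_law g) \<partial>lborel)"
    unfolding W_def
    by (rule pair_sigma_finite.Fubini') (auto intro!: pair_sigma_finite.intro law.sigma_finite_measure_axioms lborel.sigma_finite_measure_axioms)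
  \<comment> \<open>The expectation of \<open>1 - exp (- r z)\<close> is
    \<open>1 - exp (- (z powr \<beta>))\<close>, hence at most \<open>z powr \<beta>\<close>. The
    remaining integrand is integrable at 0 exactly because \<open>p < \<beta>\<close>.\<close>
  also have "\<dots> \<le> (\<integral>\<^sup>+z\<in>{0<..}. ennreal (z powr (\<beta> - p - 1) * exp (- (1 * z))) \<partial>lborel)"
  proof (intro nn_integral_mono)
    fix z :: real
    show "(\<integral>\<^sup>+r. ennreal (z powr (- p - 1) * exp (- z) * (1 - exp (- (r * z)))) * indicator {0<..} z \<partial>subordinator_law g)
      \<le> ennreal (z powr (\<beta> - p - 1) * exp (- (1 * z))) * indicator {0<..} z"
    proof (cases "z > 0")
      case True
      have L: "(\<integral>\<^sup>+r. ennreal (exp (- (r * z))) \<partial>subordinator_law g) = ennreal (exp (- (z powr \<beta>)))"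
        using True subordinator_law_Laplace[of z] by (simp add: mult.commute)
      have "(\<integral>\<^sup>+r. ennreal (1 - exp (- (r * z))) \<partial>subordinator_law g) = (\<integral>\<^sup>+r. 1 - ennreal (exp (- (r * z))) \<partial>subordinator_law g)"
        by (intro nn_integral_cong) (simp add: ennreal_minus[symmetric])
      also have "\<dots> = 1 - ennreal (exp (- (z powr \<beta>)))"
        using AE_subordinator_law_pos
        by (subst nn_integral_diff) (use True law.emeasure_space_1 in \<open>auto simp: L\<close>)
      also have "\<dots> = ennreal (1 - exp (- (z powr \<beta>)))"
        by (simp add: ennreal_minus[symmetric])
      also have "\<dots> \<le> ennreal (z powr \<beta>)"
        using exp_ge_add_one_self[of "- (z powr \<beta>)"] by (intro ennreal_leI) simp
      finally have *: "(\<integral>\<^sup>+r. ennreal (1 - exp (- (r * z))) \<partial>subordinator_law g) \<le> ennreal (z powr \<beta>)" .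
      have "(\<integral>\<^sup>+r. ennreal (z powr (- p - 1) * exp (- z) * (1 - exp (- (r * z)))) * indicator {0<..} z \<partial>subordinator_law g)
        = ennreal (z powr (- p - 1) * exp (- z)) * (\<integral>\<^sup>+r. ennreal (1 - exp (- (r * z))) \<partial>subordinator_law g)"
        using True by (simp add: ennreal_mult'[where b="1 - _"] nn_integral_cmult)
      also have "\<dots> \<le> ennreal (z powr (- p - 1) * exp (- z)) * ennreal (z powr \<beta>)"
        by (rule mult_left_mono[OF *]) simp
      also have "\<dots> = ennreal (z powr (\<beta> - p - 1) * exp (- (1 * z)))"
        using True by (simp add: ennreal_mult'[symmetric] powr_diff powr_minus powr_mult_base field_simps)
      finally show ?thesis using True by simp
    qed simp
  qed
  also have "\<dots> < \<infinity>"
    using nn_integral_Gamma[of "\<beta> - p" 1] p by simp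
  finally have fin: "(\<integral>\<^sup>+r. W r \<partial>subordinator_law g) < \<infinity>" .
  have "(\<integral>\<^sup>+r. ennreal (r powr p) \<partial>subordinator_law g) \<le> (\<integral>\<^sup>+r. 1 + ennreal (1 / c) * W r \<partial>subordinator_law g)"
  proof (rule nn_integral_mono_AE, use AE_subordinator_law_pos in eventually_elim)
    fix r :: real assume "0 < r"
    show "ennreal (r powr p) \<le> 1 + ennreal (1 / c) * W r"
    proof (cases "r \<ge> 1")
      case True
      have "ennreal (r powr p) = ennreal (1 / c) * ennreal (c * r powr p)"
        using c by (simp add: ennreal_mult'[symmetric])
      also have "\<dots> \<le> ennreal (1 / c) * W r"
        by (intro mult_left_mono lower True) simp
      finally show ?thesis by (simp add: add_increasing)
    next
      case False
      then have "r powr p \<le> 1" using \<open>0 < r\<close> p by (intro powr_le1) auto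
      then have "ennreal (r powr p) \<le> 1" using ennreal_leI by fastforce
      then show ?thesis by (simp add: add_increasing2)
    qed
  qed
  also have "\<dots> = 1 + ennreal (1 / c) * (\<integral>\<^sup>+r. W r \<partial>subordinator_law g)"
    using law.emeasure_space_1 by (simp add: nn_integral_add nn_integral_cmult)
  also have "\<dots> < \<infinity>" using fin by (simp add: ennreal_mult_less_top)
  finally show ?thesis .
qed

text \<open>This is the identity in law of E_t and (t / D_1)^\<beta>. The prefactor in
  \<open>inverse_subordinator_density\<close> is the reciprocal of the Jacobian of that map, so only
  \<open>g\<close> survives.\<close>

lemma nn_integral_inverse_subordinator_density:
  assumes [measurable]: "F \<in> borel_measurable borel" and t: "t > 0"
  shows "(\<integral>\<^sup>+s\<in>{0<..}. F s * ennreal (inverse_subordinator_density \<beta> g t s) \<partial>lborel) =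
    (\<integral>\<^sup>+r. F (t powr \<beta> * r powr (- \<beta>)) \<partial>subordinator_law g)"
proof -
  have [measurable]: "inverse_subordinator_density \<beta> g t \<in> borel_measurable borel"
    unfolding inverse_subordinator_density_def by measurable
  have "(\<integral>\<^sup>+s\<in>{0<..}. F s * ennreal (inverse_subordinator_density \<beta> g t s) \<partial>lborel) =
   (\<integral>\<^sup>+y\<in>{0<..}. (F (t powr \<beta> * y powr (-\<beta>)) * ennreal (inverse_subordinator_density \<beta> g t (t powr \<beta> * y powr (-\<beta>)))) *
      ennreal (t powr \<beta> * \<bar>-\<beta>\<bar> * y powr (-\<beta> - 1)) \<partial>lborel)"
    by (rule nn_integral_powr_substitution) (use beta t in auto)
  also have "\<dots> = (\<integral>\<^sup>+y\<in>{0<..}. F (t powr \<beta> * y powr (-\<beta>)) * ennreal (g y) \<partial>lborel)"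
  proof (intro nn_integral_cong)
    fix y :: real
    show "(F (t powr \<beta> * y powr (-\<beta>)) * ennreal (inverse_subordinator_density \<beta> g t (t powr \<beta> * y powr (-\<beta>)))) *
      ennreal (t powr \<beta> * \<bar>-\<beta>\<bar> * y powr (-\<beta> - 1)) * indicator {0<..} y = F (t powr \<beta> * y powr (-\<beta>)) * ennreal (g y) * indicator {0<..} y"
    proof (cases "y > 0")
      case True
      have 1: "(t powr \<beta> * y powr (-\<beta>)) powr (- 1 / \<beta>) = y / t"
      proof -
        have "t powr \<beta> * y powr (-\<beta>) = (t / y) powr \<beta>"
          using True t by (simp add: powr_divide powr_minus_divide)
        then show ?thesis using True t beta by (simp add: powr_powr powr_minus)
      qed
      have 2: "(t powr \<beta> * y powr (-\<beta>)) powr (- 1 - 1 / \<beta>) = t powr (- \<beta> - 1) * y powr (\<beta> + 1)"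
        using True t beta by (simp add: powr_mult powr_powr algebra_simps)
      have "inverse_subordinator_density \<beta> g t (t powr \<beta> * y powr (-\<beta>)) * (t powr \<beta> * \<beta> * y powr (-\<beta> - 1)) = 
         (t * t powr (- \<beta> - 1) * t powr \<beta>) * (y powr (\<beta> + 1) * y powr (-\<beta> - 1)) * g y"
        unfolding inverse_subordinator_density_def 1 2 using beta t by simp
      also have "t * t powr (- \<beta> - 1) * t powr \<beta> = 1"
        using t by (simp add: powr_diff powr_minus)
      also have "y powr (\<beta> + 1) * y powr (-\<beta> - 1) = 1"
        using True by (simp add: powr_add[symmetric])
      finally have 3: "inverse_subordinator_density \<beta> g t (t powr \<beta> * y powr (-\<beta>)) * (t powr \<beta> * \<beta> * y powr (-\<beta> - 1)) = g y"
        by simp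
      show ?thesis
        using beta t True by (simp add: mult.assoc ennreal_mult''[symmetric] 3[unfolded mult.assoc])
    qed simp
  qed
  also have "\<dots> = (\<integral>\<^sup>+r. F (t powr \<beta> * r powr (- \<beta>)) \<partial>subordinator_law g)"
    by (rule nn_integral_subordinator_law[symmetric]) auto
  finally show ?thesis .
qed


text \<open>The moment of D_1 of order \<open>- \<beta> * k\<close> is
  \<open>Gamma k / (\<beta> * Gamma (\<beta> * k))\<close>, which the functional equation turns into
  \<open>fact k / Gamma (1 + \<beta> * k)\<close>. At \<open>k = 0\<close> the Gamma function has a
  pole, hence the case distinction.\<close>

lemma power_div_Gamma_eq_moment:
  assumes "0 \<le> z"
  shows "ennreal (z ^ k / Gamma (1 + \<beta> * real k)) =
    (\<integral>\<^sup>+r. ennreal ((z * r powr (- \<beta>)) ^ k / fact k) \<partial>subordinator_law g)"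
proof (cases "k = 0")
  case True
  then show ?thesis using law.emeasure_space_1 by simp
next
  case False
  have q: "\<beta> * real k > 0" using False beta by simp
  have 1: "Gamma (1 + real k) = real k * Gamma (real k)"
    using False by (intro Gamma_plus1[of "real k", unfolded add.commute[of _ 1]]) auto
  have 2: "Gamma (1 + \<beta> * real k) = (\<beta> * real k) * Gamma (\<beta> * real k)"
    using q by (intro Gamma_plus1[of "\<beta> * real k", unfolded add.commute[of _ 1]]) (metis less_le_not_le nonpos_Ints_nonpos)
  have 3: "fact k = Gamma (1 + real k)" by (simp add: Gamma_fact)
  have "(\<integral>\<^sup>+r. ennreal ((z * r powr (- \<beta>)) ^ k / fact k) \<partial>subordinator_law g) =
    (\<integral>\<^sup>+r. ennreal (z ^ k / fact k) * ennreal (r powr (- (\<beta> * real k))) \<partial>subordinator_law g)"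
    using AE_subordinator_law_pos
  proof (intro nn_integral_cong_AE, eventually_elim)
    fix r :: real assume "0 < r"
    then have "(r powr (- \<beta>)) ^ k = r powr (- (\<beta> * real k))"
      by (simp add: powr_powr powr_realpow[symmetric])
    then show "ennreal ((z * r powr (- \<beta>)) ^ k / fact k) = ennreal (z ^ k / fact k) * ennreal (r powr (- (\<beta> * real k)))"
      using assms by (simp add: ennreal_mult'[symmetric] power_mult_distrib)
  qed
  also have "\<dots> = ennreal (z ^ k / fact k) * ennreal (Gamma (\<beta> * real k / \<beta>) / (\<beta> * Gamma (\<beta> * real k)))"
    using q by (simp add: nn_integral_cmult nn_integral_subordinator_law_neg_moment)
  also have "\<dots> = ennreal (z ^ k / fact k * (Gamma (real k) / (\<beta> * Gamma (\<beta> * real k))))"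
    using beta assms by (simp add: ennreal_mult'[symmetric])
  also have "z ^ k / fact k * (Gamma (real k) / (\<beta> * Gamma (\<beta> * real k))) = z ^ k / Gamma (1 + \<beta> * real k)"
  proof -
    have "Gamma (real k) \<noteq> 0" using False Gamma_real_pos[of "real k"] by force
    then show ?thesis unfolding 2 3 1 using False beta by (simp add: field_simps del: Gamma_eq_zero_iff)
  qed
  finally show ?thesis by simp
qed

text \<open>Cutting the Gamma integral down to \<open>x \<ge> L\<close> gives \<open>Gamma (1 +
  \<beta> * k) \<ge> L powr (\<beta> * k) * exp (- L)\<close>. With
  \<open>L powr \<beta> = 2 * z + 1\<close> this outgrows \<open>z ^ k\<close> by a geometric factor
  of ratio at most 1/2.\<close>

lemma summable_power_div_Gamma:
  assumes "0 \<le> z"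
  shows "summable (\<lambda>k. z ^ k / Gamma (1 + \<beta> * real k))"
proof -
  define L where "L = (2 * z + 1) powr (1 / \<beta>)"
  have L: "L > 0" "L powr \<beta> = 2 * z + 1" using assms beta by (auto simp: L_def powr_powr)
  have lb: "Gamma (1 + \<beta> * real k) \<ge> exp (- L) * (2 * z + 1) ^ k" for k
  proof -
    have "ennreal (exp (- L) * (2 * z + 1) ^ k) = ennreal (L powr (\<beta> * real k)) * ennreal (exp (- L))"
      using L assms by (simp add: ennreal_mult'[symmetric] powr_powr[symmetric] powr_realpow mult.commute)
    also have "ennreal (exp (- L)) = (\<integral>\<^sup>+x\<in>{L..}. ennreal (exp (- x)) \<partial>lborel)"
    proof -
      have "(\<integral>\<^sup>+x\<in>{L..}. ennreal (exp (- x)) \<partial>lborel) = ennreal (0 - (- exp (- L)))"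
        by (rule nn_integral_FTC_atLeast)
           (auto intro!: derivative_eq_intros tendsto_minus_cancel_left[THEN iffD1] filterlim_compose[OF exp_at_bot] filterlim_uminus_at_bot_at_top)
      then show ?thesis by (simp only: diff_0 minus_minus)
    qed
    also have "ennreal (L powr (\<beta> * real k)) * \<dots> = (\<integral>\<^sup>+x\<in>{L..}. ennreal (L powr (\<beta> * real k) * exp (- x)) \<partial>lborel)"
      by (simp add: ennreal_mult' nn_integral_cmult mult.assoc)
    also have "\<dots> \<le> (\<integral>\<^sup>+x\<in>{0<..}. ennreal (x powr (1 + \<beta> * real k - 1) * exp (- (1 * x))) \<partial>lborel)"
      using L beta by (intro nn_integral_mono) (auto intro!: ennreal_leI mult_right_mono powr_mono2 split: split_indicator)
    also have "\<dots> = ennreal (Gamma (1 + \<beta> * real k))"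
      using nn_integral_Gamma[of "1 + \<beta> * real k" 1] beta
      by (simp add: add_pos_nonneg)
    finally show ?thesis
      using beta Gamma_real_pos[of "1 + \<beta> * real k"] by (simp add: ennreal_le_iff add_pos_nonneg less_imp_le)
  qed
  show ?thesis
  proof (rule summable_comparison_test')
    show "summable (\<lambda>k. exp L * (1 / 2) ^ k :: real)" by (intro summable_mult summable_geometric) auto
    fix k :: nat
    have G: "Gamma (1 + \<beta> * real k) > 0" using beta by (auto intro!: Gamma_real_pos add_pos_nonneg)
    have "z ^ k / Gamma (1 + \<beta> * real k) \<le> z ^ k / (exp (- L) * (2 * z + 1) ^ k)"
      using lb[of k] G assms by (intro divide_left_mono) auto
    also have "\<dots> = exp L * (z / (2 * z + 1)) ^ k"
      by (simp add: exp_minus power_divide field_simps)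
    also have "\<dots> \<le> exp L * (1 / 2) ^ k"
      using assms by (intro mult_left_mono power_mono) (auto simp: field_simps)
    finally show "norm (z ^ k / Gamma (1 + \<beta> * real k)) \<le> exp L * (1 / 2) ^ k"
      using assms G by simp
  qed
qed

text \<open>The terms of the exponential series have absolute moments
  \<open>z ^ k / Gamma (1 + \<beta> * k)\<close>, the Mittag-Leffler coefficients at
  \<open>+ z\<close>. Their summability justifies exchanging series and expectation, and the
  alternating signs are put back afterwards.\<close>

lemma mittag_leffler_eq_Laplace:
  assumes "0 \<le> z"
  shows "mittag_leffler \<beta> (- z) = (\<integral>r. exp (- (z * r powr (- \<beta>))) \<partial>subordinator_law g)"
proof -
  define f where "f k r = (- (z * r powr (- \<beta>))) ^ k / fact k" for k :: nat and r :: real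
  have G: "Gamma (1 + \<beta> * real k) > 0" for k using beta by (auto intro!: Gamma_real_pos add_pos_nonneg)
  have [measurable]: "f k \<in> borel_measurable borel" for k unfolding f_def by measurable
  have nf: "norm (f k r) = (z * r powr (- \<beta>)) ^ k / fact k" for k r
    using assms by (simp add: f_def power_abs)
  have bnd: "(\<integral>\<^sup>+r. ennreal (norm (f k r)) \<partial>subordinator_law g) = ennreal (z ^ k / Gamma (1 + \<beta> * real k))" for k
    unfolding nf power_div_Gamma_eq_moment[OF assms] ..
  have int: "integrable (subordinator_law g) (f k)" for k
    by (rule integrableI_bounded) (auto simp: bnd simp del: real_norm_def)
  have inorm: "(\<integral>r. norm (f k r) \<partial>subordinator_law g) = z ^ k / Gamma (1 + \<beta> * real k)" for k
    using bnd[of k] G[of k] assms by (subst integral_eq_nn_integral) auto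
  have fsign: "f k r = (-1) ^ k * norm (f k r)" for k r
    unfolding nf by (simp add: f_def power_minus[of "z * _"])
  have iv: "(\<integral>r. f k r \<partial>subordinator_law g) = (- z) ^ k / Gamma (1 + \<beta> * real k)" for k
    by (subst fsign) (simp add: inorm power_minus[of z] del: real_norm_def)
  have "(\<lambda>k. integral\<^sup>L (subordinator_law g) (f k)) sums (\<integral>r. (\<Sum>k. f k r) \<partial>subordinator_law g)"
  proof (rule sums_integral[OF int])
    show "AE r in subordinator_law g. summable (\<lambda>k. norm (f k r))"
      unfolding nf using summable_exp_generic by (intro AE_I2) (simp add: scaleR_conv_of_real divide_inverse mult.commute summable_exp)
    show "summable (\<lambda>k. \<integral>r. norm (f k r) \<partial>subordinator_law g)"
      unfolding inorm by (rule summable_power_div_Gamma) fact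
  qed
  moreover have "(\<Sum>k. f k r) = exp (- (z * r powr (- \<beta>)))" for r
    unfolding f_def exp_def by (simp add: divide_inverse mult.commute)
  ultimately show ?thesis unfolding mittag_leffler_def iv by (simp add: sums_iff)
qed

lemma ennreal_mittag_leffler:
  assumes "0 \<le> z"
  shows "ennreal (mittag_leffler \<beta> (- z)) = (\<integral>\<^sup>+r. ennreal (exp (- (z * r powr (- \<beta>)))) \<partial>subordinator_law g)"
  unfolding mittag_leffler_eq_Laplace[OF assms]
  by (rule nn_integral_eq_integral[symmetric])
     (auto intro!: law.integrable_const_bound[where B=1] simp: assms)

lemma mittag_leffler_pos:
  assumes "0 \<le> z"
  shows "0 < mittag_leffler \<beta> (- z)"
proof -
  have "(\<integral>\<^sup>+r. ennreal (exp (- (z * r powr (- \<beta>)))) \<partial>subordinator_law g) \<noteq> 0"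
    by (subst nn_integral_0_iff_AE) auto
  then have "ennreal (mittag_leffler \<beta> (- z)) \<noteq> 0" by (simp add: ennreal_mittag_leffler[OF assms])
  then show ?thesis by (metis ennreal_neg linorder_not_less)
qed

text \<open>Measurability is read off the Laplace representation as a parameter integral; the
  indicator confines \<open>z\<close> to the range where that representation is available.\<close>

lemma mittag_leffler_measurable [measurable]:
  "(\<lambda>z. mittag_leffler \<beta> (- z) * indicator {0<..} z) \<in> borel_measurable borel"
proof -
  have "(\<lambda>z. mittag_leffler \<beta> (- z) * indicator {0<..} z) =
    (\<lambda>z. enn2real (\<integral>\<^sup>+r. ennreal (exp (- (z * r powr (- \<beta>)))) \<partial>subordinator_law g) * indicator {0<..} z)"
    using mittag_leffler_pos
    by (auto simp: fun_eq_iff ennreal_mittag_leffler[symmetric] less_imp_le split: split_indicator)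
  then show ?thesis by simp
qed

text \<open>The square of the Laplace transform is the transform of a sum over two independent
  copies of D_1, and integrating out \<open>z\<close> first is a Gamma integral. The double integral
  on the right is the form in which the kernel produces this constant.\<close>

lemma nn_integral_mittag_leffler_sq:
  assumes q: "0 < q"
  shows "(\<integral>\<^sup>+z\<in>{0<..}. ennreal (z powr (q - 1) * (mittag_leffler \<beta> (- z))\<^sup>2) \<partial>lborel) =
    (\<integral>\<^sup>+r. \<integral>\<^sup>+r'. ennreal (Gamma q * (r powr (- \<beta>) + r' powr (- \<beta>)) powr (- q)) \<partial>subordinator_law g \<partial>subordinator_law g)"
proof -
  let ?L = "subordinator_law g"
  interpret LL: pair_sigma_finite ?L lborel
    by (intro pair_sigma_finite.intro law.sigma_finite_measure_axioms lborel.sigma_finite_measure_axioms)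
  have "(\<integral>\<^sup>+z\<in>{0<..}. ennreal (z powr (q - 1) * (mittag_leffler \<beta> (- z))\<^sup>2) \<partial>lborel) =
    (\<integral>\<^sup>+z. (\<integral>\<^sup>+r. (\<integral>\<^sup>+r'. ennreal (z powr (q - 1) * exp (- ((r powr (- \<beta>) + r' powr (- \<beta>)) * z))) * indicator {0<..} z \<partial>?L) \<partial>?L) \<partial>lborel)"
  proof (intro nn_integral_cong)
    fix z :: real
    show "ennreal (z powr (q - 1) * (mittag_leffler \<beta> (- z))\<^sup>2) * indicator {0<..} z =
      (\<integral>\<^sup>+r. (\<integral>\<^sup>+r'. ennreal (z powr (q - 1) * exp (- ((r powr (- \<beta>) + r' powr (- \<beta>)) * z))) * indicator {0<..} z \<partial>?L) \<partial>?L)"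
    proof (cases "z > 0")
      case True
      have e: "ennreal (z powr (q - 1) * exp (- ((r powr (- \<beta>) + r' powr (- \<beta>)) * z))) =
        ennreal (z powr (q - 1)) * ennreal (exp (- (z * r powr (- \<beta>)))) * ennreal (exp (- (z * r' powr (- \<beta>))))" for r r'
        by (simp add: ennreal_mult'[symmetric] exp_add[symmetric] algebra_simps)
      have "(\<integral>\<^sup>+r. (\<integral>\<^sup>+r'. ennreal (z powr (q - 1) * exp (- ((r powr (- \<beta>) + r' powr (- \<beta>)) * z))) \<partial>?L) \<partial>?L) =
        (\<integral>\<^sup>+r. ennreal (z powr (q - 1)) * ennreal (exp (- (z * r powr (- \<beta>)))) * ennreal (mittag_leffler \<beta> (- z)) \<partial>?L)"
        unfolding e using True by (subst nn_integral_cmult) (auto simp: ennreal_mittag_leffler)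
      also have "\<dots> = ennreal (z powr (q - 1)) * ennreal (mittag_leffler \<beta> (- z)) * ennreal (mittag_leffler \<beta> (- z))"
        using True by (subst nn_integral_multc, simp, subst nn_integral_cmult) (auto simp: ennreal_mittag_leffler)
      finally show ?thesis using True mittag_leffler_pos[of z]
        by (simp add: ennreal_mult'[symmetric] ennreal_mult''[symmetric] power2_eq_square mult.assoc)
    qed simp
  qed
  also have "\<dots> = (\<integral>\<^sup>+r. (\<integral>\<^sup>+z. (\<integral>\<^sup>+r'. ennreal (z powr (q - 1) * exp (- ((r powr (- \<beta>) + r' powr (- \<beta>)) * z))) * indicator {0<..} z \<partial>?L) \<partial>lborel) \<partial>?L)"
    by (rule LL.Fubini') simp
  also have "\<dots> = (\<integral>\<^sup>+r. (\<integral>\<^sup>+r'. (\<integral>\<^sup>+z. ennreal (z powr (q - 1) * exp (- ((r powr (- \<beta>) + r' powr (- \<beta>)) * z))) * indicator {0<..} z \<partial>lborel) \<partial>?L) \<partial>?L)"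
    by (intro nn_integral_cong LL.Fubini') simp
  also have "\<dots> = (\<integral>\<^sup>+r. (\<integral>\<^sup>+r'. ennreal (Gamma q * (r powr (- \<beta>) + r' powr (- \<beta>)) powr (- q)) \<partial>?L) \<partial>?L)"
    using AE_subordinator_law_pos
  proof (intro nn_integral_cong_AE, eventually_elim)
    fix r :: real assume r: "0 < r"
    show "(\<integral>\<^sup>+r'. (\<integral>\<^sup>+z. ennreal (z powr (q - 1) * exp (- ((r powr (- \<beta>) + r' powr (- \<beta>)) * z))) * indicator {0<..} z \<partial>lborel) \<partial>?L)
      = (\<integral>\<^sup>+r'. ennreal (Gamma q * (r powr (- \<beta>) + r' powr (- \<beta>)) powr (- q)) \<partial>?L)"
      using r q by (intro nn_integral_cong nn_integral_Gamma) (auto intro!: add_pos_nonneg)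
  qed
  finally show ?thesis .
qed

text \<open>From \<open>a * b \<le> (a + b) powr 2\<close> follows
  \<open>(a + b) powr (- q) \<le> (a * b) powr (- (q / 2))\<close>, which separates the two copies.
  What remains is the square of the moment of order \<open>\<beta> * q / 2\<close>, and
  \<open>q < 2\<close> puts this order below \<open>\<beta>\<close>.\<close>

lemma nn_integral_mittag_leffler_sq_finite:
  assumes q: "0 < q" "q < 2"
  shows "(\<integral>\<^sup>+z\<in>{0<..}. ennreal (z powr (q - 1) * (mittag_leffler \<beta> (- z))\<^sup>2) \<partial>lborel) < \<infinity>"
proof -
  let ?L = "subordinator_law g"
  let ?m = "\<integral>\<^sup>+r. ennreal (r powr (\<beta> * q / 2)) \<partial>?L"
  have G: "Gamma q > 0" using q by simp
  have "(\<integral>\<^sup>+r. \<integral>\<^sup>+r'. ennreal (Gamma q * (r powr (- \<beta>) + r' powr (- \<beta>)) powr (- q)) \<partial>?L \<partial>?L)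
    \<le> (\<integral>\<^sup>+r. \<integral>\<^sup>+r'. ennreal (Gamma q) * ennreal (r powr (\<beta> * q / 2)) * ennreal (r' powr (\<beta> * q / 2)) \<partial>?L \<partial>?L)"
    using AE_subordinator_law_pos
  proof (intro nn_integral_mono_AE, eventually_elim)
    fix r :: real assume r: "0 < r"
    show "(\<integral>\<^sup>+r'. ennreal (Gamma q * (r powr (- \<beta>) + r' powr (- \<beta>)) powr (- q)) \<partial>?L)
     \<le> (\<integral>\<^sup>+r'. ennreal (Gamma q) * ennreal (r powr (\<beta> * q / 2)) * ennreal (r' powr (\<beta> * q / 2)) \<partial>?L)"
      using AE_subordinator_law_pos
    proof (intro nn_integral_mono_AE, eventually_elim)
      fix r' :: real assume r': "0 < r'"
      define a b where "a = r powr (- \<beta>)" and "b = r' powr (- \<beta>)"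
      have ab: "a > 0" "b > 0" using r r' by (auto simp: a_def b_def)
      have "a * b \<le> (a + b) powr 2" using ab by (simp add: power2_eq_square algebra_simps)
      then have "((a + b) powr 2) powr (- (q / 2)) \<le> (a * b) powr (- (q / 2))"
        using ab q by (intro powr_mono2') auto
      then have "(a + b) powr (- q) \<le> a powr (- (q / 2)) * b powr (- (q / 2))"
        using ab by (simp add: powr_powr powr_mult del: powr_numeral)
      also have "a powr (- (q / 2)) = r powr (\<beta> * q / 2)" by (simp add: a_def powr_powr)
      also have "b powr (- (q / 2)) = r' powr (\<beta> * q / 2)" by (simp add: b_def powr_powr)
      finally have "(a + b) powr (- q) \<le> r powr (\<beta> * q / 2) * r' powr (\<beta> * q / 2)" .
      then have "Gamma q * (a + b) powr (- q) \<le> Gamma q * (r powr (\<beta> * q / 2) * r' powr (\<beta> * q / 2))"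
        using G by (intro mult_left_mono) auto
      then show "ennreal (Gamma q * (r powr (- \<beta>) + r' powr (- \<beta>)) powr (- q)) \<le> ennreal (Gamma q) * ennreal (r powr (\<beta> * q / 2)) * ennreal (r' powr (\<beta> * q / 2))"
        using G by (simp add: a_def b_def ennreal_mult''[symmetric] mult.assoc ennreal_leI)
    qed
  qed
  also have "\<dots> = ennreal (Gamma q) * ?m * ?m"
    by (simp add: nn_integral_cmult nn_integral_multc)
  also have "\<dots> < \<infinity>"
    using nn_integral_subordinator_law_pos_moment[of "\<beta> * q / 2"] q beta by (simp add: ennreal_mult_less_top)
  finally show ?thesis using q by (simp add: nn_integral_mittag_leffler_sq)
qed

text \<open>Carries the value over to the Bochner integral that occurs in \<open>C_star\<close>;
  finiteness excludes the default value 0. Positivity holds because the integrand is positive on the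
  unit interval, which is not a null set.\<close>

lemma ennreal_integral_mittag_leffler_sq:
  assumes q: "0 < q" "q < 2"
  shows "ennreal (LINT z:{0<..}|lborel. z powr (q - 1) * (mittag_leffler \<beta> (- z))\<^sup>2) =
      (\<integral>\<^sup>+r. \<integral>\<^sup>+r'. ennreal (Gamma q * (r powr (- \<beta>) + r' powr (- \<beta>)) powr (- q)) \<partial>subordinator_law g \<partial>subordinator_law g)" (is ?eq)
    and "0 < (LINT z:{0<..}|lborel. z powr (q - 1) * (mittag_leffler \<beta> (- z))\<^sup>2)" (is ?pos)
proof -
  let ?f = "\<lambda>z. indicator {0<..} z *\<^sub>R (z powr (q - 1) * (mittag_leffler \<beta> (- z))\<^sup>2)"
  have "?f = (\<lambda>z. z powr (q - 1) * (mittag_leffler \<beta> (- z) * indicator {0<..} z)\<^sup>2)"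
    by (auto simp: fun_eq_iff split: split_indicator)
  also have "\<dots> \<in> borel_measurable borel" by measurable
  finally have meas [measurable]: "?f \<in> borel_measurable borel" .
  have eq: "(\<integral>\<^sup>+z. ennreal (?f z) \<partial>lborel) = (\<integral>\<^sup>+z\<in>{0<..}. ennreal (z powr (q - 1) * (mittag_leffler \<beta> (- z))\<^sup>2) \<partial>lborel)"
    by (auto intro!: nn_integral_cong split: split_indicator)
  have int: "integrable lborel ?f"
  proof (rule integrableI_nonneg)
    show "?f \<in> borel_measurable lborel" unfolding measurable_lborel2 by (rule meas)
    show "(\<integral>\<^sup>+z. ennreal (?f z) \<partial>lborel) < \<infinity>" unfolding eq by (rule nn_integral_mittag_leffler_sq_finite[OF q])
  qed auto
  have *: "ennreal (LINT z:{0<..}|lborel. z powr (q - 1) * (mittag_leffler \<beta> (- z))\<^sup>2) = (\<integral>\<^sup>+z. ennreal (?f z) \<partial>lborel)"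
    unfolding set_lebesgue_integral_def by (intro nn_integral_eq_integral[OF int, symmetric]) auto
  then show ?eq unfolding eq using q by (simp add: nn_integral_mittag_leffler_sq)
  have "(\<integral>\<^sup>+z. ennreal (?f z) \<partial>lborel) \<noteq> 0"
  proof
    assume "(\<integral>\<^sup>+z. ennreal (?f z) \<partial>lborel) = 0"
    moreover have "(\<lambda>z. ennreal (?f z)) \<in> borel_measurable lborel"
      unfolding measurable_lborel2 by (intro measurable_compose[OF meas] measurable_ennreal)
    ultimately have "AE z in lborel. ennreal (?f z) = 0" by (simp only: nn_integral_0_iff_AE)
    then have "AE z in lborel. z \<notin> {0<..<1::real}"
    proof eventually_elim
      fix z assume z: "ennreal (?f z) = 0"
      show "z \<notin> {0<..<1}"
      proof
        assume "z \<in> {0<..<1}"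
        then have "?f z > 0" using mittag_leffler_pos[of z] by simp
        then show False using z by (metis ennreal_eq_0_iff linorder_not_less)
      qed
    qed
    then have "{0<..<1::real} \<in> null_sets lborel" by (subst (asm) AE_iff_null_sets[symmetric]) auto
    then show False by (simp add: null_sets_def)
  qed
  then show ?pos unfolding *[symmetric] by (metis ennreal_neg linorder_not_less)
qed

end

section \<open>Fourier inversion and the stable density\<close>

lemma integral_lborel_affine:
  fixes f :: "'a::euclidean_space \<Rightarrow> 'b::{banach, second_countable_topology}"
  assumes [measurable]: "f \<in> borel_measurable borel" and c: "c \<noteq> 0"
  shows "(\<integral>x. f x \<partial>lborel) = \<bar>c\<bar> ^ DIM('a) *\<^sub>R (\<integral>x. f (t + c *\<^sub>R x) \<partial>lborel)"
proof -
  have "(\<integral>x. f x \<partial>lborel) = (\<integral>x. f x \<partial>density (distr lborel borel (\<lambda>x. t + c *\<^sub>R x)) (\<lambda>_. ennreal (\<bar>c\<bar> ^ DIM('a))))"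
    using lborel_affine[OF c, of t] by simp
  also have "\<dots> = \<bar>c\<bar> ^ DIM('a) *\<^sub>R (\<integral>x. f (t + c *\<^sub>R x) \<partial>lborel)"
    by (simp add: integral_density integral_distr)
  finally show ?thesis .
qed

section \<open>Gaussian densities on a Euclidean space, by factorisation over the
  coordinates\<close>

lemma lborel_euclidean_prod:
  fixes f :: "'a::euclidean_space \<Rightarrow> real \<Rightarrow> 'b::{real_normed_field, banach, second_countable_topology}"
  assumes int: "\<And>b. b \<in> Basis \<Longrightarrow> integrable lborel (f b)"
  shows "integrable lborel (\<lambda>x::'a. \<Prod>b\<in>Basis. f b (x \<bullet> b))" (is ?i)
    and "(\<integral>x. (\<Prod>b\<in>Basis. f b ((x::'a) \<bullet> b)) \<partial>lborel) = (\<Prod>b\<in>Basis. \<integral>r. f b r \<partial>lborel)" (is ?e)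
proof -
  interpret product_sigma_finite "\<lambda>_::'a. lborel :: real measure" by standard
  have m: "(\<lambda>x::'a. \<Prod>b\<in>Basis. f b (x \<bullet> b)) \<in> borel_measurable borel"
  proof (intro borel_measurable_prod)
    fix b :: 'a assume "b \<in> Basis"
    then have [measurable]: "f b \<in> borel_measurable borel" using borel_measurable_integrable[OF int] by simp
    show "(\<lambda>x::'a. f b (x \<bullet> b)) \<in> borel_measurable borel" by measurable
  qed
  have t: "(\<lambda>x. \<Sum>b\<in>Basis. x b *\<^sub>R (b::'a)) \<in> measurable (Pi\<^sub>M Basis (\<lambda>_. lborel)) borel" by measurable
  have cg: "(\<Prod>b\<in>Basis. f b ((\<Sum>c\<in>Basis. x c *\<^sub>R c) \<bullet> b)) = (\<Prod>b\<in>Basis. f b (x b))" for x :: "'a \<Rightarrow> real"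
    by (intro prod.cong) auto
  show ?i
    unfolding lborel_eq[where 'a='a]
    by (subst integrable_distr_eq[OF t m]) (simp add: cg product_integrable_prod int)
  show ?e
    unfolding lborel_eq[where 'a='a]
    by (subst integral_distr[OF t m]) (simp add: cg product_integral_prod int)
qed

text \<open>The product form lets integrals and transforms factor over an orthonormal basis;
  \<open>std_gauss_eq\<close> supplies the radial form.\<close>

definition std_gauss :: "'a::euclidean_space \<Rightarrow> real" where
  "std_gauss x = (\<Prod>b\<in>Basis. std_normal_density (x \<bullet> b))"

lemma std_gauss_eq:
  "std_gauss (x::'a::euclidean_space) = exp (- (norm x)\<^sup>2 / 2) / sqrt (2 * pi) ^ DIM('a)"
proof -
  have "std_gauss x = (\<Prod>b\<in>Basis. exp (- (x \<bullet> b)\<^sup>2 / 2)) / sqrt (2 * pi) ^ DIM('a)"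
    by (simp add: std_gauss_def std_normal_density_def prod_dividef)
  also have "(\<Prod>b\<in>Basis. exp (- (x \<bullet> b)\<^sup>2 / 2)) = exp (\<Sum>b\<in>Basis. - (x \<bullet> b)\<^sup>2 / 2)"
    by (simp add: exp_sum)
  also have "(\<Sum>b\<in>Basis. - (x \<bullet> b)\<^sup>2 / 2) = - (norm x)\<^sup>2 / 2"
    unfolding power2_norm_eq_inner euclidean_inner[of x x]
    by (simp add: power2_eq_square sum_divide_distrib sum_negf)
  finally show ?thesis .
qed

lemma std_gauss_nonneg [simp]: "0 \<le> std_gauss x" and std_gauss_le1: "std_gauss x \<le> 1"
  and std_gauss_measurable [measurable]: "std_gauss \<in> borel_measurable borel"
proof -
  show "0 \<le> std_gauss x" by (simp add: std_gauss_eq)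
  have "1 \<le> sqrt (2 * pi)" using pi_gt3 by simp
  then have "1 \<le> sqrt (2 * pi) ^ DIM('a)" by (rule one_le_power)
  then show "std_gauss x \<le> 1" for x :: 'a
    unfolding std_gauss_eq by (subst divide_le_eq_1_pos) (auto intro: order_trans[OF _ \<open>1 \<le> sqrt (2 * pi) ^ DIM('a)\<close>])
  show "std_gauss \<in> borel_measurable borel" unfolding std_gauss_eq[abs_def] by measurable
qed

lemma integrable_std_gauss [simp]: "integrable lborel std_gauss"
  unfolding std_gauss_def[abs_def] by (intro lborel_euclidean_prod(1)) simp

lemma integral_std_gauss: "(\<integral>x. std_gauss x \<partial>lborel) = 1"
  unfolding std_gauss_def[abs_def] by (subst lborel_euclidean_prod(2)) simp_all

lemma Fourier_std_gauss:
  "(\<integral>x. iexp (\<xi> \<bullet> x) * complex_of_real (std_gauss x) \<partial>lborel) = complex_of_real (exp (- (norm \<xi>)\<^sup>2 / 2))"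
proof -
  have int: "integrable lborel (\<lambda>r. iexp (c * r) * complex_of_real (std_normal_density r))" for c
    by (rule Bochner_Integration.integrable_bound[where f="\<lambda>r. std_normal_density r"]) (auto simp: norm_mult)
  have 1: "(\<integral>r. iexp (c * r) * complex_of_real (std_normal_density r) \<partial>lborel) = complex_of_real (exp (- c\<^sup>2 / 2))" for c
  proof -
    have "complex_of_real (exp (- c\<^sup>2 / 2)) = char std_normal_distribution c"
      by (simp add: char_std_normal_distribution)
    also have "\<dots> = (\<integral>r. std_normal_density r *\<^sub>R iexp (c * r) \<partial>lborel)"
      unfolding char_def by (subst integral_density) auto
    finally show ?thesis by (simp add: scaleR_conv_of_real mult.commute)
  qed
  have "iexp (\<xi> \<bullet> x) * complex_of_real (std_gauss x) = (\<Prod>b\<in>Basis. iexp ((\<xi> \<bullet> b) * (x \<bullet> b)) * complex_of_real (std_normal_density (x \<bullet> b)))" for x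
    unfolding std_gauss_def euclidean_inner[of \<xi> x]
    by (simp add: prod.distrib exp_sum[symmetric] sum_distrib_left)
  then have "(\<integral>x. iexp (\<xi> \<bullet> x) * complex_of_real (std_gauss x) \<partial>lborel) = (\<Prod>b\<in>Basis. complex_of_real (exp (- (\<xi> \<bullet> b)\<^sup>2 / 2)))"
    using lborel_euclidean_prod(2)[of "\<lambda>b r. iexp ((\<xi> \<bullet> b) * r) * complex_of_real (std_normal_density r)"] int
    by (simp add: 1 del: of_real_mult)
  also have "\<dots> = complex_of_real (exp (- (norm \<xi>)\<^sup>2 / 2))"
  proof -
    have "(\<Prod>b\<in>Basis. exp (- (\<xi> \<bullet> b)\<^sup>2 / 2)) = exp (- (norm \<xi>)\<^sup>2 / 2)"
      unfolding power2_norm_eq_inner euclidean_inner[of \<xi> \<xi>]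
      by (simp add: exp_sum[symmetric] power2_eq_square sum_divide_distrib sum_negf)
    then show ?thesis by (simp only: of_real_prod[symmetric])
  qed
  finally show ?thesis .
qed

section \<open>Fourier inversion by Gaussian mollification, for a continuous function with
  non-negative integrable transform\<close>

context
  fixes p \<psi> :: "'a::euclidean_space \<Rightarrow> real"
  assumes cont: "continuous_on UNIV p" and nonneg: "\<And>x. 0 \<le> p x" and int: "integrable lborel p"
    and psi_int: "integrable lborel \<psi>" and psi_nonneg: "\<And>x. 0 \<le> \<psi> x"
    and FT: "\<And>\<xi>. (\<integral>x. iexp (\<xi> \<bullet> x) * complex_of_real (p x) \<partial>lborel) = complex_of_real (\<psi> \<xi>)"
begin

lemma p_meas: "p \<in> borel_measurable borel"
  and psi_meas: "\<psi> \<in> borel_measurable borel"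
  using cont psi_int by (auto intro: borel_measurable_continuous_onI)

lemma integrable_p_mollified:
  assumes "0 < a"
  shows "integrable lborel (\<lambda>z. p (x + a *\<^sub>R z) * std_gauss z)"
proof -
  note [measurable] = p_meas psi_meas
  have "integrable (density (distr lborel borel (\<lambda>z. x + a *\<^sub>R z)) (\<lambda>_. ennreal (\<bar>a\<bar> ^ DIM('a)))) p"
    using int lborel_affine[of a x] assms by simp
  then have "integrable lborel (\<lambda>z. \<bar>a\<bar> ^ DIM('a) *\<^sub>R p (x + a *\<^sub>R z))"
    by (subst (asm) integrable_density) (auto simp: integrable_distr_eq)
  then have "integrable lborel (\<lambda>z. p (x + a *\<^sub>R z))" using assms by simp
  then show ?thesis
    by (rule Bochner_Integration.integrable_bound)
       (use nonneg std_gauss_le1 in \<open>auto intro!: mult_left_le simp: abs_mult\<close>)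
qed

text \<open>Inserting the transform of \<open>p\<close> for \<open>\<psi>\<close> gives a double
  integral in \<open>\<xi>\<close> and \<open>y\<close>, absolutely convergent thanks to the
  Gaussian factor. After the exchange the inner integral is the transform of a Gaussian, a bump of
  width \<open>a\<close> around \<open>x\<close>, and rescaling turns it into the mollified
  \<open>p\<close>.\<close>

lemma mollified_Fourier:
  assumes a: "0 < a"
  shows "complex_of_real (\<integral>z. p (x + a *\<^sub>R z) * std_gauss z \<partial>lborel) =
    complex_of_real (1 / (2 * pi) ^ DIM('a)) *
      (\<integral>\<xi>. complex_of_real (exp (- (norm (a *\<^sub>R \<xi>))\<^sup>2 / 2)) * (iexp (- (\<xi> \<bullet> x)) * complex_of_real (\<psi> \<xi>)) \<partial>lborel)"
proof -
  note [measurable] = p_meas psi_meas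
  define E where "E w = exp (- (norm w)\<^sup>2 / 2)" for w :: 'a
  \<comment> \<open>The normalisation of \<open>std_gauss\<close>. It enters twice, once when the
    damping factor \<open>E\<close> is written as a density and once when the transform of that
    density is; the product is the \<open>(2 * pi) ^ DIM('a)\<close> of the inversion
    formula.\<close>
  define c where "c = sqrt (2 * pi) ^ DIM('a)"
  have c: "c > 0" "c * c = (2 * pi) ^ DIM('a)"
  proof -
    have "c * c = (sqrt (2 * pi) * sqrt (2 * pi)) ^ DIM('a)" by (simp only: c_def power_mult_distrib)
    then show "c * c = (2 * pi) ^ DIM('a)" by simp
  qed (simp add: c_def)
  have E: "E w = c * std_gauss w" for w by (simp add: E_def c_def std_gauss_eq)
  have [measurable]: "E \<in> borel_measurable borel" unfolding E_def by measurable
  have Eint: "integrable lborel (\<lambda>\<xi>. E (a *\<^sub>R \<xi>))"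
  proof -
    have "integrable (density (distr lborel borel (\<lambda>z. 0 + a *\<^sub>R z)) (\<lambda>_. ennreal (\<bar>a\<bar> ^ DIM('a)))) (std_gauss :: 'a \<Rightarrow> real)"
      using a by (subst lborel_affine[of a "0::'a", symmetric]) simp_all
    then have "integrable lborel (\<lambda>z::'a. \<bar>a\<bar> ^ DIM('a) *\<^sub>R std_gauss (0 + a *\<^sub>R z))"
      by (subst (asm) integrable_density) (auto simp: integrable_distr_eq)
    then show ?thesis using a by (simp add: E)
  qed
  let ?h = "\<lambda>\<xi> y. complex_of_real (E (a *\<^sub>R \<xi>)) * (iexp (\<xi> \<bullet> (y - x)) * complex_of_real (p y))"
  have hint: "integrable (lborel \<Otimes>\<^sub>M lborel) (\<lambda>(\<xi>, y). ?h \<xi> y)"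
  proof (rule lborel_pair.Fubini_integrable)
    show "(\<lambda>(\<xi>, y). ?h \<xi> y) \<in> borel_measurable (lborel \<Otimes>\<^sub>M lborel)" by measurable
    have "(\<integral>y. norm (?h \<xi> y) \<partial>lborel) = E (a *\<^sub>R \<xi>) * (\<integral>y. p y \<partial>lborel)" for \<xi>
      using nonneg by (simp add: norm_mult E_def)
    then show "integrable lborel (\<lambda>\<xi>. \<integral>y. norm (case (\<xi>, y) of (\<xi>, y) \<Rightarrow> ?h \<xi> y) \<partial>lborel)"
      using Eint by simp
    show "AE \<xi> in lborel. integrable lborel (\<lambda>y. case (\<xi>, y) of (\<xi>, y) \<Rightarrow> ?h \<xi> y)"
      by (intro AE_I2, simp, rule impI disjI2 integrable_mult_right, rule Bochner_Integration.integrable_bound[OF int])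
         (auto simp: norm_mult)
  qed
  have "(\<integral>\<xi>. complex_of_real (E (a *\<^sub>R \<xi>)) * (iexp (- (\<xi> \<bullet> x)) * complex_of_real (\<psi> \<xi>)) \<partial>lborel) = (\<integral>\<xi>. (\<integral>y. ?h \<xi> y \<partial>lborel) \<partial>lborel)"
  proof (intro Bochner_Integration.integral_cong refl)
    fix \<xi>
    have "(\<integral>y. ?h \<xi> y \<partial>lborel) = (\<integral>y. complex_of_real (E (a *\<^sub>R \<xi>)) * iexp (- (\<xi> \<bullet> x)) * (iexp (\<xi> \<bullet> y) * complex_of_real (p y)) \<partial>lborel)"
    proof (intro Bochner_Integration.integral_cong refl)
      fix y
      have "iexp (\<xi> \<bullet> (y - x)) = iexp (- (\<xi> \<bullet> x)) * iexp (\<xi> \<bullet> y)"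
        by (simp add: exp_add[symmetric] inner_diff_right algebra_simps)
      then show "?h \<xi> y = complex_of_real (E (a *\<^sub>R \<xi>)) * iexp (- (\<xi> \<bullet> x)) * (iexp (\<xi> \<bullet> y) * complex_of_real (p y))"
        by (simp only: ac_simps)
    qed
    also have "\<dots> = complex_of_real (E (a *\<^sub>R \<xi>)) * iexp (- (\<xi> \<bullet> x)) * complex_of_real (\<psi> \<xi>)"
      by (subst integral_mult_right_zero) (simp only: FT)
    finally show "complex_of_real (E (a *\<^sub>R \<xi>)) * (iexp (- (\<xi> \<bullet> x)) * complex_of_real (\<psi> \<xi>)) = (\<integral>y. ?h \<xi> y \<partial>lborel)"
      by (simp only: mult.assoc)
  qed
  also have "\<dots> = (\<integral>y. (\<integral>\<xi>. ?h \<xi> y \<partial>lborel) \<partial>lborel)"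
    by (rule lborel_pair.Fubini_integral[symmetric]) (use hint in \<open>simp add: split_def\<close>)
  also have "\<dots> = (\<integral>y. complex_of_real (c * c / a ^ DIM('a) * (std_gauss ((y - x) /\<^sub>R a) * p y)) \<partial>lborel)"
  proof (intro Bochner_Integration.integral_cong refl)
    fix y
    have "(\<integral>\<xi>. ?h \<xi> y \<partial>lborel) = (\<integral>\<xi>. (iexp (\<xi> \<bullet> (y - x)) * complex_of_real (E (a *\<^sub>R \<xi>))) * complex_of_real (p y) \<partial>lborel)"
      by (simp only: ac_simps)
    also have "\<dots> = (\<integral>\<xi>. iexp (\<xi> \<bullet> (y - x)) * complex_of_real (E (a *\<^sub>R \<xi>)) \<partial>lborel) * complex_of_real (p y)"
      by simp
    also have "(\<integral>\<xi>. iexp (\<xi> \<bullet> (y - x)) * complex_of_real (E (a *\<^sub>R \<xi>)) \<partial>lborel) =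
      \<bar>1/a\<bar> ^ DIM('a) *\<^sub>R (\<integral>\<xi>. iexp ((0 + (1/a) *\<^sub>R \<xi>) \<bullet> (y - x)) * complex_of_real (E (a *\<^sub>R (0 + (1/a) *\<^sub>R \<xi>))) \<partial>lborel)"
      by (rule integral_lborel_affine) (use a in auto)
    also have "(\<integral>\<xi>. iexp ((0 + (1/a) *\<^sub>R \<xi>) \<bullet> (y - x)) * complex_of_real (E (a *\<^sub>R (0 + (1/a) *\<^sub>R \<xi>))) \<partial>lborel)
      = (\<integral>\<xi>. complex_of_real c * (iexp (((y - x) /\<^sub>R a) \<bullet> \<xi>) * complex_of_real (std_gauss \<xi>)) \<partial>lborel)"
    proof (intro Bochner_Integration.integral_cong refl)
      fix \<xi> :: 'a
      have "(0 + (1/a) *\<^sub>R \<xi>) \<bullet> (y - x) = ((y - x) /\<^sub>R a) \<bullet> \<xi>" "a *\<^sub>R (0 + (1/a) *\<^sub>R \<xi>) = \<xi>"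
        using a by (simp_all add: inner_commute divide_inverse)
      then show "iexp ((0 + (1/a) *\<^sub>R \<xi>) \<bullet> (y - x)) * complex_of_real (E (a *\<^sub>R (0 + (1/a) *\<^sub>R \<xi>))) = complex_of_real c * (iexp (((y - x) /\<^sub>R a) \<bullet> \<xi>) * complex_of_real (std_gauss \<xi>))"
        by (simp only: E of_real_mult ac_simps)
    qed
    also have "\<dots> = complex_of_real c * complex_of_real (E ((y - x) /\<^sub>R a))"
      by (subst integral_mult_right_zero) (simp only: Fourier_std_gauss E_def)
    finally show "(\<integral>\<xi>. ?h \<xi> y \<partial>lborel) = complex_of_real (c * c / a ^ DIM('a) * (std_gauss ((y - x) /\<^sub>R a) * p y))"
      using a by (simp add: E scaleR_conv_of_real power_divide)
  qed
  also have "\<dots> = complex_of_real (c * c / a ^ DIM('a) * (\<integral>y. std_gauss ((y - x) /\<^sub>R a) * p y \<partial>lborel))"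
    by (simp only: integral_complex_of_real integral_mult_right_zero)
  also have "(\<integral>y. std_gauss ((y - x) /\<^sub>R a) * p y \<partial>lborel) = \<bar>a\<bar> ^ DIM('a) *\<^sub>R (\<integral>z. std_gauss (((x + a *\<^sub>R z) - x) /\<^sub>R a) * p (x + a *\<^sub>R z) \<partial>lborel)"
    by (rule integral_lborel_affine) (use a in auto)
  also have "\<dots> = a ^ DIM('a) * (\<integral>z. p (x + a *\<^sub>R z) * std_gauss z \<partial>lborel)"
    using a by (simp add: mult.commute)
  finally have "(\<integral>\<xi>. complex_of_real (E (a *\<^sub>R \<xi>)) * (iexp (- (\<xi> \<bullet> x)) * complex_of_real (\<psi> \<xi>)) \<partial>lborel) =
     complex_of_real (c * c * (\<integral>z. p (x + a *\<^sub>R z) * std_gauss z \<partial>lborel))"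
    using a by simp
  then show ?thesis
    unfolding E_def[symmetric] c(2)[symmetric] using c(1) by simp
qed

lemma mollified_limit: "(\<lambda>n. p (x + (1 / real (Suc n)) *\<^sub>R z)) \<longlonglongrightarrow> p x"
proof -
  have "isCont p x" using cont continuous_on_eq_continuous_at by blast
  moreover have "(\<lambda>n. x + (1 / real (Suc n)) *\<^sub>R z) \<longlonglongrightarrow> x + 0 *\<^sub>R z"
    by (intro tendsto_intros LIMSEQ_Suc[OF lim_1_over_n])
  ultimately show ?thesis
    using isCont_tendsto_compose[of x p "\<lambda>n. x + (1 / real (Suc n)) *\<^sub>R z"] by (simp only: scaleR_zero_left add_0_right)
qed

text \<open>Boundedness is obtained first, by Fatou's lemma: it supplies the majorant for the dominated
  convergence in the inversion formula.\<close>

lemma Fourier_density_bounded: "p x \<le> 1 / (2 * pi) ^ DIM('a) * (\<integral>\<xi>. \<psi> \<xi> \<partial>lborel)" (is "_ \<le> ?B")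
proof -
  note [measurable] = p_meas psi_meas
  define m where "m n = (\<integral>z. p (x + (1 / real (Suc n)) *\<^sub>R z) * std_gauss z \<partial>lborel)" for n
  have m_le: "m n \<le> ?B" for n
  proof -
    let ?f = "\<lambda>\<xi>. complex_of_real (exp (- (norm ((1 / real (Suc n)) *\<^sub>R \<xi>))\<^sup>2 / 2)) * (iexp (- (\<xi> \<bullet> x)) * complex_of_real (\<psi> \<xi>))"
    have nf: "norm (?f \<xi>) \<le> \<psi> \<xi>" for \<xi>
      using psi_nonneg[of \<xi>] by (simp add: norm_mult mult_left_le_one_le)
    have "norm (complex_of_real (m n)) = 1 / (2 * pi) ^ DIM('a) * norm (\<integral>\<xi>. ?f \<xi> \<partial>lborel)"
      unfolding m_def by (subst mollified_Fourier) (simp_all add: norm_mult norm_divide norm_power)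
    also have "\<dots> \<le> 1 / (2 * pi) ^ DIM('a) * (\<integral>\<xi>. \<psi> \<xi> \<partial>lborel)"
    proof (rule mult_left_mono)
      show "norm (\<integral>\<xi>. ?f \<xi> \<partial>lborel) \<le> (\<integral>\<xi>. \<psi> \<xi> \<partial>lborel)"
      proof (rule Bochner_Integration.integral_norm_bound_integral[OF _ psi_int nf])
        show "integrable lborel ?f"
          by (rule Bochner_Integration.integrable_bound[OF psi_int])
             (use nf psi_nonneg in \<open>auto simp del: of_nat_Suc intro: order_trans\<close>)
      qed
    qed simp
    finally show ?thesis by simp
  qed
  \<comment> \<open>The value at \<open>x\<close> is written as a constant integrated against a
    probability density, so that it becomes the limit of mollified integrands to which Fatou's lemma
    applies.\<close>
  have "ennreal (p x) = (\<integral>\<^sup>+z. ennreal (p x) * ennreal (std_gauss (z::'a)) \<partial>lborel)"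
    by (subst nn_integral_cmult) (auto simp: nn_integral_eq_integral integral_std_gauss)
  also have "\<dots> = (\<integral>\<^sup>+z. liminf (\<lambda>n. ennreal (p (x + (1 / real (Suc n)) *\<^sub>R z) * std_gauss z)) \<partial>lborel)"
  proof (intro nn_integral_cong)
    fix z :: 'a
    have "(\<lambda>n. ennreal (p (x + (1 / real (Suc n)) *\<^sub>R z) * std_gauss z)) \<longlonglongrightarrow> ennreal (p x * std_gauss z)"
      by (intro tendsto_ennrealI tendsto_mult mollified_limit tendsto_const)
    then show "ennreal (p x) * ennreal (std_gauss z) = liminf (\<lambda>n. ennreal (p (x + (1 / real (Suc n)) *\<^sub>R z) * std_gauss z))"
      using nonneg by (simp add: lim_imp_Liminf ennreal_mult')
  qed
  also have "\<dots> \<le> liminf (\<lambda>n. \<integral>\<^sup>+z. ennreal (p (x + (1 / real (Suc n)) *\<^sub>R z) * std_gauss z) \<partial>lborel)"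
    by (rule nn_integral_liminf) measurable
  also have "\<dots> = liminf (\<lambda>n. ennreal (m n))"
    unfolding m_def using nonneg by (subst nn_integral_eq_integral) (auto intro!: integrable_p_mollified)
  also have "\<dots> \<le> ennreal ?B"
    using m_le by (intro Liminf_le) (auto intro!: always_eventually ennreal_leI)
  finally show ?thesis using psi_nonneg by (subst (asm) ennreal_le_iff) (auto intro!: mult_nonneg_nonneg)
qed

text \<open>Both sides of \<open>mollified_Fourier\<close> at scale \<open>1 / Suc n\<close>
  converge by dominated convergence, the left one under a multiple of the Gaussian, the right one
  under \<open>\<psi>\<close>. Continuity of \<open>p\<close> yields the formula at every point,
  which the prescribed version of the stable density calls for.\<close>

theorem Fourier_inversion:
  "complex_of_real (p x) = complex_of_real (1 / (2 * pi) ^ DIM('a)) *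
     (\<integral>\<xi>. iexp (- (\<xi> \<bullet> x)) * complex_of_real (\<psi> \<xi>) \<partial>lborel)"
proof -
  note [measurable] = p_meas psi_meas
  let ?B = "1 / (2 * pi) ^ DIM('a) * (\<integral>\<xi>. \<psi> \<xi> \<partial>lborel)"
  have "(\<lambda>n. \<integral>z. p (x + (1 / real (Suc n)) *\<^sub>R z) * std_gauss z \<partial>lborel) \<longlonglongrightarrow> (\<integral>z. p x * std_gauss (z::'a) \<partial>lborel)"
  proof (rule Bochner_Integration.integral_dominated_convergence)
    show "integrable lborel (\<lambda>z::'a. ?B * std_gauss z)" by simp
    show "AE z in lborel. (\<lambda>n. p (x + (1 / real (Suc n)) *\<^sub>R z) * std_gauss z) \<longlonglongrightarrow> p x * std_gauss z"
      by (intro AE_I2 tendsto_mult mollified_limit tendsto_const)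
    show "AE z in lborel. norm (p (x + (1 / real (Suc n)) *\<^sub>R z) * std_gauss z) \<le> ?B * std_gauss z" for n
      using nonneg Fourier_density_bounded by (intro AE_I2) (simp only: real_norm_def abs_mult abs_of_nonneg std_gauss_nonneg, intro mult_right_mono, auto)
  qed measurable
  then have 1: "(\<lambda>n. complex_of_real (\<integral>z. p (x + (1 / real (Suc n)) *\<^sub>R z) * std_gauss z \<partial>lborel)) \<longlonglongrightarrow> complex_of_real (p x)"
    by (intro tendsto_of_real) (simp add: integral_std_gauss)
  have "(\<lambda>n. \<integral>\<xi>. complex_of_real (exp (- (norm ((1 / real (Suc n)) *\<^sub>R \<xi>))\<^sup>2 / 2)) * (iexp (- (\<xi> \<bullet> x)) * complex_of_real (\<psi> \<xi>)) \<partial>lborel)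
     \<longlonglongrightarrow> (\<integral>\<xi>. iexp (- (\<xi> \<bullet> x)) * complex_of_real (\<psi> \<xi>) \<partial>lborel)"
  proof (rule Bochner_Integration.integral_dominated_convergence)
    show "integrable lborel \<psi>" by (rule psi_int)
    show "AE \<xi> in lborel. (\<lambda>n. complex_of_real (exp (- (norm ((1 / real (Suc n)) *\<^sub>R \<xi>))\<^sup>2 / 2)) * (iexp (- (\<xi> \<bullet> x)) * complex_of_real (\<psi> \<xi>)))
      \<longlonglongrightarrow> iexp (- (\<xi> \<bullet> x)) * complex_of_real (\<psi> \<xi>)"
    proof (intro AE_I2)
      fix \<xi> :: 'a
      have "(\<lambda>n. complex_of_real (exp (- (norm ((1 / real (Suc n)) *\<^sub>R \<xi>))\<^sup>2 / 2)) * (iexp (- (\<xi> \<bullet> x)) * complex_of_real (\<psi> \<xi>)))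
        \<longlonglongrightarrow> complex_of_real (exp (- (norm (0 *\<^sub>R \<xi>))\<^sup>2 / 2)) * (iexp (- (\<xi> \<bullet> x)) * complex_of_real (\<psi> \<xi>))"
        by (intro tendsto_intros LIMSEQ_Suc[OF lim_1_over_n]) simp
      then show "(\<lambda>n. complex_of_real (exp (- (norm ((1 / real (Suc n)) *\<^sub>R \<xi>))\<^sup>2 / 2)) * (iexp (- (\<xi> \<bullet> x)) * complex_of_real (\<psi> \<xi>)))
        \<longlonglongrightarrow> iexp (- (\<xi> \<bullet> x)) * complex_of_real (\<psi> \<xi>)" by simp
    qed
    show "AE \<xi> in lborel. norm (complex_of_real (exp (- (norm ((1 / real (Suc n)) *\<^sub>R \<xi>))\<^sup>2 / 2)) * (iexp (- (\<xi> \<bullet> x)) * complex_of_real (\<psi> \<xi>))) \<le> \<psi> \<xi>" for n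
      using psi_nonneg by (intro AE_I2) (simp add: norm_mult mult_left_le_one_le)
  qed measurable
  then have 2: "(\<lambda>n. complex_of_real (1 / (2 * pi) ^ DIM('a)) * (\<integral>\<xi>. complex_of_real (exp (- (norm ((1 / real (Suc n)) *\<^sub>R \<xi>))\<^sup>2 / 2)) * (iexp (- (\<xi> \<bullet> x)) * complex_of_real (\<psi> \<xi>)) \<partial>lborel))
     \<longlonglongrightarrow> complex_of_real (1 / (2 * pi) ^ DIM('a)) * (\<integral>\<xi>. iexp (- (\<xi> \<bullet> x)) * complex_of_real (\<psi> \<xi>) \<partial>lborel)"
    by (rule tendsto_mult_left)
  have "(\<lambda>n. complex_of_real (\<integral>z. p (x + (1 / real (Suc n)) *\<^sub>R z) * std_gauss z \<partial>lborel)) =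
    (\<lambda>n. complex_of_real (1 / (2 * pi) ^ DIM('a)) * (\<integral>\<xi>. complex_of_real (exp (- (norm ((1 / real (Suc n)) *\<^sub>R \<xi>))\<^sup>2 / 2)) * (iexp (- (\<xi> \<bullet> x)) * complex_of_real (\<psi> \<xi>)) \<partial>lborel))"
    by (intro ext mollified_Fourier) simp
  from 1[unfolded this] 2 show ?thesis by (rule LIMSEQ_unique)
qed

end


text \<open>Inversion is applied to \<open>q\<close> alone. Since \<open>p\<close> and
  \<open>\<phi>\<close> are integrable, the order of integration can be exchanged, and the integral
  over \<open>x\<close> is then the transform of \<open>p\<close> at \<open>- \<xi>\<close>.\<close>

lemma Fourier_Parseval:
  fixes p q \<psi> \<phi> :: "'a::euclidean_space \<Rightarrow> real"
  assumes p: "continuous_on UNIV p" "integrable lborel p"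
    and psi_bd: "\<And>\<xi>. \<bar>\<psi> \<xi>\<bar> \<le> B"
    and pFT: "\<And>\<xi>. (\<integral>x. iexp (\<xi> \<bullet> x) * complex_of_real (p x) \<partial>lborel) = complex_of_real (\<psi> \<xi>)"
    and q: "continuous_on UNIV q" "\<And>x. 0 \<le> q x" "integrable lborel q"
    and chi: "integrable lborel \<phi>" "\<And>\<xi>. 0 \<le> \<phi> \<xi>"
    and qFT: "\<And>\<xi>. (\<integral>x. iexp (\<xi> \<bullet> x) * complex_of_real (q x) \<partial>lborel) = complex_of_real (\<phi> \<xi>)"
  shows "integrable lborel (\<lambda>x. p x * q x)"
    and "(\<integral>x. p x * q x \<partial>lborel) = 1 / (2 * pi) ^ DIM('a) * (\<integral>\<xi>. \<psi> (- \<xi>) * \<phi> \<xi> \<partial>lborel)"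
proof -
  let ?C = "1 / (2 * pi) ^ DIM('a)"
  have [measurable]: "p \<in> borel_measurable borel" "q \<in> borel_measurable borel" "\<phi> \<in> borel_measurable borel"
    using p q chi by (auto intro: borel_measurable_continuous_onI)
  have qb: "q x \<le> ?C * (\<integral>\<xi>. \<phi> \<xi> \<partial>lborel)" for x
    by (rule Fourier_density_bounded[OF q chi qFT])
  have chi_int: "0 \<le> (\<integral>\<xi>. \<phi> \<xi> \<partial>lborel)" using chi by simp
  show "integrable lborel (\<lambda>x. p x * q x)"
  proof (rule Bochner_Integration.integrable_bound)
    show "integrable lborel (\<lambda>x. p x * (?C * (\<integral>\<xi>. \<phi> \<xi> \<partial>lborel)))" using p by simp
    show "AE x in lborel. norm (p x * q x) \<le> norm (p x * (?C * (\<integral>\<xi>. \<phi> \<xi> \<partial>lborel)))"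
      unfolding norm_mult using qb q(2) chi_int by (intro AE_I2 mult_left_mono) (auto simp: abs_mult)
  qed measurable
  let ?h = "\<lambda>x \<xi>. complex_of_real (p x) * (iexp (- (\<xi> \<bullet> x)) * complex_of_real (\<phi> \<xi>))"
  have hint: "integrable (lborel \<Otimes>\<^sub>M lborel) (\<lambda>(x, \<xi>). ?h x \<xi>)"
  proof (rule lborel_pair.Fubini_integrable)
    show "(\<lambda>(x, \<xi>). ?h x \<xi>) \<in> borel_measurable (lborel \<Otimes>\<^sub>M lborel)" by measurable
    have "(\<integral>\<xi>. norm (?h x \<xi>) \<partial>lborel) = \<bar>p x\<bar> * (\<integral>\<xi>. \<phi> \<xi> \<partial>lborel)" for x
      using chi by (simp add: norm_mult)
    then show "integrable lborel (\<lambda>x. \<integral>\<xi>. norm (case (x, \<xi>) of (x, \<xi>) \<Rightarrow> ?h x \<xi>) \<partial>lborel)"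
      using p by simp
    show "AE x in lborel. integrable lborel (\<lambda>\<xi>. case (x, \<xi>) of (x, \<xi>) \<Rightarrow> ?h x \<xi>)"
      by (intro AE_I2, simp, rule impI disjI2 integrable_mult_right, rule Bochner_Integration.integrable_bound[OF chi(1)])
         (auto simp: norm_mult)
  qed
  have "complex_of_real (\<integral>x. p x * q x \<partial>lborel) = (\<integral>x. complex_of_real (p x) * complex_of_real (q x) \<partial>lborel)"
    by (simp add: integral_complex_of_real[symmetric] del: integral_complex_of_real)
  also have "\<dots> = (\<integral>x. complex_of_real ?C * (\<integral>\<xi>. ?h x \<xi> \<partial>lborel) \<partial>lborel)"
  proof (intro Bochner_Integration.integral_cong refl)
    fix x
    show "complex_of_real (p x) * complex_of_real (q x) = complex_of_real ?C * (\<integral>\<xi>. ?h x \<xi> \<partial>lborel)"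
      unfolding Fourier_inversion[OF q chi qFT, of x] integral_mult_right_zero by (simp only: ac_simps)
  qed
  also have "\<dots> = complex_of_real ?C * (\<integral>x. (\<integral>\<xi>. ?h x \<xi> \<partial>lborel) \<partial>lborel)"
    by (rule integral_mult_right_zero)
  also have "(\<integral>x. (\<integral>\<xi>. ?h x \<xi> \<partial>lborel) \<partial>lborel) = (\<integral>\<xi>. (\<integral>x. ?h x \<xi> \<partial>lborel) \<partial>lborel)"
    by (rule lborel_pair.Fubini_integral[symmetric]) (use hint in \<open>simp add: split_def\<close>)
  also have "\<dots> = (\<integral>\<xi>. complex_of_real (\<psi> (- \<xi>) * \<phi> \<xi>) \<partial>lborel)"
  proof (intro Bochner_Integration.integral_cong refl)
    fix \<xi> :: 'a
    have "(\<integral>x. ?h x \<xi> \<partial>lborel) = (\<integral>x. (iexp ((- \<xi>) \<bullet> x) * complex_of_real (p x)) * complex_of_real (\<phi> \<xi>) \<partial>lborel)"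
      by (simp add: ac_simps)
    also have "\<dots> = complex_of_real (\<psi> (- \<xi>)) * complex_of_real (\<phi> \<xi>)"
      by (subst integral_mult_left_zero) (simp only: pFT)
    finally show "(\<integral>x. ?h x \<xi> \<partial>lborel) = complex_of_real (\<psi> (- \<xi>) * \<phi> \<xi>)" by simp
  qed
  also have "\<dots> = complex_of_real (\<integral>\<xi>. \<psi> (- \<xi>) * \<phi> \<xi> \<partial>lborel)"
    by (rule integral_complex_of_real)
  finally show "(\<integral>x. p x * q x \<partial>lborel) = ?C * (\<integral>\<xi>. \<psi> (- \<xi>) * \<phi> \<xi> \<partial>lborel)"
    by (simp only: of_real_mult[symmetric] of_real_eq_iff)
qed

text \<open>Layer-cake argument: \<open>exp (- (c * norm \<xi> powr \<alpha>))\<close> is the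
  integral of \<open>f\<close>, minus the radial derivative, over \<open>r \<ge> norm \<xi>\<close>.
  By Tonelli only volumes of balls are left, weighted by \<open>f\<close>.\<close>

lemma nn_integral_exp_norm_powr:
  assumes c: "0 < c" and \<alpha>: "0 < \<alpha>"
  shows "(\<integral>\<^sup>+\<xi>. ennreal (exp (- (c * norm (\<xi>::'a::euclidean_space) powr \<alpha>))) \<partial>lborel) =
    ennreal (unit_ball_vol DIM('a) * Gamma (1 + DIM('a) / \<alpha>) * c powr (- (DIM('a) / \<alpha>)))"
proof -
  define d where "d = real DIM('a)"
  have d: "d > 0" by (simp add: d_def)
  define f where "f r = c * \<alpha> * r powr (\<alpha> - 1) * exp (- (c * r powr \<alpha>))" for r
  have f0: "0 \<le> f r" for r using assms by (simp add: f_def)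
  have [measurable]: "f \<in> borel_measurable borel" unfolding f_def by measurable
  have tail: "(\<integral>\<^sup>+r. ennreal (f r) * indicator {R..} r \<partial>lborel) = ennreal (exp (- (c * R powr \<alpha>)))" if R: "R > 0" for R
  proof -
    have "(\<integral>\<^sup>+r. ennreal (f r) * indicator {R..} r \<partial>lborel) = ennreal (0 - (- exp (- (c * R powr \<alpha>))))"
    proof (rule nn_integral_FTC_atLeast)
      show "((\<lambda>r. - exp (- (c * r powr \<alpha>))) \<longlongrightarrow> 0) at_top"
      proof -
        have "filterlim (\<lambda>r. exp (\<alpha> * ln r)) at_top at_top"
          using \<alpha> by (intro filterlim_compose[OF exp_at_top] filterlim_tendsto_pos_mult_at_top[OF tendsto_const] ln_at_top)
        moreover have "\<forall>\<^sub>F r in at_top. exp (\<alpha> * ln r) = r powr \<alpha>"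
          using eventually_gt_at_top[of 0] by eventually_elim (simp add: powr_def)
        ultimately have "filterlim (\<lambda>r. r powr \<alpha>) at_top at_top"
          by (simp add: filterlim_cong[OF refl refl])
        then have "filterlim (\<lambda>r. c * r powr \<alpha>) at_top at_top"
          using c by (intro filterlim_tendsto_pos_mult_at_top[OF tendsto_const]) auto
        then have "((\<lambda>r. exp (- (c * r powr \<alpha>))) \<longlongrightarrow> 0) at_top"
          by (intro filterlim_compose[OF exp_at_bot] filterlim_compose[OF filterlim_uminus_at_bot_at_top])
        then show ?thesis using tendsto_minus by fastforce
      qed
      fix r assume "R \<le> r"
      then show "((\<lambda>r. - exp (- (c * r powr \<alpha>))) has_real_derivative f r) (at r)"
        using R by (auto intro!: derivative_eq_intros simp: f_def)
    qed (use f0 in auto)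
    then show ?thesis by simp
  qed
  have "(\<integral>\<^sup>+\<xi>. ennreal (exp (- (c * norm (\<xi>::'a) powr \<alpha>))) \<partial>lborel) =
    (\<integral>\<^sup>+\<xi>. (\<integral>\<^sup>+r. ennreal (f r) * indicator {0<..} r * indicator {x. norm x \<le> r} (\<xi>::'a) \<partial>lborel) \<partial>lborel)"
  \<comment> \<open>The tail formula holds for positive radii, so the origin is removed as a null
    set.\<close>
  proof (intro nn_integral_cong_AE AE_I[of _ _ "{0}"])
    show "{\<xi>\<in>space lborel. \<not> ennreal (exp (- (c * norm (\<xi>::'a) powr \<alpha>))) = (\<integral>\<^sup>+r. ennreal (f r) * indicator {0<..} r * indicator {x. norm x \<le> r} (\<xi>::'a) \<partial>lborel)} \<subseteq> {0}"
    proof safe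
      fix \<xi> :: 'a
      assume ne: "ennreal (exp (- (c * norm \<xi> powr \<alpha>))) \<noteq> (\<integral>\<^sup>+r. ennreal (f r) * indicator {0<..} r * indicator {x. norm x \<le> r} \<xi> \<partial>lborel)"
      show "\<xi> = 0"
      proof (rule ccontr)
        assume "\<xi> \<noteq> 0"
        then have n: "norm \<xi> > 0" by simp
        have "(\<integral>\<^sup>+r. ennreal (f r) * indicator {0<..} r * indicator {x. norm x \<le> r} \<xi> \<partial>lborel) = (\<integral>\<^sup>+r. ennreal (f r) * indicator {norm \<xi>..} r \<partial>lborel)"
        proof (intro nn_integral_cong)
          fix r
          show "ennreal (f r) * indicator {0<..} r * indicator {x. norm x \<le> r} \<xi> = ennreal (f r) * indicator {norm \<xi>..} r"
            using less_le_trans[OF n, of r] by (simp add: indicator_def)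
        qed
        then show False using ne tail[OF n] by simp
      qed
    qed
  qed auto
  also have "\<dots> = (\<integral>\<^sup>+r. (\<integral>\<^sup>+\<xi>. ennreal (f r) * indicator {0<..} r * indicator {x. norm x \<le> r} (\<xi>::'a) \<partial>lborel) \<partial>lborel)"
    by (rule lborel_pair.Fubini') (simp add: split_def indicator_def)
  also have "\<dots> = (\<integral>\<^sup>+r\<in>{0<..}. ennreal (unit_ball_vol d * c * \<alpha>) * ennreal (r powr (\<alpha> + d - 1) * exp (- (c * r powr \<alpha>))) \<partial>lborel)"
  proof (intro nn_integral_cong)
    fix r :: real
    show "(\<integral>\<^sup>+\<xi>. ennreal (f r) * indicator {0<..} r * indicator {x. norm x \<le> r} (\<xi>::'a) \<partial>lborel) =
      ennreal (unit_ball_vol d * c * \<alpha>) * ennreal (r powr (\<alpha> + d - 1) * exp (- (c * r powr \<alpha>))) * indicator {0<..} r"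
    proof (cases "r > 0")
      case True
      have "{x. norm x \<le> r} = cball (0::'a) r" by auto
      then have "(\<integral>\<^sup>+\<xi>. ennreal (f r) * indicator {0<..} r * indicator {x. norm x \<le> r} (\<xi>::'a) \<partial>lborel) = ennreal (f r) * ennreal (unit_ball_vol d * r ^ DIM('a))"
        using True by (simp add: nn_integral_cmult emeasure_cball d_def)
      also have "\<dots> = ennreal (f r * (unit_ball_vol d * r powr d))"
        using True d f0 by (simp add: ennreal_mult' d_def powr_realpow)
      also have "f r * (unit_ball_vol d * r powr d) = (unit_ball_vol d * c * \<alpha>) * (r powr (\<alpha> + d - 1) * exp (- (c * r powr \<alpha>)))"
        using True by (simp add: f_def powr_add powr_diff)
      finally show ?thesis using True d c \<alpha> by (simp add: ennreal_mult')
    qed simp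
  qed
  also have "\<dots> = ennreal (unit_ball_vol d * c * \<alpha>) * ennreal (Gamma ((\<alpha> + d) / \<alpha>) / \<alpha> * c powr (- ((\<alpha> + d) / \<alpha>)))"
    using c \<alpha> d nn_integral_stretched_Gamma[of "\<alpha> + d" c \<alpha>] by (simp add: mult.assoc nn_integral_cmult)
  also have "\<dots> = ennreal ((unit_ball_vol d * c * \<alpha>) * (Gamma ((\<alpha> + d) / \<alpha>) / \<alpha> * c powr (- ((\<alpha> + d) / \<alpha>))))"
    using c \<alpha> d by (intro ennreal_mult'[symmetric]) simp
  also have "(unit_ball_vol d * c * \<alpha>) * (Gamma ((\<alpha> + d) / \<alpha>) / \<alpha> * c powr (- ((\<alpha> + d) / \<alpha>))) = unit_ball_vol d * Gamma (1 + d / \<alpha>) * c powr (- (d / \<alpha>))"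
  proof -
    have "(\<alpha> + d) / \<alpha> = 1 + d / \<alpha>" using \<alpha> by (simp add: field_simps)
    moreover have "c * c powr (- (1 + d / \<alpha>)) = c powr (- (d / \<alpha>))"
      using c by (simp add: powr_mult_base)
    ultimately show ?thesis using \<alpha> by simp
  qed
  finally show ?thesis by (simp add: d_def)
qed

section \<open>Overlaps and joint measurability of the stable densities\<close>

context
  fixes \<alpha> \<nu> :: real and p :: "real \<Rightarrow> 'a::euclidean_space \<Rightarrow> real"
  assumes alpha: "0 < \<alpha>" and nu: "0 < \<nu>" and p: "stable_density \<alpha> \<nu> p"
begin

lemma stable_density_facts:
  assumes "0 < s"
  shows "continuous_on UNIV (p s)" "\<And>x. 0 \<le> p s x" "integrable lborel (p s)"
    "\<And>\<xi>. (\<integral>x. iexp (\<xi> \<bullet> x) * complex_of_real (p s x) \<partial>lborel) = complex_of_real (exp (- (s * \<nu> * norm \<xi> powr \<alpha>)))"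
  using p assms by (auto simp: stable_density_def)

lemma integrable_stable_exponent:
  assumes "0 < s"
  shows "integrable lborel (\<lambda>\<xi>::'a. exp (- (s * \<nu> * norm \<xi> powr \<alpha>)))"
proof (rule integrableI_nonneg)
  show "(\<integral>\<^sup>+\<xi>. ennreal (exp (- (s * \<nu> * norm (\<xi>::'a) powr \<alpha>))) \<partial>lborel) < \<infinity>"
    using assms alpha nu by (subst nn_integral_exp_norm_powr) auto
qed auto

text \<open>By Parseval the two exponents add, so the overlap depends on \<open>s + s'\<close> only;
  it is the value at the origin of the density at time \<open>s + s'\<close>.\<close>

lemma nn_integral_stable_density_overlap:
  assumes s: "0 < s" "0 < s'"
  shows "(\<integral>\<^sup>+x. ennreal (p s x * p s' x) \<partial>lborel) =
    ennreal (1 / (2 * pi) ^ DIM('a) * (unit_ball_vol DIM('a) * Gamma (1 + DIM('a) / \<alpha>) * ((s + s') * \<nu>) powr (- (DIM('a) / \<alpha>))))"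
proof -
  note P = stable_density_facts[OF s(1)] and Q = stable_density_facts[OF s(2)]
  have bd: "\<bar>exp (- (s * \<nu> * norm \<xi> powr \<alpha>))\<bar> \<le> 1" for \<xi> :: 'a
    using s nu by simp
  note Pars = Fourier_Parseval[OF P(1,3) bd P(4) Q(1,2,3) integrable_stable_exponent[OF s(2)] _ Q(4)]
  have "(\<integral>\<^sup>+x. ennreal (p s x * p s' x) \<partial>lborel) = ennreal (\<integral>x. p s x * p s' x \<partial>lborel)"
    by (rule nn_integral_eq_integral[OF Pars(1)]) (use P(2) Q(2) in auto)
  also have "(\<integral>x. p s x * p s' x \<partial>lborel) = 1 / (2 * pi) ^ DIM('a) * (\<integral>\<xi>. exp (- ((s + s') * \<nu> * norm (\<xi>::'a) powr \<alpha>)) \<partial>lborel)"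
    by (subst Pars(2)) (simp_all add: exp_add[symmetric] algebra_simps)
  also have "(\<integral>\<xi>. exp (- ((s + s') * \<nu> * norm (\<xi>::'a) powr \<alpha>)) \<partial>lborel) = unit_ball_vol DIM('a) * Gamma (1 + DIM('a) / \<alpha>) * ((s + s') * \<nu>) powr (- (DIM('a) / \<alpha>))"
  proof -
    have "ennreal (\<integral>\<xi>. exp (- ((s + s') * \<nu> * norm (\<xi>::'a) powr \<alpha>)) \<partial>lborel) = (\<integral>\<^sup>+\<xi>. ennreal (exp (- ((s + s') * \<nu> * norm (\<xi>::'a) powr \<alpha>))) \<partial>lborel)"
      by (rule nn_integral_eq_integral[symmetric]) (use s in \<open>auto intro!: integrable_stable_exponent\<close>)
    also have "\<dots> = ennreal (unit_ball_vol DIM('a) * Gamma (1 + DIM('a) / \<alpha>) * ((s + s') * \<nu>) powr (- (DIM('a) / \<alpha>)))"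
      using s nu alpha by (subst nn_integral_exp_norm_powr) auto
    finally show ?thesis
      using alpha by (subst (asm) ennreal_inj) (auto intro!: mult_nonneg_nonneg less_imp_le[OF Gamma_real_pos] add_pos_nonneg)
  qed
  finally show ?thesis .
qed

text \<open>\<open>stable_density\<close> prescribes each \<open>p s\<close> separately. Joint
  measurability in time and space comes from the inversion formula, which exhibits \<open>p\<close>
  as a parameter integral.\<close>

lemma stable_density_measurable:
  "(\<lambda>z. p (fst z) (snd z) * indicator {0<..} (fst z)) \<in> borel_measurable (borel \<Otimes>\<^sub>M borel)"
proof -
  have "p (fst z) (snd z) * indicator {0<..} (fst z) =
    Re (complex_of_real (1 / (2 * pi) ^ DIM('a)) *
      (\<integral>\<xi>. iexp (- (\<xi> \<bullet> snd z)) * complex_of_real (exp (- (fst z * \<nu> * norm (\<xi>::'a) powr \<alpha>))) \<partial>lborel)) * indicator {0<..} (fst z)" for z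
  proof (cases "fst z > 0")
    case True
    note P = stable_density_facts[OF True]
    have "complex_of_real (p (fst z) (snd z)) = complex_of_real (1 / (2 * pi) ^ DIM('a)) *
      (\<integral>\<xi>. iexp (- (\<xi> \<bullet> snd z)) * complex_of_real (exp (- (fst z * \<nu> * norm (\<xi>::'a) powr \<alpha>))) \<partial>lborel)"
      by (rule Fourier_inversion[OF P(1,2,3) integrable_stable_exponent[OF True] _ P(4)]) simp
    then show ?thesis by (metis Re_complex_of_real)
  qed simp
  then show ?thesis by simp
qed

end

section \<open>The Green kernel\<close>

context subordinator
begin

context
  fixes \<alpha> \<nu> :: real and p :: "real \<Rightarrow> 'a::euclidean_space \<Rightarrow> real"
  assumes alpha: "0 < \<alpha>" and nu: "0 < \<nu>" and p: "stable_density \<alpha> \<nu> p"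
begin

lemma inverse_subordinator_density_nonneg: "0 \<le> t \<Longrightarrow> 0 \<le> inverse_subordinator_density \<beta> g t s"
  using beta g_nonneg by (simp add: inverse_subordinator_density_def)

lemma green_kernel_eq:
  "green_kernel \<beta> p g t x = (\<integral>s. (p s x * indicator {0<..} s) * inverse_subordinator_density \<beta> g t s \<partial>lborel)"
  by (simp add: green_kernel_def set_lebesgue_integral_def mult.assoc mult.left_commute)

lemma green_kernel_measurable:
  "(\<lambda>z. green_kernel \<beta> p g (fst z) (snd z)) \<in> borel_measurable (borel \<Otimes>\<^sub>M borel)"
proof -
  have [measurable]: "(\<lambda>z. p (fst z) (snd z) * indicator {0<..} (fst z)) \<in> borel_measurable (borel \<Otimes>\<^sub>M borel)"
    by (rule stable_density_measurable[OF alpha nu p])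
  have 1: "(\<lambda>(z, s). (\<lambda>z. p (fst z) (snd z) * indicator {0<..} (fst z)) (s, snd z)) \<in> borel_measurable ((borel \<Otimes>\<^sub>M borel) \<Otimes>\<^sub>M lborel)"
    by measurable
  have 2: "(\<lambda>(z, s). inverse_subordinator_density \<beta> g (fst z) s) \<in> borel_measurable ((borel \<Otimes>\<^sub>M borel) \<Otimes>\<^sub>M lborel)"
    unfolding inverse_subordinator_density_def by measurable
  show ?thesis unfolding green_kernel_eq
    by (rule lborel.borel_measurable_lebesgue_integral)
       (use borel_measurable_times[OF 1 2] in \<open>simp add: split_def\<close>)
qed

text \<open>An inequality covers both cases: where the integral over \<open>s\<close> converges the
  two sides agree, and where it diverges \<open>green_kernel\<close> has the default value
  0.\<close>

lemma ennreal_green_kernel_le: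
  assumes t: "0 < t"
  shows "ennreal \<bar>green_kernel \<beta> p g t x\<bar> \<le>
    (\<integral>\<^sup>+r. ennreal (p (t powr \<beta> * r powr (- \<beta>)) x) \<partial>subordinator_law g)"
proof -
  have [measurable]: "(\<lambda>s. p s x * indicator {0<..} s) \<in> borel_measurable borel"
    using measurable_compose[OF _ stable_density_measurable[OF alpha nu p], of "\<lambda>s. (s, x)" borel] by simp
  have pn: "0 \<le> p s x * indicator {0<..} s" for s
    using stable_density_facts(2)[OF alpha nu p, of s x] by (simp add: indicator_def)
  have "green_kernel \<beta> p g t x \<ge> 0"
    unfolding green_kernel_eq using pn inverse_subordinator_density_nonneg t by (intro Bochner_Integration.integral_nonneg) (simp add: less_imp_le)
  then have "ennreal \<bar>green_kernel \<beta> p g t x\<bar> = ennreal (norm (green_kernel \<beta> p g t x))" by simp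
  also have "\<dots> \<le> (\<integral>\<^sup>+s. ennreal (norm ((p s x * indicator {0<..} s) * inverse_subordinator_density \<beta> g t s)) \<partial>lborel)"
    unfolding green_kernel_eq
    by (cases "integrable lborel (\<lambda>s. (p s x * indicator {0<..} s) * inverse_subordinator_density \<beta> g t s)")
       (auto intro!: integral_norm_bound_ennreal[of _ "\<lambda>s. (p s x * indicator {0<..} s) * inverse_subordinator_density \<beta> g t s", simplified] simp: not_integrable_integral_eq)
  also have "\<dots> = (\<integral>\<^sup>+s\<in>{0<..}. ennreal (p s x * indicator {0<..} s) * ennreal (inverse_subordinator_density \<beta> g t s) \<partial>lborel)"
    using inverse_subordinator_density_nonneg[of t] stable_density_facts(2)[OF alpha nu p] t
    by (intro nn_integral_cong) (auto simp: indicator_def ennreal_mult' less_imp_le)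
  also have "\<dots> = (\<integral>\<^sup>+r. ennreal (p (t powr \<beta> * r powr (- \<beta>)) x * indicator {0<..} (t powr \<beta> * r powr (- \<beta>))) \<partial>subordinator_law g)"
    by (rule nn_integral_inverse_subordinator_density[OF _ t]) measurable
  also have "\<dots> = (\<integral>\<^sup>+r. ennreal (p (t powr \<beta> * r powr (- \<beta>)) x) \<partial>subordinator_law g)"
    using AE_subordinator_law_pos by (intro nn_integral_cong_AE, eventually_elim) (use t in simp)
  finally show ?thesis .
qed

text \<open>The kernel is at most the expectation of the stable density at the random time (t /
  D_1)^\<beta>, so its square is at most a double expectation over independent copies. Integrating
  over \<open>x\<close> first produces the overlap, a negative power of the sum of the two random
  times; the power of \<open>t\<close> factors out and leaves the double integral of
  \<open>nn_integral_mittag_leffler_sq\<close>.\<close>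

lemma nn_integral_green_kernel_sq:
  assumes t: "0 < t" and d: "real DIM('a) < 2 * \<alpha>"
  shows "(\<integral>\<^sup>+x. ennreal ((green_kernel \<beta> p g t x)\<^sup>2) \<partial>lborel) \<le>
    ennreal (C_star DIM('a) \<alpha> \<beta> \<nu> * t powr (- (\<beta> * real DIM('a) / \<alpha>)))"
proof -
  let ?L = "subordinator_law g"
  define q where "q = real DIM('a) / \<alpha>"
  have q: "0 < q" "q < 2" using alpha d by (auto simp: q_def field_simps)
  define s where "s r = t powr \<beta> * r powr (- \<beta>)" for r
  have s: "0 < s r" if "0 < r" for r using that t by (simp add: s_def)
  have [measurable]: "s \<in> borel_measurable borel" unfolding s_def by measurable
  \<comment> \<open>The cut-off version is the one known to be jointly measurable; at the positive
    times \<open>s r\<close> it agrees with \<open>p\<close>.\<close>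
  define P where "P s x = p s x * indicator {0<..} s" for s x
  have Pm: "(\<lambda>z. P (fst z) (snd z)) \<in> borel_measurable (borel \<Otimes>\<^sub>M borel)"
    unfolding P_def by (rule stable_density_measurable[OF alpha nu p])
  have [measurable]: "(\<lambda>z. P (f z) (h z)) \<in> borel_measurable M"
    if [measurable]: "f \<in> borel_measurable M" "h \<in> borel_measurable M" for M :: "'b measure" and f h
    using measurable_compose[OF measurable_Pair[OF that] Pm] by simp
  have Peq: "P (s r) x = p (s r) x" if "0 < r" for r x using s[OF that] by (simp add: P_def)
  have Pn: "0 \<le> P s x" for s x
    using stable_density_facts(2)[OF alpha nu p, of s x] by (simp add: P_def indicator_def)
  \<comment> \<open>The constant of the overlap. Dividing it by \<open>Gamma q\<close> and using
    \<open>Gamma (1 + q) = q * Gamma q\<close> together with the formula for the ball volume gives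
    the prefactor of \<open>C_star\<close>, apart from the power of \<open>\<nu>\<close>.\<close>
  define \<kappa> where "\<kappa> = 1 / (2 * pi) ^ DIM('a) * (unit_ball_vol DIM('a) * Gamma (1 + q))"
  have kappa: "\<kappa> > 0" unfolding \<kappa>_def using q by (intro mult_pos_pos) (auto intro!: Gamma_real_pos)
  interpret LL: pair_sigma_finite ?L "lborel :: 'a measure"
    by (intro pair_sigma_finite.intro law.sigma_finite_measure_axioms lborel.sigma_finite_measure_axioms)
  have "(\<integral>\<^sup>+x. ennreal ((green_kernel \<beta> p g t x)\<^sup>2) \<partial>lborel) \<le> (\<integral>\<^sup>+x. (\<integral>\<^sup>+r. ennreal (P (s r) x) \<partial>?L) * (\<integral>\<^sup>+r. ennreal (P (s r) x) \<partial>?L) \<partial>lborel)"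
  proof (intro nn_integral_mono)
    fix x
    have "(\<integral>\<^sup>+r. ennreal (P (s r) x) \<partial>?L) = (\<integral>\<^sup>+r. ennreal (p (s r) x) \<partial>?L)"
      using AE_subordinator_law_pos by (intro nn_integral_cong_AE, eventually_elim) (simp add: Peq)
    then have "ennreal \<bar>green_kernel \<beta> p g t x\<bar> \<le> (\<integral>\<^sup>+r. ennreal (P (s r) x) \<partial>?L)"
      using ennreal_green_kernel_le[OF t, of x] by (simp add: s_def)
    then have "ennreal \<bar>green_kernel \<beta> p g t x\<bar> * ennreal \<bar>green_kernel \<beta> p g t x\<bar> \<le> (\<integral>\<^sup>+r. ennreal (P (s r) x) \<partial>?L) * (\<integral>\<^sup>+r. ennreal (P (s r) x) \<partial>?L)"
      by (intro mult_mono) auto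
    then show "ennreal ((green_kernel \<beta> p g t x)\<^sup>2) \<le> (\<integral>\<^sup>+r. ennreal (P (s r) x) \<partial>?L) * (\<integral>\<^sup>+r. ennreal (P (s r) x) \<partial>?L)"
      by (simp add: ennreal_mult'[symmetric] power2_eq_square)
  qed
  also have "\<dots> = (\<integral>\<^sup>+x. (\<integral>\<^sup>+r. (\<integral>\<^sup>+r'. ennreal (P (s r) x) * ennreal (P (s r') x) \<partial>?L) \<partial>?L) \<partial>lborel)"
  proof (intro nn_integral_cong)
    fix x
    have [measurable]: "(\<lambda>r. ennreal (P (s r) x)) \<in> borel_measurable ?L" by measurable
    show "(\<integral>\<^sup>+r. ennreal (P (s r) x) \<partial>?L) * (\<integral>\<^sup>+r. ennreal (P (s r) x) \<partial>?L) = (\<integral>\<^sup>+r. (\<integral>\<^sup>+r'. ennreal (P (s r) x) * ennreal (P (s r') x) \<partial>?L) \<partial>?L)"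
      by (simp add: nn_integral_cmult nn_integral_multc)
  qed
  also have "\<dots> = (\<integral>\<^sup>+r. (\<integral>\<^sup>+x. (\<integral>\<^sup>+r'. ennreal (P (s r) x) * ennreal (P (s r') x) \<partial>?L) \<partial>lborel) \<partial>?L)"
    by (rule LL.Fubini') measurable
  also have "\<dots> = (\<integral>\<^sup>+r. (\<integral>\<^sup>+r'. (\<integral>\<^sup>+x. ennreal (P (s r) x) * ennreal (P (s r') x) \<partial>lborel) \<partial>?L) \<partial>?L)"
    by (intro nn_integral_cong LL.Fubini') measurable
  also have "\<dots> = (\<integral>\<^sup>+r. (\<integral>\<^sup>+r'. ennreal (\<kappa> * \<nu> powr (- q) * t powr (- (\<beta> * q)) / Gamma q) * ennreal (Gamma q * (r powr (- \<beta>) + r' powr (- \<beta>)) powr (- q)) \<partial>?L) \<partial>?L)"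
    using AE_subordinator_law_pos
  proof (intro nn_integral_cong_AE, eventually_elim)
    fix r :: real assume r: "0 < r"
    show "(\<integral>\<^sup>+r'. (\<integral>\<^sup>+x. ennreal (P (s r) x) * ennreal (P (s r') x) \<partial>lborel) \<partial>?L) =
      (\<integral>\<^sup>+r'. ennreal (\<kappa> * \<nu> powr (- q) * t powr (- (\<beta> * q)) / Gamma q) * ennreal (Gamma q * (r powr (- \<beta>) + r' powr (- \<beta>)) powr (- q)) \<partial>?L)"
      using AE_subordinator_law_pos
    proof (intro nn_integral_cong_AE, eventually_elim)
      fix r' :: real assume r': "0 < r'"
      have G: "Gamma q > 0" using q by simp
      have "(\<integral>\<^sup>+x. ennreal (P (s r) x) * ennreal (P (s r') x) \<partial>lborel) = (\<integral>\<^sup>+x. ennreal (p (s r) x * p (s r') x) \<partial>lborel)"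
        using r r' Pn by (intro nn_integral_cong) (simp add: ennreal_mult'[symmetric] Peq[symmetric])
      also have "\<dots> = ennreal (\<kappa> * ((s r + s r') * \<nu>) powr (- q))"
        using nn_integral_stable_density_overlap[OF alpha nu p s[OF r] s[OF r']] by (simp add: \<kappa>_def q_def mult.assoc)
      also have "(s r + s r') * \<nu> = (t powr \<beta> * \<nu>) * (r powr (- \<beta>) + r' powr (- \<beta>))"
        by (simp add: s_def algebra_simps)
      also have "\<dots> powr (- q) = t powr (- (\<beta> * q)) * \<nu> powr (- q) * (r powr (- \<beta>) + r' powr (- \<beta>)) powr (- q)"
        using t nu by (simp add: powr_mult powr_powr)
      also have "\<kappa> * (t powr (- (\<beta> * q)) * \<nu> powr (- q) * (r powr (- \<beta>) + r' powr (- \<beta>)) powr (- q)) =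
        (\<kappa> * \<nu> powr (- q) * t powr (- (\<beta> * q)) / Gamma q) * (Gamma q * (r powr (- \<beta>) + r' powr (- \<beta>)) powr (- q))"
        using G by (simp del: Gamma_real_pos)
      finally show "(\<integral>\<^sup>+x. ennreal (P (s r) x) * ennreal (P (s r') x) \<partial>lborel) =
         ennreal (\<kappa> * \<nu> powr (- q) * t powr (- (\<beta> * q)) / Gamma q) * ennreal (Gamma q * (r powr (- \<beta>) + r' powr (- \<beta>)) powr (- q))"
        using G kappa by (subst (asm) ennreal_mult') (auto intro!: divide_nonneg_pos)
    qed
  qed
  also have "\<dots> = ennreal (\<kappa> * \<nu> powr (- q) * t powr (- (\<beta> * q)) / Gamma q) *
     (\<integral>\<^sup>+r. \<integral>\<^sup>+r'. ennreal (Gamma q * (r powr (- \<beta>) + r' powr (- \<beta>)) powr (- q)) \<partial>?L \<partial>?L)"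
    by (simp add: nn_integral_cmult)
  also have "\<dots> = ennreal (\<kappa> * \<nu> powr (- q) * t powr (- (\<beta> * q)) / Gamma q) *
     ennreal (LINT z:{0<..}|lborel. z powr (q - 1) * (mittag_leffler \<beta> (- z))\<^sup>2)"
    using q by (simp add: ennreal_integral_mittag_leffler_sq)
  also have "\<dots> = ennreal (\<kappa> * \<nu> powr (- q) * t powr (- (\<beta> * q)) / Gamma q *
     (LINT z:{0<..}|lborel. z powr (q - 1) * (mittag_leffler \<beta> (- z))\<^sup>2))"
    using kappa q by (intro ennreal_mult'[symmetric]) auto
  also have "\<kappa> * \<nu> powr (- q) * t powr (- (\<beta> * q)) / Gamma q *
     (LINT z:{0<..}|lborel. z powr (q - 1) * (mittag_leffler \<beta> (- z))\<^sup>2) =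
     C_star DIM('a) \<alpha> \<beta> \<nu> * t powr (- (\<beta> * real DIM('a) / \<alpha>))"
  proof -
    have G: "Gamma q > 0" "Gamma (real DIM('a) / 2) > 0" using q by auto
    have Gp: "Gamma (x + 1) = x * Gamma x" if "0 < x" for x :: real
      using that by (intro Gamma_plus1) (metis less_le_not_le nonpos_Ints_nonpos)
    have 1: "Gamma (1 + q) = q * Gamma q" using Gp[OF q(1)] by (simp add: add.commute)
    have 2: "unit_ball_vol DIM('a) = pi powr (real DIM('a) / 2) / (real DIM('a) / 2 * Gamma (real DIM('a) / 2))"
    proof -
      have "Gamma (real DIM('a) / 2 + 1) = real DIM('a) / 2 * Gamma (real DIM('a) / 2)" by (rule Gp) simp
      then show ?thesis unfolding unit_ball_vol_def by (simp only:)
    qed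
    have 3: "\<kappa> / Gamma q = 2 * pi powr (real DIM('a) / 2) / (\<alpha> * Gamma (real DIM('a) / 2)) * (1 / (2 * pi) ^ DIM('a))"
      unfolding \<kappa>_def 1 2 using G alpha by (simp add: q_def field_simps del: Gamma_real_pos Gamma_eq_zero_iff)
    define I where "I = (LINT z:{0<..}|lborel. z powr (q - 1) * (mittag_leffler \<beta> (- z))\<^sup>2)"
    have "\<kappa> * \<nu> powr (- q) * t powr (- (\<beta> * q)) / Gamma q * I = \<nu> powr (- q) * (\<kappa> / Gamma q) * I * t powr (- (\<beta> * q))"
      by simp
    also have "\<dots> = C_star DIM('a) \<alpha> \<beta> \<nu> * t powr (- (\<beta> * real DIM('a) / \<alpha>))"
      unfolding 3 C_star_def q_def[symmetric] I_def[symmetric] by (simp add: q_def)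
    finally show ?thesis by (simp only: I_def)
  qed
  finally show ?thesis .
qed

end

lemma C_star_pos:
  assumes "0 < \<alpha>" "0 < \<nu>" "0 < d" "real d < 2 * \<alpha>"
  shows "0 < C_star d \<alpha> \<beta> \<nu>"
proof -
  have "0 < real d / \<alpha>" "real d / \<alpha> < 2" using assms by (auto simp: field_simps)
  from ennreal_integral_mittag_leffler_sq(2)[OF this] show ?thesis
    unfolding C_star_def using assms by (auto intro!: mult_pos_pos divide_pos_pos Gamma_real_pos)
qed

end

section \<open>Independence and moments of a Poisson random measure\<close>

locale poisson_rm = prob_space M for M :: "'w measure" +
  fixes \<Lambda> :: "'s measure" and N :: "'w \<Rightarrow> 's measure"
  assumes prm: "poisson_random_measure M \<Lambda> N"
begin

lemma sets_N: "\<omega> \<in> space M \<Longrightarrow> sets (N \<omega>) = sets \<Lambda>"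
  using prm by (simp add: poisson_random_measure_def)

lemma emeasure_N_measurable: "A \<in> sets \<Lambda> \<Longrightarrow> (\<lambda>\<omega>. emeasure (N \<omega>) A) \<in> borel_measurable M"
  using prm by (simp add: poisson_random_measure_def)

lemma prob_N_eq:
  "A \<in> sets \<Lambda> \<Longrightarrow> emeasure \<Lambda> A < \<infinity> \<Longrightarrow>
    prob {\<omega>\<in>space M. emeasure (N \<omega>) A = of_nat k} = (measure \<Lambda> A) ^ k / fact k * exp (- measure \<Lambda> A)"
  using prm by (simp add: poisson_random_measure_def)

lemma indep_vars_N:
  fixes A :: "nat \<Rightarrow> 's set"
  shows "range A \<subseteq> sets \<Lambda> \<Longrightarrow> disjoint_family A \<Longrightarrow> indep_vars (\<lambda>_. borel) (\<lambda>i \<omega>. emeasure (N \<omega>) (A i)) UNIV"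
  using prm by (simp add: poisson_random_measure_def)

definition noise_gen :: "'s set \<Rightarrow> 'w set set" where
  "noise_gen E = {{\<omega>\<in>space M. emeasure (N \<omega>) A \<in> B} | A B. A \<in> sets \<Lambda> \<and> A \<subseteq> E \<and> B \<in> sets borel}"

text \<open>Finite intersections of members of \<open>noise_gen\<close>: they generate the same
  sigma-algebra and are stable under intersection, so that independence extends from them to the
  sigma-algebras.\<close>

definition noise_cyl :: "'s set \<Rightarrow> 'w set set" where
  "noise_cyl E = {{\<omega>\<in>space M. \<forall>i<n. emeasure (N \<omega>) (A i) \<in> B i} | (n::nat) A B.
     \<forall>i<n. A i \<in> sets \<Lambda> \<and> A i \<subseteq> E \<and> B i \<in> sets borel}"

text \<open>The information carried by the noise on a region \<open>E\<close>. The filtration at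
  time \<open>t\<close> is the case of the slab up to \<open>t\<close>, while the noise after
  \<open>t\<close> lives on a disjoint region.\<close>

definition noise_algebra :: "'s set \<Rightarrow> 'w measure" where
  "noise_algebra E = sigma (space M) (noise_gen E)"

lemma N_event:
  assumes "A \<in> sets \<Lambda>" "B \<in> sets borel"
  shows "{\<omega>\<in>space M. emeasure (N \<omega>) A \<in> B} \<in> events"
proof -
  have "(\<lambda>\<omega>. emeasure (N \<omega>) A) -` B \<inter> space M \<in> events"
    by (rule measurable_sets[OF emeasure_N_measurable]) fact+
  also have "(\<lambda>\<omega>. emeasure (N \<omega>) A) -` B \<inter> space M = {\<omega>\<in>space M. emeasure (N \<omega>) A \<in> B}" by auto
  finally show ?thesis .
qed

lemma noise_gen_events: "noise_gen E \<subseteq> events"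
  unfolding noise_gen_def by (auto intro: N_event)

lemma noise_cyl_events: "noise_cyl E \<subseteq> events"
proof
  fix a assume "a \<in> noise_cyl E"
  then obtain n :: nat and A B where a: "a = {\<omega>\<in>space M. \<forall>i<n. emeasure (N \<omega>) (A i) \<in> B i}"
    and AB: "\<And>i. i < n \<Longrightarrow> A i \<in> sets \<Lambda> \<and> A i \<subseteq> E \<and> B i \<in> sets borel"
    unfolding noise_cyl_def by auto
  have "{\<omega>\<in>space M. \<forall>i\<in>{..<n}. emeasure (N \<omega>) (A i) \<in> B i} \<in> events"
  proof (rule sets.sets_Collect_finite_All)
    fix i assume "i \<in> {..<n}"
    then show "{\<omega>\<in>space M. emeasure (N \<omega>) (A i) \<in> B i} \<in> events" using AB[of i] N_event by auto
  qed simp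
  also have "{\<omega>\<in>space M. \<forall>i\<in>{..<n}. emeasure (N \<omega>) (A i) \<in> B i} = a" unfolding a by blast
  finally show "a \<in> events" .
qed

lemma space_noise_algebra [simp]: "space (noise_algebra E) = space M"
  unfolding noise_algebra_def by (rule space_measure_of) (use noise_gen_events sets.space_closed in blast)

lemma sets_noise_algebra: "sets (noise_algebra E) = sigma_sets (space M) (noise_gen E)"
  unfolding noise_algebra_def by (rule sets_measure_of) (use noise_gen_events sets.space_closed in blast)

lemma noise_algebra_events: "sets (noise_algebra E) \<subseteq> events"
  unfolding sets_noise_algebra by (rule sets.sigma_sets_subset[OF noise_gen_events])

lemma noise_algebra_mono: "E \<subseteq> E' \<Longrightarrow> sets (noise_algebra E) \<subseteq> sets (noise_algebra E')"
  unfolding sets_noise_algebra by (rule sigma_sets_mono') (auto simp: noise_gen_def)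

lemma noise_algebra_eq_cyl: "sets (noise_algebra E) = sigma_sets (space M) (noise_cyl E)"
proof (rule antisym)
  have "noise_gen E \<subseteq> noise_cyl E"
  proof
    fix a assume "a \<in> noise_gen E"
    then obtain A B where "a = {\<omega>\<in>space M. emeasure (N \<omega>) A \<in> B}" "A \<in> sets \<Lambda> \<and> A \<subseteq> E \<and> B \<in> sets borel"
      unfolding noise_gen_def by auto
    then show "a \<in> noise_cyl E"
      unfolding noise_cyl_def by (auto intro!: exI[of _ "Suc 0"] exI[of _ "\<lambda>_. A"] exI[of _ "\<lambda>_. B"])
  qed
  then show "sets (noise_algebra E) \<subseteq> sigma_sets (space M) (noise_cyl E)"
    unfolding sets_noise_algebra by (rule sigma_sets_mono')
  have "noise_cyl E \<subseteq> sets (noise_algebra E)"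
  proof
    fix a assume "a \<in> noise_cyl E"
    then obtain n :: nat and A B where a: "a = {\<omega>\<in>space M. \<forall>i<n. emeasure (N \<omega>) (A i) \<in> B i}"
      and AB: "\<And>i. i < n \<Longrightarrow> A i \<in> sets \<Lambda> \<and> A i \<subseteq> E \<and> B i \<in> sets borel"
      unfolding noise_cyl_def by auto
    have "{\<omega>\<in>space (noise_algebra E). \<forall>i\<in>{..<n}. emeasure (N \<omega>) (A i) \<in> B i} \<in> sets (noise_algebra E)"
    proof (rule sets.sets_Collect_finite_All)
      fix i assume "i \<in> {..<n}"
      then show "{\<omega>\<in>space (noise_algebra E). emeasure (N \<omega>) (A i) \<in> B i} \<in> sets (noise_algebra E)"
        unfolding sets_noise_algebra space_noise_algebra
        using AB[of i] by (intro sigma_sets.Basic) (auto simp: noise_gen_def)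
    qed simp
    also have "{\<omega>\<in>space (noise_algebra E). \<forall>i\<in>{..<n}. emeasure (N \<omega>) (A i) \<in> B i} = a"
      unfolding a space_noise_algebra by blast
    finally show "a \<in> sets (noise_algebra E)" .
  qed
  then show "sigma_sets (space M) (noise_cyl E) \<subseteq> sets (noise_algebra E)"
    using sets.sigma_sets_subset[of "noise_cyl E" "noise_algebra E"] by simp
qed

lemma Int_stable_noise_cyl: "Int_stable (noise_cyl E)"
proof (rule Int_stableI)
  fix a b assume "a \<in> noise_cyl E" "b \<in> noise_cyl E"
  then obtain n :: nat and A B and m :: nat and A' B' where
    a: "a = {\<omega>\<in>space M. \<forall>i<n. emeasure (N \<omega>) (A i) \<in> B i}" "\<And>i. i < n \<Longrightarrow> A i \<in> sets \<Lambda> \<and> A i \<subseteq> E \<and> B i \<in> sets borel" and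
    b: "b = {\<omega>\<in>space M. \<forall>i<m. emeasure (N \<omega>) (A' i) \<in> B' i}" "\<And>i. i < m \<Longrightarrow> A' i \<in> sets \<Lambda> \<and> A' i \<subseteq> E \<and> B' i \<in> sets borel"
    unfolding noise_cyl_def by auto
  \<comment> \<open>Concatenation of the two families; the second one is shifted by
    \<open>n\<close>.\<close>
  define C where "C i = (if i < n then A i else A' (i - n))" for i
  define D where "D i = (if i < n then B i else B' (i - n))" for i
  have "(\<forall>i<n + m. P (C i) (D i)) \<longleftrightarrow> (\<forall>i<n. P (A i) (B i)) \<and> (\<forall>i<m. P (A' i) (B' i))" for P
  proof safe
    fix i assume *: "\<forall>i<n + m. P (C i) (D i)"
    show "P (A i) (B i)" if "i < n" using *[rule_format, of i] that by (simp add: C_def D_def)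
    show "P (A' i) (B' i)" if "i < m" using *[rule_format, of "n + i"] that by (simp add: C_def D_def)
  next
    fix i assume "\<forall>i<n. P (A i) (B i)" "\<forall>i<m. P (A' i) (B' i)" "i < n + m"
    then show "P (C i) (D i)" by (cases "i < n") (auto simp: C_def D_def)
  qed
  note split = this
  have "a \<inter> b = {\<omega>\<in>space M. \<forall>i<n + m. emeasure (N \<omega>) (C i) \<in> D i}"
    unfolding a(1) b(1) using split[of "\<lambda>x y. emeasure (N \<omega>) x \<in> y" for \<omega>] by auto
  moreover have "\<forall>i<n + m. C i \<in> sets \<Lambda> \<and> C i \<subseteq> E \<and> D i \<in> sets borel"
    using a(2) b(2) by (subst split[of "\<lambda>x y. x \<in> sets \<Lambda> \<and> x \<subseteq> E \<and> y \<in> sets borel"]) auto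
  ultimately show "a \<inter> b \<in> noise_cyl E" unfolding noise_cyl_def by blast
qed

text \<open>The atoms of the finite algebra generated by the sets of both cylinders form one disjoint
  sequence, indexed through the bijection \<open>set_decode\<close> between numbers and finite sets.\<close>

lemma noise_cyl_indep:
  assumes E: "E \<inter> E' = {}" and "a \<in> noise_cyl E" "b \<in> noise_cyl E'"
  shows "prob (a \<inter> b) = prob a * prob b"
proof -
  obtain n :: nat and A B and m :: nat and A' B' where
    a: "a = {\<omega>\<in>space M. \<forall>i<n. emeasure (N \<omega>) (A i) \<in> B i}" "\<And>i. i < n \<Longrightarrow> A i \<in> sets \<Lambda> \<and> A i \<subseteq> E \<and> B i \<in> sets borel" and
    b: "b = {\<omega>\<in>space M. \<forall>i<m. emeasure (N \<omega>) (A' i) \<in> B' i}" "\<And>i. i < m \<Longrightarrow> A' i \<in> sets \<Lambda> \<and> A' i \<subseteq> E' \<and> B' i \<in> sets borel"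
    using assms(2,3) unfolding noise_cyl_def by auto
  define C where "C i = (if i < n then A i else A' (i - n))" for i
  have C: "C i \<in> sets \<Lambda>" if "i < n + m" for i using a(2)[of i] b(2)[of "i - n"] that by (auto simp: C_def)
  \<comment> \<open>The points whose membership pattern with respect to the \<open>n + m\<close>
    sets is the finite set coded by \<open>k\<close>. Codes that reach beyond
    \<open>{..<n + m}\<close> give empty atoms, so the series over all \<open>k\<close> below have
    only finitely many nonzero terms.\<close>
  define At where "At k = {x\<in>space \<Lambda>. {i. i < n + m \<and> x \<in> C i} = set_decode k}" for k
  have At_sets: "At k \<in> sets \<Lambda>" for k
  proof (cases "set_decode k \<subseteq> {..<n + m}")
    case True
    then have "At k = {x\<in>space \<Lambda>. \<forall>i\<in>{..<n + m}. (x \<in> C i) = (i \<in> set_decode k)}"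
      by (auto simp: At_def)
    also have "\<dots> \<in> sets \<Lambda>"
    proof (rule sets.sets_Collect_finite_All)
      fix i assume "i \<in> {..<n + m}"
      then have "C i \<in> sets \<Lambda>" using C by simp
      moreover have "{x\<in>space \<Lambda>. (x \<in> C i) = (i \<in> set_decode k)} = (if i \<in> set_decode k then space \<Lambda> \<inter> C i else space \<Lambda> - C i)" by auto
      ultimately show "{x\<in>space \<Lambda>. (x \<in> C i) = (i \<in> set_decode k)} \<in> sets \<Lambda>" by (auto simp del: set_decode_plus_power_2)
    qed simp
    finally show ?thesis .
  next
    case False
    then have "At k = {}" by (auto simp: At_def)
    then show ?thesis by simp
  qed
  have disj: "disjoint_family At"
  proof (unfold disjoint_family_on_def, safe)
    fix k l x assume "k \<noteq> l" "x \<in> At k" "x \<in> At l"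
    then have "set_decode k = set_decode l" by (simp add: At_def)
    then have "k = l" by (metis set_decode_inverse)
    with \<open>k \<noteq> l\<close> show "x \<in> {}" by simp
  qed
  define X where "X k \<omega> = emeasure (N \<omega>) (At k)" for k \<omega>
  have ind: "indep_vars (\<lambda>_. borel) X UNIV"
    unfolding X_def[abs_def] by (rule indep_vars_N) (use At_sets disj in auto)
  have NC: "emeasure (N \<omega>) (C i) = (\<Sum>k. if i \<in> set_decode k \<and> At k \<noteq> {} then X k \<omega> else 0)"
    if w: "\<omega> \<in> space M" and i: "i < n + m" for \<omega> i
  proof -
    define D where "D k = (if i \<in> set_decode k then At k else {})" for k
    have "C i = (\<Union>k. D k)"
    proof (rule set_eqI)
      fix x
      show "x \<in> C i \<longleftrightarrow> x \<in> (\<Union>k. D k)"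
      proof
        assume x: "x \<in> C i"
        then have xs: "x \<in> space \<Lambda>" using C[OF i] sets.sets_into_space by auto
        define k where "k = set_encode {i. i < n + m \<and> x \<in> C i}"
        have "set_decode k = {i. i < n + m \<and> x \<in> C i}" unfolding k_def by (rule set_encode_inverse) simp
        then have "x \<in> D k" using x i xs by (simp add: D_def At_def)
        then show "x \<in> (\<Union>k. D k)" by auto
      next
        assume "x \<in> (\<Union>k. D k)"
        then obtain k where "i \<in> set_decode k" "x \<in> At k" by (auto simp: D_def split: if_splits)
        then show "x \<in> C i" by (auto simp: At_def)
      qed
    qed
    moreover have "(\<Sum>k. emeasure (N \<omega>) (D k)) = emeasure (N \<omega>) (\<Union>k. D k)"
    proof (rule suminf_emeasure)
      show "range D \<subseteq> sets (N \<omega>)" using At_sets sets_N[OF w] by (auto simp: D_def)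
      show "disjoint_family D" using disj unfolding disjoint_family_on_def D_def by auto
    qed
    moreover have "emeasure (N \<omega>) (D k) = (if i \<in> set_decode k \<and> At k \<noteq> {} then X k \<omega> else 0)" for k
      by (auto simp: D_def X_def)
    ultimately show ?thesis by simp
  qed
  \<comment> \<open>Codes of patterns that meet the first block. A pattern meeting both blocks
    belongs to an empty atom, since \<open>E\<close> and \<open>E'\<close> are disjoint; the guard
    \<open>At k \<noteq> {}\<close> removes such patterns, so the counts of the second block use
    only codes outside \<open>K\<close>. The two cylinders are thus events of complementary blocks
    of one independent sequence.\<close>
  define K where "K = {k. set_decode k \<inter> {..<n} \<noteq> {}}"
  define S where "S = {f\<in>space (Pi\<^sub>M K (\<lambda>_. borel)). \<forall>i\<in>{..<n}. (\<Sum>k. if i \<in> set_decode k \<and> At k \<noteq> {} then f k else 0) \<in> B i}"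
  define S' where "S' = {f\<in>space (Pi\<^sub>M (- K) (\<lambda>_. borel)). \<forall>i\<in>{..<m}. (\<Sum>k. if n + i \<in> set_decode k \<and> At k \<noteq> {} then f k else 0) \<in> B' i}"
  have K': "k \<notin> K" if h: "n + i \<in> set_decode k" "At k \<noteq> {}" "i < m" for i k
  proof
    assume "k \<in> K"
    then obtain j where j: "j < n" "j \<in> set_decode k" by (auto simp: K_def)
    obtain x where "x \<in> At k" using h by auto
    then have "x \<in> C j" "x \<in> C (n + i)" using j h by (auto simp: At_def)
    then have "x \<in> A j" "x \<in> A' i" using j by (auto simp: C_def)
    then show False using a(2)[OF j(1)] b(2)[OF h(3)] E by auto
  qed
  have ms: "(\<lambda>f. \<Sum>k. if P k then f k else (0::ennreal)) \<in> borel_measurable (Pi\<^sub>M I (\<lambda>_. borel))"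
    if "\<And>k. P k \<Longrightarrow> k \<in> I" for P and I :: "nat set"
  proof (rule borel_measurable_suminf_order)
    fix k
    show "(\<lambda>f. if P k then f k else (0::ennreal)) \<in> borel_measurable (Pi\<^sub>M I (\<lambda>_. borel))"
      using that[of k] by (cases "P k") (auto intro: measurable_component_singleton)
  qed
  have S: "S \<in> sets (Pi\<^sub>M K (\<lambda>_. borel))" unfolding S_def
  proof (rule sets.sets_Collect_finite_All)
    fix i assume i: "i \<in> {..<n}"
    then show "{f\<in>space (Pi\<^sub>M K (\<lambda>_. borel)). (\<Sum>k. if i \<in> set_decode k \<and> At k \<noteq> {} then f k else 0) \<in> B i} \<in> sets (Pi\<^sub>M K (\<lambda>_. borel))"
      using a(2)[of i] by (intro measurable_sets_Collect[OF ms]) (auto simp: K_def)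
  qed simp
  have S': "S' \<in> sets (Pi\<^sub>M (- K) (\<lambda>_. borel))" unfolding S'_def
  proof (rule sets.sets_Collect_finite_All)
    fix i assume i: "i \<in> {..<m}"
    then show "{f\<in>space (Pi\<^sub>M (- K) (\<lambda>_. borel)). (\<Sum>k. if n + i \<in> set_decode k \<and> At k \<noteq> {} then f k else 0) \<in> B' i} \<in> sets (Pi\<^sub>M (- K) (\<lambda>_. borel))"
      using b(2)[of i] K' by (intro measurable_sets_Collect[OF ms]) auto
  qed simp
  let ?V = "\<lambda>\<omega>. restrict (\<lambda>k. X k \<omega>) K" and ?V' = "\<lambda>\<omega>. restrict (\<lambda>k. X k \<omega>) (- K)"
  have iv: "indep_var (Pi\<^sub>M K (\<lambda>_. borel)) ?V (Pi\<^sub>M (- K) (\<lambda>_. borel)) ?V'"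
    by (rule indep_var_restrict[OF ind]) auto
  have aV: "?V -` S \<inter> space M = a"
  proof -
    have "(\<Sum>k. if i \<in> set_decode k \<and> At k \<noteq> {} then ?V \<omega> k else 0) = emeasure (N \<omega>) (A i)"
      if "\<omega> \<in> space M" "i < n" for \<omega> i
    proof -
      have "emeasure (N \<omega>) (A i) = emeasure (N \<omega>) (C i)" using that by (simp add: C_def)
      also have "\<dots> = (\<Sum>k. if i \<in> set_decode k \<and> At k \<noteq> {} then X k \<omega> else 0)" by (rule NC) (use that in auto)
      also have "\<dots> = (\<Sum>k. if i \<in> set_decode k \<and> At k \<noteq> {} then ?V \<omega> k else 0)"
        using that by (intro suminf_cong) (auto simp: K_def)
      finally show ?thesis by simp
    qed
    then show ?thesis unfolding S_def a(1) by (auto simp: space_PiM)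
  qed
  have bV: "?V' -` S' \<inter> space M = b"
  proof -
    have "(\<Sum>k. if n + i \<in> set_decode k \<and> At k \<noteq> {} then ?V' \<omega> k else 0) = emeasure (N \<omega>) (A' i)"
      if "\<omega> \<in> space M" "i < m" for \<omega> i
    proof -
      have "emeasure (N \<omega>) (A' i) = emeasure (N \<omega>) (C (n + i))" using that by (simp add: C_def)
      also have "\<dots> = (\<Sum>k. if n + i \<in> set_decode k \<and> At k \<noteq> {} then X k \<omega> else 0)" by (rule NC) (use that in auto)
      also have "\<dots> = (\<Sum>k. if n + i \<in> set_decode k \<and> At k \<noteq> {} then ?V' \<omega> k else 0)"
        using that K' by (intro suminf_cong) auto
      finally show ?thesis by simp
    qed
    then show ?thesis unfolding S'_def b(1) by (auto simp: space_PiM)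
  qed
  have "a \<inter> b = (\<lambda>\<omega>. (?V \<omega>, ?V' \<omega>)) -` (S \<times> S') \<inter> space M"
    unfolding aV[symmetric] bV[symmetric] by auto
  then show ?thesis
    using indep_varD[OF iv S S'] unfolding aV bV by simp
qed

lemma indep_set_noise_algebra:
  assumes "E \<inter> E' = {}"
  shows "indep_set (sets (noise_algebra E)) (sets (noise_algebra E'))"
  unfolding noise_algebra_eq_cyl
  by (intro indep_set_sigma_sets indep_setI Int_stable_noise_cyl noise_cyl_events noise_cyl_indep[OF assms])

lemma noise_algebra_expectation_mult:
  fixes X Y :: "'w \<Rightarrow> real"
  assumes E: "E \<inter> E' = {}"
    and X: "X \<in> borel_measurable (noise_algebra E)" "integrable M X"
    and Y: "Y \<in> borel_measurable (noise_algebra E')" "integrable M Y"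
  shows "integrable M (\<lambda>\<omega>. X \<omega> * Y \<omega>)" "expectation (\<lambda>\<omega>. X \<omega> * Y \<omega>) = expectation X * expectation Y"
proof -
  have sub: "sigma_sets (space M) {Z -` B \<inter> space M | B. B \<in> sets borel} \<subseteq> sets (noise_algebra F)"
    if "Z \<in> borel_measurable (noise_algebra F)" for Z :: "'w \<Rightarrow> real" and F
    using measurable_sets[OF that] sets.sigma_sets_subset[of "{Z -` B \<inter> space M | B. B \<in> sets borel}" "noise_algebra F"]
    by auto
  have "indep_var borel X borel Y"
    unfolding indep_var_eq
  proof (intro conjI)
    show "random_variable borel X" "random_variable borel Y" using X Y by auto
    show "indep_set (sigma_sets (space M) {X -` A \<inter> space M | A. A \<in> sets borel}) (sigma_sets (space M) {Y -` A \<inter> space M | A. A \<in> sets borel})"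
      using indep_set_noise_algebra[OF E] sub[OF X(1)] sub[OF Y(1)] unfolding indep_sets2_eq by blast
  qed
  then show "integrable M (\<lambda>\<omega>. X \<omega> * Y \<omega>)" "expectation (\<lambda>\<omega>. X \<omega> * Y \<omega>) = expectation X * expectation Y"
    using indep_var_integrable indep_var_lebesgue_integral X(2) Y(2) by blast+
qed

end

lemma sums_poisson:
  fixes l :: real
  defines "f \<equiv> \<lambda>k. l ^ k / fact k * exp (- l)"
  shows sums_poisson_0: "f sums 1"
    and sums_poisson_1: "(\<lambda>k. real k * f k) sums l"
    and sums_poisson_var: "(\<lambda>k. (real k - l)\<^sup>2 * f k) sums l"
proof -
  have "(\<lambda>k. l ^ k /\<^sub>R fact k * exp (- l)) sums (exp l * exp (- l))"
    by (intro sums_mult2 exp_converges)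
  then show 0: "f sums 1" by (simp add: f_def exp_minus divide_inverse mult.commute)
  \<comment> \<open>This recursion for the Poisson weights shifts the index by one, and applied
    again it reduces each factorial moment to the previous one.\<close>
  have S: "real (Suc k) * f (Suc k) = l * f k" for k
    by (simp add: f_def divide_simps del: of_nat_Suc)
  have "(\<lambda>k. real (Suc k) * f (Suc k)) sums (l * 1)"
    unfolding S by (intro sums_mult 0)
  then show 1: "(\<lambda>k. real k * f k) sums l" using sums_Suc[of "\<lambda>k. real k * f k"] by simp
  have "real (Suc k) * real (Suc k) * f (Suc k) = l * (real k * f k + f k)" for k
    unfolding mult.assoc S by (simp add: algebra_simps)
  then have "(\<lambda>k. real (Suc k) * real (Suc k) * f (Suc k)) sums (l * (l + 1))"
    by (simp only:) (intro sums_mult sums_add 0 1)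
  then have 2: "(\<lambda>k. real k * real k * f k) sums (l * (l + 1))"
    using sums_Suc[of "\<lambda>k. real k * real k * f k"] by simp
  have "(\<lambda>k. real k * real k * f k - 2 * l * (real k * f k) + l * l * f k) sums (l * (l + 1) - 2 * l * l + l * l * 1)"
    by (intro sums_add sums_diff sums_mult 0 1 2)
  then show "(\<lambda>k. (real k - l)\<^sup>2 * f k) sums l"
    by (simp add: power2_eq_square algebra_simps)
qed

context poisson_rm
begin

context
  fixes A assumes A: "A \<in> sets \<Lambda>" "emeasure \<Lambda> A < \<infinity>"
begin

text \<open>The Poisson weights sum to 1, so the prescribed probabilities already exhaust the space.
  In particular counts are almost surely finite, which makes the real-valued \<open>measure\<close>
  of \<open>N \<omega>\<close> faithful.\<close>

lemma AE_N_nat: "AE \<omega> in M. \<exists>k::nat. emeasure (N \<omega>) A = of_nat k"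
proof -
  let ?E = "\<lambda>k::nat. {\<omega>\<in>space M. emeasure (N \<omega>) A = of_nat k}"
  have ev: "?E k \<in> events" for k using N_event[OF A(1), of "{of_nat k}"] by simp
  have "disjoint_family ?E" by (auto simp: disjoint_family_on_def)
  then have "(\<lambda>k. prob (?E k)) sums prob (\<Union>k. ?E k)"
    using ev by (intro finite_measure_UNION) auto
  then have "prob (\<Union>k. ?E k) = 1"
    using sums_poisson_0[of "measure \<Lambda> A"] unfolding prob_N_eq[OF A] by (rule sums_unique2)
  then have "AE \<omega> in M. \<omega> \<in> (\<Union>k. ?E k)"
    using ev by (subst AE_in_set_eq_1) auto
  then show ?thesis by eventually_elim auto
qed

lemma nn_integral_N:
  "(\<integral>\<^sup>+\<omega>. \<phi> (emeasure (N \<omega>) A) \<partial>M) =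
    (\<Sum>k. \<phi> (of_nat k) * ennreal ((measure \<Lambda> A) ^ k / fact k * exp (- measure \<Lambda> A)))"
proof -
  let ?E = "\<lambda>k::nat. {\<omega>\<in>space M. emeasure (N \<omega>) A = of_nat k}"
  have ev [measurable]: "?E k \<in> events" for k using N_event[OF A(1), of "{of_nat k}"] by simp
  have "(\<integral>\<^sup>+\<omega>. \<phi> (emeasure (N \<omega>) A) \<partial>M) = (\<integral>\<^sup>+\<omega>. (\<Sum>k. \<phi> (of_nat k) * indicator (?E k) \<omega>) \<partial>M)"
    using AE_N_nat AE_space
  proof (intro nn_integral_cong_AE, eventually_elim)
    fix \<omega> assume "\<exists>k::nat. emeasure (N \<omega>) A = of_nat k" and w: "\<omega> \<in> space M"
    then obtain k :: nat where k: "emeasure (N \<omega>) A = of_nat k" by auto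
    have "(\<Sum>j. \<phi> (of_nat j) * indicator (?E j) \<omega>) = (\<Sum>j\<in>{k}. \<phi> (of_nat j) * indicator (?E j) \<omega>)"
      by (rule suminf_finite) (auto simp: k indicator_def)
    then show "\<phi> (emeasure (N \<omega>) A) = (\<Sum>j. \<phi> (of_nat j) * indicator (?E j) \<omega>)"
      using w by (simp add: k)
  qed
  also have "\<dots> = (\<Sum>k. (\<integral>\<^sup>+\<omega>. \<phi> (of_nat k) * indicator (?E k) \<omega> \<partial>M))"
    by (rule nn_integral_suminf) simp
  also have "\<dots> = (\<Sum>k. \<phi> (of_nat k) * ennreal ((measure \<Lambda> A) ^ k / fact k * exp (- measure \<Lambda> A)))"
    using ev by (intro suminf_cong) (simp add: nn_integral_cmult_indicator emeasure_eq_measure prob_N_eq[OF A])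
  finally show ?thesis .
qed

end

definition compensated :: "'s set \<Rightarrow> 'w \<Rightarrow> real" where
  "compensated A \<omega> = measure (N \<omega>) A - measure \<Lambda> A"

lemma compensated_measurable:
  assumes "A \<in> sets \<Lambda>" "A \<subseteq> E"
  shows "compensated A \<in> borel_measurable (noise_algebra E)"
proof -
  have "(\<lambda>\<omega>. emeasure (N \<omega>) A) \<in> borel_measurable (noise_algebra E)"
  proof (rule measurableI)
    fix B :: "ennreal set" assume "B \<in> sets borel"
    then have "{\<omega>\<in>space M. emeasure (N \<omega>) A \<in> B} \<in> noise_gen E" using assms by (auto simp: noise_gen_def)
    moreover have "(\<lambda>\<omega>. emeasure (N \<omega>) A) -` B \<inter> space (noise_algebra E) = {\<omega>\<in>space M. emeasure (N \<omega>) A \<in> B}" by auto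
    ultimately show "(\<lambda>\<omega>. emeasure (N \<omega>) A) -` B \<inter> space (noise_algebra E) \<in> sets (noise_algebra E)"
      unfolding sets_noise_algebra by auto
  qed auto
  then show ?thesis unfolding compensated_def[abs_def] measure_def by simp
qed

lemma measurable_from_noise_algebra:
  "X \<in> borel_measurable (noise_algebra E) \<Longrightarrow> X \<in> borel_measurable M"
  by (rule measurable_from_subalg) (simp_all add: subalgebra_def noise_algebra_events)

lemma compensated_rv: "A \<in> sets \<Lambda> \<Longrightarrow> compensated A \<in> borel_measurable M"
  by (rule measurable_from_noise_algebra[OF compensated_measurable[OF _ subset_UNIV]])

lemma compensated_moments:
  assumes A: "A \<in> sets \<Lambda>" "emeasure \<Lambda> A < \<infinity>"
  shows "integrable M (compensated A)" "expectation (compensated A) = 0"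
    "integrable M (\<lambda>\<omega>. (compensated A \<omega>)\<^sup>2)" "expectation (\<lambda>\<omega>. (compensated A \<omega>)\<^sup>2) = measure \<Lambda> A"
proof -
  let ?l = "measure \<Lambda> A" and ?p = "\<lambda>k. (measure \<Lambda> A) ^ k / fact k * exp (- measure \<Lambda> A)"
  have p: "0 \<le> ?p k" for k by simp
  note [measurable] = compensated_rv[OF A(1)]
  have Nm [measurable]: "(\<lambda>\<omega>. measure (N \<omega>) A) \<in> borel_measurable M"
    unfolding measure_def using emeasure_N_measurable[OF A(1)] by simp
  have "(\<integral>\<^sup>+\<omega>. ennreal (measure (N \<omega>) A) \<partial>M) = (\<Sum>k. ennreal (enn2real (of_nat k)) * ennreal (?p k))"
    unfolding measure_def[of "N _"] by (rule nn_integral_N[OF A])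
  also have "\<dots> = (\<Sum>k. ennreal (real k * ?p k))"
    by (intro suminf_cong, subst ennreal_mult''[symmetric]) auto
  also have "\<dots> = ennreal ?l"
    using sums_poisson_1[of ?l] p by (intro suminf_ennreal_eq) auto
  finally have N1: "(\<integral>\<^sup>+\<omega>. ennreal (measure (N \<omega>) A) \<partial>M) = ennreal ?l" .
  have int1: "integrable M (\<lambda>\<omega>. measure (N \<omega>) A)"
    by (rule integrableI_nonneg) (auto simp: N1)
  have "ennreal (expectation (\<lambda>\<omega>. measure (N \<omega>) A)) = ennreal ?l"
    using nn_integral_eq_integral[OF int1] N1 by simp
  then have e1: "expectation (\<lambda>\<omega>. measure (N \<omega>) A) = ?l" by simp
  show "integrable M (compensated A)" "expectation (compensated A) = 0"
    unfolding compensated_def[abs_def] using int1 by (auto simp: e1 prob_space)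
  have "(\<integral>\<^sup>+\<omega>. ennreal ((compensated A \<omega>)\<^sup>2) \<partial>M) = (\<Sum>k. ennreal ((enn2real (of_nat k) - ?l)\<^sup>2) * ennreal (?p k))"
    unfolding compensated_def measure_def[of "N _"] by (rule nn_integral_N[OF A])
  also have "\<dots> = (\<Sum>k. ennreal ((real k - ?l)\<^sup>2 * ?p k))"
    by (intro suminf_cong) (simp add: ennreal_mult''[symmetric])
  also have "\<dots> = ennreal ?l"
    using sums_poisson_var[of ?l] p by (intro suminf_ennreal_eq) auto
  finally have N2: "(\<integral>\<^sup>+\<omega>. ennreal ((compensated A \<omega>)\<^sup>2) \<partial>M) = ennreal ?l" .
  show int2: "integrable M (\<lambda>\<omega>. (compensated A \<omega>)\<^sup>2)"
    by (rule integrableI_nonneg) (auto simp: N2)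
  have "ennreal (expectation (\<lambda>\<omega>. (compensated A \<omega>)\<^sup>2)) = ennreal ?l"
    using nn_integral_eq_integral[OF int2] N2 by simp
  then show "expectation (\<lambda>\<omega>. (compensated A \<omega>)\<^sup>2) = ?l" by simp
qed

text \<open>The equality is almost sure because \<open>measure\<close> sends an infinite count to 0
  and is additive only where both counts are finite.\<close>

lemma compensated_Un:
  assumes A: "A \<in> sets \<Lambda>" "emeasure \<Lambda> A < \<infinity>" and B: "B \<in> sets \<Lambda>" "emeasure \<Lambda> B < \<infinity>" and "A \<inter> B = {}"
  shows "AE \<omega> in M. compensated (A \<union> B) \<omega> = compensated A \<omega> + compensated B \<omega>"
  using AE_N_nat[OF A] AE_N_nat[OF B] AE_space
proof eventually_elim
  case (elim \<omega>)
  have "measure (N \<omega>) (A \<union> B) = measure (N \<omega>) A + measure (N \<omega>) B"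
    using elim sets_N[of \<omega>] A B \<open>A \<inter> B = {}\<close> by (intro measure_Union) auto
  moreover have "measure \<Lambda> (A \<union> B) = measure \<Lambda> A + measure \<Lambda> B"
    using A B \<open>A \<inter> B = {}\<close> by (intro measure_Union) auto
  ultimately show ?case by (simp add: compensated_def)
qed

lemma emeasure_finite_mono: "emeasure \<Lambda> A < \<infinity> \<Longrightarrow> A \<in> sets \<Lambda> \<Longrightarrow> B \<subseteq> A \<Longrightarrow> emeasure \<Lambda> B < \<infinity>"
  using emeasure_mono[of B A \<Lambda>] by (meson order_le_less_trans)

lemma compensated_disjoint:
  assumes A: "A \<in> sets \<Lambda>" "emeasure \<Lambda> A < \<infinity>" and B: "B \<in> sets \<Lambda>" "emeasure \<Lambda> B < \<infinity>" and d: "A \<inter> B = {}"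
  shows "integrable M (\<lambda>\<omega>. compensated A \<omega> * compensated B \<omega>)"
    "expectation (\<lambda>\<omega>. compensated A \<omega> * compensated B \<omega>) = 0"
  using noise_algebra_expectation_mult[OF d compensated_measurable[OF A(1) subset_refl] compensated_moments(1)[OF A]
      compensated_measurable[OF B(1) subset_refl] compensated_moments(1)[OF B]] compensated_moments(2)[OF A]
  by auto

text \<open>Split the two sets into \<open>A - B\<close>, \<open>A \<inter> B\<close> and
  \<open>B - A\<close>. Products over disjoint pieces have mean zero by independence, so only the
  variance on the intersection remains.\<close>

lemma compensated_covariance:
  assumes A: "A \<in> sets \<Lambda>" "emeasure \<Lambda> A < \<infinity>" and B: "B \<in> sets \<Lambda>" "emeasure \<Lambda> B < \<infinity>"
  shows "integrable M (\<lambda>\<omega>. compensated A \<omega> * compensated B \<omega>)"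
    and "expectation (\<lambda>\<omega>. compensated A \<omega> * compensated B \<omega>) = measure \<Lambda> (A \<inter> B)"
proof -
  let ?U = "A - B" and ?V = "A \<inter> B" and ?W = "B - A"
  have U: "?U \<in> sets \<Lambda>" "emeasure \<Lambda> ?U < \<infinity>" and V: "?V \<in> sets \<Lambda>" "emeasure \<Lambda> ?V < \<infinity>" and W: "?W \<in> sets \<Lambda>" "emeasure \<Lambda> ?W < \<infinity>"
    using A B emeasure_finite_mono[OF A(2,1)] emeasure_finite_mono[OF B(2,1)] by auto
  have eA: "AE \<omega> in M. compensated A \<omega> = compensated ?U \<omega> + compensated ?V \<omega>"
  proof -
    have "?U \<union> ?V = A" "?U \<inter> ?V = {}" by auto
    then show ?thesis using compensated_Un[OF U V] by simp
  qed
  have eB: "AE \<omega> in M. compensated B \<omega> = compensated ?W \<omega> + compensated ?V \<omega>"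
  proof -
    have "?W \<union> ?V = B" "?W \<inter> ?V = {}" by auto
    then show ?thesis using compensated_Un[OF W V] by simp
  qed
  have e: "AE \<omega> in M. compensated A \<omega> * compensated B \<omega> =
     compensated ?U \<omega> * compensated ?W \<omega> + compensated ?U \<omega> * compensated ?V \<omega> + compensated ?V \<omega> * compensated ?W \<omega> + (compensated ?V \<omega>)\<^sup>2"
    using eA eB by eventually_elim (simp add: algebra_simps power2_eq_square)
  note m [measurable] = compensated_rv[OF A(1)] compensated_rv[OF B(1)] compensated_rv[OF U(1)] compensated_rv[OF V(1)] compensated_rv[OF W(1)]
  have d: "?U \<inter> ?W = {}" "?U \<inter> ?V = {}" "?V \<inter> ?W = {}" by auto
  note D = compensated_disjoint[OF U W d(1)] compensated_disjoint[OF U V d(2)] compensated_disjoint[OF V W d(3)] compensated_moments(3,4)[OF V]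
  show "integrable M (\<lambda>\<omega>. compensated A \<omega> * compensated B \<omega>)"
    by (subst integrable_cong_AE[OF _ _ e]) (use D in auto)
  show "expectation (\<lambda>\<omega>. compensated A \<omega> * compensated B \<omega>) = measure \<Lambda> (A \<inter> B)"
    by (subst integral_cong_AE[OF _ _ e]) (use D in auto)
qed

text \<open>The martingale step of the isometry. \<open>E\<close> is the past, \<open>E'\<close> the
  future, \<open>G\<close> an event of the past, and \<open>A\<close> may straddle the two. The past
  part of \<open>A\<close>, multiplied by the indicator of \<open>G\<close>, is independent of the
  centred future noise on \<open>B\<close> and contributes 0; the future part is independent of
  \<open>G\<close>, which splits off as a probability.\<close>

lemma indicator_compensated_covariance:
  assumes E: "E \<inter> E' = {}" and G: "G \<in> sets (noise_algebra E)"
    and A: "A \<in> sets \<Lambda>" "emeasure \<Lambda> A < \<infinity>" and B: "B \<in> sets \<Lambda>" "emeasure \<Lambda> B < \<infinity>" "B \<subseteq> E'" and AE': "A \<subseteq> E \<union> E'" "A \<inter> E \<in> sets \<Lambda>"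
  shows "integrable M (\<lambda>\<omega>. indicator G \<omega> * (compensated A \<omega> * compensated B \<omega>))"
    and "expectation (\<lambda>\<omega>. indicator G \<omega> * (compensated A \<omega> * compensated B \<omega>)) = prob G * measure \<Lambda> (A \<inter> B)"
proof -
  let ?U = "A \<inter> E" and ?V = "A - E"
  have V': "?V = A - ?U" by auto
  have U: "?U \<in> sets \<Lambda>" "emeasure \<Lambda> ?U < \<infinity>" "?U \<subseteq> E" and V: "?V \<in> sets \<Lambda>" "emeasure \<Lambda> ?V < \<infinity>" "?V \<subseteq> E'"
    using AE' A emeasure_finite_mono[OF A(2,1)] by (auto simp: V' simp del: Diff_Int2)
  have Gev: "G \<in> events" using G noise_algebra_events by auto
  have e: "AE \<omega> in M. compensated A \<omega> = compensated ?U \<omega> + compensated ?V \<omega>"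
  proof -
    have "?U \<union> ?V = A" "?U \<inter> ?V = {}" by auto
    then show ?thesis using compensated_Un[OF U(1,2) V(1,2)] by simp
  qed
  note m [measurable] = compensated_rv[OF A(1)] compensated_rv[OF B(1)] compensated_rv[OF U(1)] compensated_rv[OF V(1)]
  have iG: "indicator G \<in> borel_measurable (noise_algebra E)" using G by simp
  have 1: "integrable M (\<lambda>\<omega>. (indicator G \<omega> * compensated ?U \<omega>) * compensated B \<omega>)"
    "expectation (\<lambda>\<omega>. (indicator G \<omega> * compensated ?U \<omega>) * compensated B \<omega>) = expectation (\<lambda>\<omega>. indicator G \<omega> * compensated ?U \<omega>) * expectation (compensated B)"
  proof -
    have "(\<lambda>\<omega>. indicator G \<omega> * compensated ?U \<omega>) \<in> borel_measurable (noise_algebra E)"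
      using iG compensated_measurable[OF U(1,3)] by (rule borel_measurable_times)
    moreover have "integrable M (\<lambda>\<omega>. indicator G \<omega> * compensated ?U \<omega>)"
      using integrable_mult_indicator[OF Gev compensated_moments(1)[OF U(1,2)]] by simp
    ultimately show "integrable M (\<lambda>\<omega>. (indicator G \<omega> * compensated ?U \<omega>) * compensated B \<omega>)"
    "expectation (\<lambda>\<omega>. (indicator G \<omega> * compensated ?U \<omega>) * compensated B \<omega>) = expectation (\<lambda>\<omega>. indicator G \<omega> * compensated ?U \<omega>) * expectation (compensated B)"
      using noise_algebra_expectation_mult[OF E _ _ compensated_measurable[OF B(1,3)] compensated_moments(1)[OF B(1,2)]] by blast+
  qed
  have 2: "integrable M (\<lambda>\<omega>. indicator G \<omega> * (compensated ?V \<omega> * compensated B \<omega>))"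
    "expectation (\<lambda>\<omega>. indicator G \<omega> * (compensated ?V \<omega> * compensated B \<omega>)) = expectation (indicator G) * expectation (\<lambda>\<omega>. compensated ?V \<omega> * compensated B \<omega>)"
  proof -
    have "(\<lambda>\<omega>. compensated ?V \<omega> * compensated B \<omega>) \<in> borel_measurable (noise_algebra E')"
      using compensated_measurable[OF V(1,3)] compensated_measurable[OF B(1,3)] by (rule borel_measurable_times)
    moreover have "integrable M (indicator G :: _ \<Rightarrow> real)" using Gev by (simp add: emeasure_eq_measure)
    ultimately show "integrable M (\<lambda>\<omega>. indicator G \<omega> * (compensated ?V \<omega> * compensated B \<omega>))"
    "expectation (\<lambda>\<omega>. indicator G \<omega> * (compensated ?V \<omega> * compensated B \<omega>)) = expectation (indicator G) * expectation (\<lambda>\<omega>. compensated ?V \<omega> * compensated B \<omega>)"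
      using noise_algebra_expectation_mult[OF E iG _ _ compensated_covariance(1)[OF V(1,2) B(1,2)]] by blast+
  qed
  have e2: "AE \<omega> in M. indicator G \<omega> * (compensated A \<omega> * compensated B \<omega>) =
      (indicator G \<omega> * compensated ?U \<omega>) * compensated B \<omega> + indicator G \<omega> * (compensated ?V \<omega> * compensated B \<omega>)"
    using e by eventually_elim (simp add: algebra_simps)
  have AB: "?V \<inter> B = A \<inter> B" using B(3) E by auto
  have [measurable]: "(indicator G :: _ \<Rightarrow> real) \<in> borel_measurable M" using Gev by simp
  show "integrable M (\<lambda>\<omega>. indicator G \<omega> * (compensated A \<omega> * compensated B \<omega>))"
    by (subst integrable_cong_AE[OF _ _ e2]) (use 1 2 in auto)
  show "expectation (\<lambda>\<omega>. indicator G \<omega> * (compensated A \<omega> * compensated B \<omega>)) = prob G * measure \<Lambda> (A \<inter> B)"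
    using 1 2 compensated_moments(2)[OF B(1,2)] compensated_covariance(2)[OF V(1,2) B(1,2)] Gev
    by (subst integral_cong_AE[OF _ _ e2]) (auto simp: AB)
qed

end

section \<open>The isometry for simple integrands\<close>

lemma sum_list_square_integral:
  fixes f :: "'b \<Rightarrow> 'c \<Rightarrow> real"
  assumes "\<And>x y. x \<in> set S \<Longrightarrow> y \<in> set S \<Longrightarrow> integrable M (\<lambda>\<omega>. f x \<omega> * f y \<omega>)"
  shows "integrable M (\<lambda>\<omega>. (\<Sum>x\<leftarrow>S. f x \<omega>)\<^sup>2)"
    and "(\<integral>\<omega>. (\<Sum>x\<leftarrow>S. f x \<omega>)\<^sup>2 \<partial>M) = (\<Sum>x\<leftarrow>S. \<Sum>y\<leftarrow>S. \<integral>\<omega>. f x \<omega> * f y \<omega> \<partial>M)"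
proof -
  have sum_list_int: "integrable M (\<lambda>\<omega>. \<Sum>x\<leftarrow>L. h x \<omega>) \<and> (\<integral>\<omega>. (\<Sum>x\<leftarrow>L. h x \<omega>) \<partial>M) = (\<Sum>x\<leftarrow>L. \<integral>\<omega>. h x \<omega> \<partial>M)"
    if "\<And>x. x \<in> set L \<Longrightarrow> integrable M (h x)" for L and h :: "'b \<Rightarrow> 'c \<Rightarrow> real"
    using that by (induction L) auto
  have sq: "(\<Sum>x\<leftarrow>S. f x \<omega>)\<^sup>2 = (\<Sum>x\<leftarrow>S. \<Sum>y\<leftarrow>S. f x \<omega> * f y \<omega>)" for \<omega>
    by (simp only: power2_eq_square sum_list_mult_const sum_list_const_mult)
  have inner: "integrable M (\<lambda>\<omega>. \<Sum>y\<leftarrow>S. f x \<omega> * f y \<omega>) \<and> (\<integral>\<omega>. (\<Sum>y\<leftarrow>S. f x \<omega> * f y \<omega>) \<partial>M) = (\<Sum>y\<leftarrow>S. \<integral>\<omega>. f x \<omega> * f y \<omega> \<partial>M)"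
    if "x \<in> set S" for x
    using assms that by (intro sum_list_int) auto
  have outer: "integrable M (\<lambda>\<omega>. \<Sum>x\<leftarrow>S. \<Sum>y\<leftarrow>S. f x \<omega> * f y \<omega>) \<and>
    (\<integral>\<omega>. (\<Sum>x\<leftarrow>S. \<Sum>y\<leftarrow>S. f x \<omega> * f y \<omega>) \<partial>M) = (\<Sum>x\<leftarrow>S. \<integral>\<omega>. (\<Sum>y\<leftarrow>S. f x \<omega> * f y \<omega>) \<partial>M)"
    by (rule sum_list_int) (use inner in auto)
  show "integrable M (\<lambda>\<omega>. (\<Sum>x\<leftarrow>S. f x \<omega>)\<^sup>2)" unfolding sq using outer by blast
  have "(\<integral>\<omega>. (\<Sum>x\<leftarrow>S. f x \<omega>)\<^sup>2 \<partial>M) = (\<Sum>x\<leftarrow>S. \<integral>\<omega>. (\<Sum>y\<leftarrow>S. f x \<omega> * f y \<omega>) \<partial>M)"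
    unfolding sq using outer by blast
  also have "\<dots> = (\<Sum>x\<leftarrow>S. \<Sum>y\<leftarrow>S. \<integral>\<omega>. f x \<omega> * f y \<omega> \<partial>M)"
    using inner by (intro arg_cong[where f=sum_list] map_cong refl) auto
  finally show "(\<integral>\<omega>. (\<Sum>x\<leftarrow>S. f x \<omega>)\<^sup>2 \<partial>M) = (\<Sum>x\<leftarrow>S. \<Sum>y\<leftarrow>S. \<integral>\<omega>. f x \<omega> * f y \<omega> \<partial>M)" .
qed

section \<open>The noise with intensity dt dx \<mu>(dh): finite regions, filtration and the terms of
  simple integrands\<close>

locale levy_noise = prob_space M for M :: "'w measure" +
  fixes \<mu> :: "'a::euclidean_space measure" and N :: "'w \<Rightarrow> (real \<times> 'a \<times> 'a) measure"
  assumes levy: "levy_measure \<mu>" and noise: "poisson_random_measure M (intensity \<mu>) N"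
begin

sublocale poisson_rm M "intensity \<mu>" N
  by unfold_locales (rule noise)

sublocale marks: sigma_finite_measure \<mu>
  using levy by (simp add: levy_measure_def)

lemma sets_mu [measurable_cong]: "sets \<mu> = sets borel"
  using levy by (simp add: levy_measure_def)

lemma space_mu [simp]: "space \<mu> = UNIV"
  using sets_eq_imp_space_eq[OF sets_mu] by simp

lemma sets_space_mark [measurable_cong]: "sets (space_mark_measure \<mu>) = sets (borel \<Otimes>\<^sub>M borel)"
  unfolding space_mark_measure_def by (intro sets_pair_measure_cong sets_mu) simp

lemma space_space_mark [simp]: "space (space_mark_measure \<mu>) = UNIV"
  by (simp add: space_mark_measure_def space_pair_measure)

lemma sigma_finite_space_mark: "sigma_finite_measure (space_mark_measure \<mu>)"
  unfolding space_mark_measure_def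
  by (intro sigma_finite_pair_measure lborel.sigma_finite_measure_axioms marks.sigma_finite_measure_axioms)

sublocale space_mark: sigma_finite_measure "space_mark_measure \<mu>"
  by (rule sigma_finite_space_mark)

lemma sets_intensity [measurable_cong]:
  "sets (intensity \<mu>) = sets (restrict_space borel {0..} \<Otimes>\<^sub>M (borel \<Otimes>\<^sub>M borel))"
  unfolding intensity_def by (intro sets_pair_measure_cong sets_space_mark sets_restrict_space_cong) simp

lemma space_intensity [simp]: "space (intensity \<mu>) = {0..} \<times> UNIV"
  by (simp add: intensity_def space_pair_measure space_restrict_space)

lemma emeasure_intensity_Times:
  assumes "T \<in> sets borel" "T \<subseteq> {0..}" "D \<in> sets (space_mark_measure \<mu>)"
  shows "T \<times> D \<in> sets (intensity \<mu>)" "emeasure (intensity \<mu>) (T \<times> D) = emeasure lborel T * emeasure (space_mark_measure \<mu>) D"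
proof -
  have T: "T \<in> sets (restrict_space lborel {0..})" using assms by (simp add: sets_restrict_space_iff)
  show "T \<times> D \<in> sets (intensity \<mu>)" unfolding intensity_def using T assms(3) by (rule pair_measureI)
  show "emeasure (intensity \<mu>) (T \<times> D) = emeasure lborel T * emeasure (space_mark_measure \<mu>) D"
    unfolding intensity_def using assms
    by (subst space_mark.emeasure_pair_measure_Times[OF T assms(3)]) (simp add: emeasure_restrict_space)
qed

lemma region_sets: "0 \<le> s \<Longrightarrow> D \<in> sets (space_mark_measure \<mu>) \<Longrightarrow> {s<..t} \<times> D \<in> sets (intensity \<mu>)"
  by (rule emeasure_intensity_Times) auto

lemma region_finite:
  "0 \<le> s \<Longrightarrow> D \<in> sets (space_mark_measure \<mu>) \<Longrightarrow> emeasure (space_mark_measure \<mu>) D < \<infinity> \<Longrightarrow>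
    emeasure (intensity \<mu>) ({s<..t} \<times> D) < \<infinity>"
  by (subst emeasure_intensity_Times(2), auto, cases "s \<le> t", auto simp: ennreal_mult_less_top)

lemma filtration_eq: "noise_filtration M \<mu> N t = noise_algebra ({0..t} \<times> UNIV)"
  by (simp add: noise_filtration_def noise_algebra_def noise_gen_def)

lemma filtration_mono: "s \<le> t \<Longrightarrow> sets (noise_filtration M \<mu> N s) \<subseteq> sets (noise_filtration M \<mu> N t)"
  unfolding filtration_eq by (rule noise_algebra_mono) auto

lemma filtration_events: "F \<in> sets (noise_filtration M \<mu> N s) \<Longrightarrow> F \<in> events"
  unfolding filtration_eq using noise_algebra_events by auto

definition valid_term :: "real \<times> 'w set \<times> real \<times> real \<times> ('a \<times> 'a) set \<Rightarrow> bool" where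
  "valid_term = (\<lambda>(c, F, s, t, D). 0 \<le> s \<and> s \<le> t \<and> F \<in> sets (noise_filtration M \<mu> N s) \<and>
        D \<in> sets (space_mark_measure \<mu>) \<and> emeasure (space_mark_measure \<mu>) D < \<infinity>)"

definition term_int :: "real \<times> 'w set \<times> real \<times> real \<times> ('a \<times> 'a) set \<Rightarrow> 'w \<Rightarrow> real" where
  "term_int = (\<lambda>(c, F, s, t, D) \<omega>. c * indicator F \<omega> * compensated ({s<..t} \<times> D) \<omega>)"

definition term_val :: "real \<times> 'w set \<times> real \<times> real \<times> ('a \<times> 'a) set \<Rightarrow> (real \<times> 'w) \<times> 'a \<times> 'a \<Rightarrow> real" where
  "term_val = (\<lambda>(c, F, s, t, D) z. c * indicator (({s<..t} \<times> F) \<times> D) z)"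

lemma simple_predictable_iff: "simple_predictable M \<mu> N S \<longleftrightarrow> (\<forall>x\<in>set S. valid_term x)"
  by (simp add: simple_predictable_def valid_term_def)

lemma simple_integral_eq: "simple_integral \<mu> N S \<omega> = (\<Sum>x\<leftarrow>S. term_int x \<omega>)"
  by (simp add: simple_integral_def term_int_def compensated_def split_def)

definition simple_val :: "('w, 'a) simple_integrand \<Rightarrow> (real \<times> 'w) \<times> 'a \<times> 'a \<Rightarrow> real" where
  "simple_val S = (\<lambda>((r, \<omega>), (y, h)). simple_value S r y h \<omega>)"

lemma simple_val_eq: "simple_val S z = (\<Sum>x\<leftarrow>S. term_val x z)"
proof -
  obtain r \<omega> y h where z: "z = ((r, \<omega>), (y, h))" by (metis surj_pair)
  show ?thesis
    unfolding simple_val_def simple_value_def term_val_def split_def z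
    by (intro arg_cong[where f=sum_list] map_cong refl) (auto simp: indicator_def)
qed

text \<open>The common value of the two inner products that the isometry compares, that of the
  integrals under \<open>M\<close> and that of the integrands under
  \<open>pred_measure\<close>.\<close>

definition covar :: "real \<times> 'w set \<times> real \<times> real \<times> ('a \<times> 'a) set \<Rightarrow> real \<times> 'w set \<times> real \<times> real \<times> ('a \<times> 'a) set \<Rightarrow> real" where
  "covar = (\<lambda>(c, F, s, t, D) (c', F', s', t', D'). c * c' * (prob (F \<inter> F') * measure (intensity \<mu>) (({s<..t} \<times> D) \<inter> ({s'<..t'} \<times> D'))))"

text \<open>Time is cut at the later starting point \<open>s'\<close>: both events are known by
  then, and the region of the second term lies entirely after it.\<close>

lemma term_int_covar_aux:
  assumes x: "valid_term (c, F, s, t, D)" and y: "valid_term (c', F', s', t', D')" and "s \<le> s'"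
  shows "integrable M (\<lambda>\<omega>. term_int (c, F, s, t, D) \<omega> * term_int (c', F', s', t', D') \<omega>)"
    and "expectation (\<lambda>\<omega>. term_int (c, F, s, t, D) \<omega> * term_int (c', F', s', t', D') \<omega>) = covar (c, F, s, t, D) (c', F', s', t', D')"
proof -
  let ?A = "{s<..t} \<times> D" and ?B = "{s'<..t'} \<times> D'" and ?E = "{0..s'} \<times> (UNIV :: ('a \<times> 'a) set)" and ?E' = "{s'<..} \<times> (UNIV :: ('a \<times> 'a) set)"
  have v: "0 \<le> s" "0 \<le> s'" "F \<in> sets (noise_filtration M \<mu> N s)" "F' \<in> sets (noise_filtration M \<mu> N s')"
     "D \<in> sets (space_mark_measure \<mu>)" "emeasure (space_mark_measure \<mu>) D < \<infinity>"
     "D' \<in> sets (space_mark_measure \<mu>)" "emeasure (space_mark_measure \<mu>) D' < \<infinity>"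
    using x y by (auto simp: valid_term_def)
  have G: "F \<inter> F' \<in> sets (noise_algebra ?E)"
    using v(3,4) filtration_mono[OF \<open>s \<le> s'\<close>] unfolding filtration_eq by auto
  have d: "?E \<inter> ?E' = {}" by auto
  have AE: "?A \<inter> ?E = {s<..min t s'} \<times> D" using v(1) by auto
  have sub: "?A \<subseteq> ?E \<union> ?E'" "?B \<subseteq> ?E'" using v(1) by auto
  have AEs: "?A \<inter> ?E \<in> sets (intensity \<mu>)" unfolding AE by (rule region_sets) fact+
  note C = indicator_compensated_covariance[OF d G region_sets[OF v(1,5)] region_finite[OF v(1,5,6)]
      region_sets[OF v(2,7)] region_finite[OF v(2,7,8)] sub(2) sub(1) AEs]
  have eq: "term_int (c, F, s, t, D) \<omega> * term_int (c', F', s', t', D') \<omega> = c * c' * (indicator (F \<inter> F') \<omega> * (compensated ?A \<omega> * compensated ?B \<omega>))" for \<omega>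
    by (simp add: term_int_def indicator_inter_arith)
  show "integrable M (\<lambda>\<omega>. term_int (c, F, s, t, D) \<omega> * term_int (c', F', s', t', D') \<omega>)"
    unfolding eq using C(1) by simp
  show "expectation (\<lambda>\<omega>. term_int (c, F, s, t, D) \<omega> * term_int (c', F', s', t', D') \<omega>) = covar (c, F, s, t, D) (c', F', s', t', D')"
    unfolding eq integral_mult_right_zero C(2) by (simp add: covar_def)
qed

lemma term_int_covar:
  assumes "valid_term x" "valid_term y"
  shows "integrable M (\<lambda>\<omega>. term_int x \<omega> * term_int y \<omega>)"
    and "expectation (\<lambda>\<omega>. term_int x \<omega> * term_int y \<omega>) = covar x y"
proof -
  obtain c F s t D where x: "x = (c, F, s, t, D)" by (cases x)
  obtain c' F' s' t' D' where y: "y = (c', F', s', t', D')" by (cases y)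
  have sym: "covar y x = covar x y" by (simp add: covar_def x y Int_commute mult.commute)
  have "integrable M (\<lambda>\<omega>. term_int x \<omega> * term_int y \<omega>) \<and> expectation (\<lambda>\<omega>. term_int x \<omega> * term_int y \<omega>) = covar x y"
  proof (cases "s \<le> s'")
    case True
    then show ?thesis using term_int_covar_aux assms unfolding x y by blast
  next
    case False
    then have "s' \<le> s" by simp
    with term_int_covar_aux[of c' F' s' t' D' c F s t D] assms
    have "integrable M (\<lambda>\<omega>. term_int y \<omega> * term_int x \<omega>)" "expectation (\<lambda>\<omega>. term_int y \<omega> * term_int x \<omega>) = covar y x"
      unfolding x y by blast+
    then show ?thesis unfolding sym by (simp add: mult.commute)
  qed
  then show "integrable M (\<lambda>\<omega>. term_int x \<omega> * term_int y \<omega>)" "expectation (\<lambda>\<omega>. term_int x \<omega> * term_int y \<omega>) = covar x y"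
    by auto
qed

lemma term_int_measurable: "valid_term x \<Longrightarrow> term_int x \<in> borel_measurable M"
proof (cases x)
  fix c F s t D assume x: "x = (c, F, s, t, D)" and "valid_term x"
  then have "F \<in> events" "{s<..t} \<times> D \<in> sets (intensity \<mu>)"
    by (auto simp: valid_term_def intro: filtration_events region_sets)
  then have [measurable]: "F \<in> events" "compensated ({s<..t} \<times> D) \<in> borel_measurable M"
    by (auto intro: compensated_rv)
  show ?thesis unfolding x term_int_def by simp
qed

lemma simple_integral_measurable:
  assumes "simple_predictable M \<mu> N S"
  shows "simple_integral \<mu> N S \<in> borel_measurable M"
proof -
  have "(\<lambda>\<omega>. \<Sum>x\<leftarrow>S. term_int x \<omega>) \<in> borel_measurable M"
    using assms unfolding simple_predictable_iff by (induction S) (auto intro!: borel_measurable_add term_int_measurable)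
  then show ?thesis by (simp add: simple_integral_eq[abs_def])
qed

section \<open>The predictable sigma-algebra with marks, and the measure under which integrands are
  measured\<close>

abbreviation "predictable_mark_algebra \<equiv> predictable_algebra M \<mu> N \<Otimes>\<^sub>M ((borel :: 'a measure) \<Otimes>\<^sub>M (borel :: 'a measure))"

definition predictable_gen :: "(real \<times> 'w) set set" where
  "predictable_gen = ({{0} \<times> F | F. F \<in> sets (noise_filtration M \<mu> N 0)} \<union>
      {{s<..t} \<times> F | s t F. 0 \<le> s \<and> s \<le> t \<and> F \<in> sets (noise_filtration M \<mu> N s)})"

lemma predictable_gen_Pow: "predictable_gen \<subseteq> Pow ({0..} \<times> space M)"
  unfolding predictable_gen_def using filtration_events sets.sets_into_space by fastforce

lemma space_predictable [simp]: "space (predictable_algebra M \<mu> N) = {0..} \<times> space M"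
  unfolding predictable_algebra_def predictable_gen_def[symmetric]
  by (rule space_measure_of[OF predictable_gen_Pow])

lemma sets_predictable: "sets (predictable_algebra M \<mu> N) = sigma_sets ({0..} \<times> space M) predictable_gen"
  unfolding predictable_algebra_def predictable_gen_def[symmetric]
  by (rule sets_measure_of[OF predictable_gen_Pow])

lemma rectangle_predictable:
  "0 \<le> s \<Longrightarrow> s \<le> t \<Longrightarrow> F \<in> sets (noise_filtration M \<mu> N s) \<Longrightarrow> {s<..t} \<times> F \<in> sets (predictable_algebra M \<mu> N)"
  unfolding sets_predictable by (rule sigma_sets.Basic) (auto simp: predictable_gen_def)

text \<open>The predictable sigma-algebra is coarser than the product of the Borel sets of time with
  the events. This is what permits pushing the product measure forward to it.\<close>

lemma measurable_id_predictable:
  "(\<lambda>z. z) \<in> measurable (restrict_space borel {0..} \<Otimes>\<^sub>M M) (predictable_algebra M \<mu> N)"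
  unfolding predictable_algebra_def predictable_gen_def[symmetric]
proof (rule measurable_sigma_sets[OF _ predictable_gen_Pow])
  show "sets (sigma ({0..} \<times> space M) predictable_gen) = sigma_sets ({0..} \<times> space M) predictable_gen"
    by (rule sets_measure_of[OF predictable_gen_Pow])
  show "(\<lambda>z. z) \<in> space (restrict_space borel {0..} \<Otimes>\<^sub>M M) \<rightarrow> {0..} \<times> space M"
    by (auto simp: space_pair_measure space_restrict_space)
  fix A assume A: "A \<in> predictable_gen"
  have sp: "space (restrict_space borel {0..} \<Otimes>\<^sub>M M) = {0::real..} \<times> space M"
    by (simp add: space_pair_measure space_restrict_space)
  have "A \<in> sets (restrict_space borel {0..} \<Otimes>\<^sub>M M)"
  proof -
    have "T \<times> F \<in> sets (restrict_space borel {0..} \<Otimes>\<^sub>M M)" if "T \<in> sets borel" "T \<subseteq> {0::real..}" "F \<in> events" for T F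
      using that by (intro pair_measureI) (auto simp: sets_restrict_space_iff)
    note rect = this
    from A show ?thesis unfolding predictable_gen_def
    proof (elim UnE CollectE exE conjE)
      fix F assume "A = {0} \<times> F" "F \<in> sets (noise_filtration M \<mu> N 0)"
      then show ?thesis using rect[of "{0}" F] filtration_events by auto
    next
      fix s t F assume "A = {s<..t} \<times> F" "0 \<le> s" "F \<in> sets (noise_filtration M \<mu> N s)"
      moreover from \<open>0 \<le> s\<close> have "{s<..t} \<subseteq> {0..}" by auto
      ultimately show ?thesis using rect[OF _ _ filtration_events] by simp
    qed
  qed
  then show "(\<lambda>z. z) -` A \<inter> space (restrict_space borel {0..} \<Otimes>\<^sub>M M) \<in> sets (restrict_space borel {0..} \<Otimes>\<^sub>M M)"
    by (simp add: sets.Int_space_eq2)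
qed

text \<open>Predictability ties time to the sample point, whereas the intensity ties it to space and
  mark; this map translates between the two groupings.\<close>

definition rearrange :: "(real \<times> 'a \<times> 'a) \<times> 'w \<Rightarrow> (real \<times> 'w) \<times> 'a \<times> 'a" where
  "rearrange = (\<lambda>((s, y, h), \<omega>). ((s, \<omega>), (y, h)))"

lemma rearrange_measurable [measurable]:
  "rearrange \<in> measurable (intensity \<mu> \<Otimes>\<^sub>M M) predictable_mark_algebra"
proof -
  have "(\<lambda>z. (fst (fst z), snd z)) \<in> measurable (intensity \<mu> \<Otimes>\<^sub>M M) (restrict_space borel {0..} \<Otimes>\<^sub>M M)"
    by measurable
  from measurable_compose[OF this measurable_id_predictable]
  have [measurable]: "(\<lambda>z. (fst (fst z), snd z)) \<in> measurable (intensity \<mu> \<Otimes>\<^sub>M M) (predictable_algebra M \<mu> N)" .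
  have "(\<lambda>z. ((fst (fst z), snd z), snd (fst z))) \<in> measurable (intensity \<mu> \<Otimes>\<^sub>M M) predictable_mark_algebra"
    by measurable
  moreover have "rearrange = (\<lambda>z. ((fst (fst z), snd z), snd (fst z)))"
    by (auto simp: rearrange_def fun_eq_iff)
  ultimately show ?thesis by simp
qed

text \<open>Intensity times probability, seen on the predictable sets only. The square-integrable
  predictable integrands thereby become an ordinary L^2 space.\<close>

definition pred_measure :: "((real \<times> 'w) \<times> 'a \<times> 'a) measure" where
  "pred_measure = distr (intensity \<mu> \<Otimes>\<^sub>M M) predictable_mark_algebra rearrange"

lemma sets_pred_measure [simp, measurable_cong]: "sets pred_measure = sets predictable_mark_algebra"
  and space_pred_measure [simp]: "space pred_measure = ({0..} \<times> space M) \<times> UNIV"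
  by (auto simp: pred_measure_def space_pair_measure)

lemma emeasure_pred_measure_Times:
  assumes T: "T \<in> sets borel" "T \<subseteq> {0..}" and F: "F \<in> events" and D: "D \<in> sets (space_mark_measure \<mu>)"
    and W: "(T \<times> F) \<times> D \<in> sets predictable_mark_algebra"
  shows "emeasure pred_measure ((T \<times> F) \<times> D) = emeasure (intensity \<mu>) (T \<times> D) * emeasure M F"
proof -
  have "emeasure pred_measure ((T \<times> F) \<times> D) = emeasure (intensity \<mu> \<Otimes>\<^sub>M M) (rearrange -` ((T \<times> F) \<times> D) \<inter> space (intensity \<mu> \<Otimes>\<^sub>M M))"
    unfolding pred_measure_def by (rule emeasure_distr[OF rearrange_measurable W])
  also have "rearrange -` ((T \<times> F) \<times> D) \<inter> space (intensity \<mu> \<Otimes>\<^sub>M M) = (T \<times> D) \<times> F"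
    using T(2) sets.sets_into_space[OF F] by (auto simp: rearrange_def space_pair_measure)
  also have "emeasure (intensity \<mu> \<Otimes>\<^sub>M M) ((T \<times> D) \<times> F) = emeasure (intensity \<mu>) (T \<times> D) * emeasure M F"
    by (rule emeasure_pair_measure_Times[OF emeasure_intensity_Times(1)[OF T D] F])
  finally show ?thesis .
qed

lemma term_val_covar:
  assumes "valid_term x" "valid_term y"
  shows "integrable pred_measure (\<lambda>z. term_val x z * term_val y z)"
    and "(\<integral>z. term_val x z * term_val y z \<partial>pred_measure) = covar x y"
proof -
  obtain c F s t D where x: "x = (c, F, s, t, D)" by (cases x)
  obtain c' F' s' t' D' where y: "y = (c', F', s', t', D')" by (cases y)
  have v: "0 \<le> s" "s \<le> t" "0 \<le> s'" "s' \<le> t'" "F \<in> sets (noise_filtration M \<mu> N s)" "F' \<in> sets (noise_filtration M \<mu> N s')"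
     "D \<in> sets (space_mark_measure \<mu>)" "emeasure (space_mark_measure \<mu>) D < \<infinity>"
     "D' \<in> sets (space_mark_measure \<mu>)"
    using assms by (auto simp: valid_term_def x y)
  let ?W = "(({s<..t} \<inter> {s'<..t'}) \<times> (F \<inter> F')) \<times> (D \<inter> D')"
  have Weq: "?W = (({s<..t} \<times> F) \<times> D) \<inter> (({s'<..t'} \<times> F') \<times> D')" by auto
  have W: "?W \<in> sets predictable_mark_algebra"
    unfolding Weq using v by (intro sets.Int pair_measureI rectangle_predictable) (auto simp: sets_space_mark)
  have e: "emeasure pred_measure ?W = emeasure (intensity \<mu>) (({s<..t} \<times> D) \<inter> ({s'<..t'} \<times> D')) * emeasure M (F \<inter> F')"
    using v W filtration_events by (subst emeasure_pred_measure_Times) (auto simp: Times_Int_Times)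
  have fin: "emeasure (intensity \<mu>) (({s<..t} \<times> D) \<inter> ({s'<..t'} \<times> D')) < \<infinity>"
    by (rule emeasure_finite_mono[OF region_finite[OF v(1,7,8)] region_sets[OF v(1,7)]]) auto
  have eq: "term_val x z * term_val y z = c * c' * indicator ?W z" for z
    by (auto simp: term_val_def x y indicator_def)
  have fW: "emeasure pred_measure ?W < \<infinity>" unfolding e using fin by (simp add: emeasure_eq_measure ennreal_mult_less_top)
  show "integrable pred_measure (\<lambda>z. term_val x z * term_val y z)"
    unfolding eq using W fW by simp
  have "measure pred_measure ?W = prob (F \<inter> F') * measure (intensity \<mu>) (({s<..t} \<times> D) \<inter> ({s'<..t'} \<times> D'))"
    unfolding measure_def e by (simp add: enn2real_mult mult.commute)
  then show "(\<integral>z. term_val x z * term_val y z \<partial>pred_measure) = covar x y"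
  proof -
    have W': "?W \<inter> space pred_measure = ?W" by (rule sets.Int_space_eq2) (simp only: sets_pred_measure W)
    assume m: "measure pred_measure ?W = prob (F \<inter> F') * measure (intensity \<mu>) (({s<..t} \<times> D) \<inter> ({s'<..t'} \<times> D'))"
    show ?thesis
      unfolding eq integral_mult_right_zero Bochner_Integration.integral_indicator W' m by (simp add: covar_def x y)
  qed
qed

text \<open>Both squares expand into the same double sum of \<open>covar\<close>, so overlapping
  terms are treated without first refining them to disjoint rectangles.\<close>

theorem simple_integral_isometry:
  assumes "simple_predictable M \<mu> N S"
  shows "(\<integral>\<^sup>+\<omega>. ennreal ((simple_integral \<mu> N S \<omega>)\<^sup>2) \<partial>M) = (\<integral>\<^sup>+z. ennreal ((simple_val S z)\<^sup>2) \<partial>pred_measure)"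
proof -
  have v: "valid_term x" if "x \<in> set S" for x using assms that by (simp add: simple_predictable_iff)
  have iI: "integrable M (\<lambda>\<omega>. term_int x \<omega> * term_int y \<omega>)"
    and iV: "integrable pred_measure (\<lambda>z. term_val x z * term_val y z)" if "x \<in> set S" "y \<in> set S" for x y
    using term_int_covar(1)[OF v v, OF that] term_val_covar(1)[OF v v, OF that] by auto
  note I = sum_list_square_integral[of S M term_int, OF iI] and V = sum_list_square_integral[of S pred_measure term_val, OF iV]
  have "(\<integral>\<^sup>+\<omega>. ennreal ((simple_integral \<mu> N S \<omega>)\<^sup>2) \<partial>M) = ennreal (expectation (\<lambda>\<omega>. (\<Sum>x\<leftarrow>S. term_int x \<omega>)\<^sup>2))"
    unfolding simple_integral_eq by (rule nn_integral_eq_integral[OF I(1)]) auto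
  also have "expectation (\<lambda>\<omega>. (\<Sum>x\<leftarrow>S. term_int x \<omega>)\<^sup>2) = (\<integral>z. (\<Sum>x\<leftarrow>S. term_val x z)\<^sup>2 \<partial>pred_measure)"
    by (subst I(2), assumption, assumption, subst V(2), assumption, assumption, intro arg_cong[where f=sum_list] map_cong refl)
       (simp only: term_int_covar(2) term_val_covar(2) v)
  also have "ennreal \<dots> = (\<integral>\<^sup>+z. ennreal ((simple_val S z)\<^sup>2) \<partial>pred_measure)"
    unfolding simple_val_eq by (rule nn_integral_eq_integral[OF V(1), symmetric]) auto
  finally show ?thesis .
qed

end

section \<open>Density of the simple integrands\<close>

text \<open>Young's inequality, from \<open>0 \<le> (\<delta> * a - b)\<^sup>2 / \<delta>\<close>.
  With \<open>\<delta> = 1\<close> it serves as a triangle inequality for squared distances; letting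
  \<open>\<delta>\<close> tend to 0 keeps the constant 1 in the moment bound of the stochastic
  integral.\<close>

lemma nn_integral_sq_add_le:
  fixes f g :: "'b \<Rightarrow> real"
  assumes [measurable]: "f \<in> borel_measurable M" "g \<in> borel_measurable M" and \<delta>: "0 < \<delta>"
  shows "(\<integral>\<^sup>+x. ennreal ((f x + g x)\<^sup>2) \<partial>M) \<le>
    ennreal (1 + \<delta>) * (\<integral>\<^sup>+x. ennreal ((f x)\<^sup>2) \<partial>M) + ennreal (1 + 1 / \<delta>) * (\<integral>\<^sup>+x. ennreal ((g x)\<^sup>2) \<partial>M)"
proof -
  have "(a + b)\<^sup>2 \<le> (1 + \<delta>) * a\<^sup>2 + (1 + 1 / \<delta>) * b\<^sup>2" for a b :: real
  proof -
    have "0 \<le> (\<delta> * a - b)\<^sup>2 / \<delta>" using \<delta> by simp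
    also have "(\<delta> * a - b)\<^sup>2 / \<delta> = \<delta> * a\<^sup>2 - 2 * a * b + b\<^sup>2 / \<delta>"
      using \<delta> by (simp add: power2_eq_square field_simps)
    finally show ?thesis by (simp add: power2_eq_square algebra_simps)
  qed
  then have "(\<integral>\<^sup>+x. ennreal ((f x + g x)\<^sup>2) \<partial>M) \<le> (\<integral>\<^sup>+x. ennreal (1 + \<delta>) * ennreal ((f x)\<^sup>2) + ennreal (1 + 1 / \<delta>) * ennreal ((g x)\<^sup>2) \<partial>M)"
    using \<delta> by (intro nn_integral_mono) (simp add: ennreal_mult'[symmetric] ennreal_plus[symmetric] ennreal_leI del: ennreal_plus)
  also have "\<dots> = ennreal (1 + \<delta>) * (\<integral>\<^sup>+x. ennreal ((f x)\<^sup>2) \<partial>M) + ennreal (1 + 1 / \<delta>) * (\<integral>\<^sup>+x. ennreal ((g x)\<^sup>2) \<partial>M)"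
    by (simp add: nn_integral_add nn_integral_cmult)
  finally show ?thesis .
qed

context levy_noise
begin

text \<open>The squared distance, which stays within \<open>ennreal\<close> integrals; its triangle
  inequality carries factors 2.\<close>

definition L2dist :: "((real \<times> 'w) \<times> 'a \<times> 'a \<Rightarrow> real) \<Rightarrow> ((real \<times> 'w) \<times> 'a \<times> 'a \<Rightarrow> real) \<Rightarrow> ennreal" where
  "L2dist f g = (\<integral>\<^sup>+z. ennreal ((f z - g z)\<^sup>2) \<partial>pred_measure)"

definition simple_approximable :: "((real \<times> 'w) \<times> 'a \<times> 'a \<Rightarrow> real) \<Rightarrow> bool" where
  "simple_approximable f \<longleftrightarrow> f \<in> borel_measurable predictable_mark_algebra \<and>
     (\<forall>e>0. \<exists>S. simple_predictable M \<mu> N S \<and> L2dist f (simple_val S) < ennreal e)"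

lemma borel_measurable_pred_measure: "borel_measurable pred_measure = borel_measurable predictable_mark_algebra"
  by (rule measurable_cong_sets) auto

lemma term_val_measurable: "valid_term x \<Longrightarrow> term_val x \<in> borel_measurable predictable_mark_algebra"
proof (cases x)
  fix c F s t D assume x: "x = (c, F, s, t, D)" and "valid_term x"
  then have [measurable]: "({s<..t} \<times> F) \<times> D \<in> sets predictable_mark_algebra"
    by (intro pair_measureI rectangle_predictable) (auto simp: valid_term_def sets_space_mark)
  show ?thesis unfolding x term_val_def by simp
qed

lemma simple_val_measurable:
  assumes "simple_predictable M \<mu> N S"
  shows "simple_val S \<in> borel_measurable predictable_mark_algebra"
proof -
  have "(\<lambda>z. \<Sum>x\<leftarrow>S. term_val x z) \<in> borel_measurable predictable_mark_algebra"
    using assms unfolding simple_predictable_iff by (induction S) (auto intro!: borel_measurable_add term_val_measurable)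
  then show ?thesis by (simp add: simple_val_eq[abs_def])
qed

lemma L2dist_triangle:
  assumes "f \<in> borel_measurable predictable_mark_algebra" "g \<in> borel_measurable predictable_mark_algebra" "h \<in> borel_measurable predictable_mark_algebra"
  shows "L2dist f h \<le> 2 * L2dist f g + 2 * L2dist g h"
proof -
  have [measurable]: "f \<in> borel_measurable pred_measure" "g \<in> borel_measurable pred_measure" "h \<in> borel_measurable pred_measure"
    using assms by (simp_all add: borel_measurable_pred_measure)
  show ?thesis
    unfolding L2dist_def using nn_integral_sq_add_le[of "\<lambda>z. f z - g z" pred_measure "\<lambda>z. g z - h z" 1] by simp
qed

lemma simple_approximable_val:
  assumes "simple_predictable M \<mu> N S"
  shows "simple_approximable (simple_val S)"
  unfolding simple_approximable_def
proof (intro conjI allI impI exI[of _ S])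
  show "L2dist (simple_val S) (simple_val S) < ennreal e" if "0 < e" for e
    using that by (simp add: L2dist_def)
qed (use assms simple_val_measurable in auto)

lemma simple_approximable_limit:
  assumes f: "f \<in> borel_measurable predictable_mark_algebra"
    and g: "\<And>e. 0 < e \<Longrightarrow> \<exists>g. simple_approximable g \<and> L2dist f g < ennreal e"
  shows "simple_approximable f"
  unfolding simple_approximable_def
proof (intro conjI allI impI f)
  fix e :: real assume e: "0 < e"
  then obtain g where g: "simple_approximable g" "L2dist f g < ennreal (e / 4)" using g[of "e / 4"] by auto
  then obtain S where S: "simple_predictable M \<mu> N S" "L2dist g (simple_val S) < ennreal (e / 4)"
    using e unfolding simple_approximable_def by (meson divide_pos_pos zero_less_numeral)
  have "L2dist f (simple_val S) \<le> 2 * L2dist f g + 2 * L2dist g (simple_val S)"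
    using f g S simple_val_measurable by (intro L2dist_triangle) (auto simp: simple_approximable_def)
  also have "\<dots> < ennreal 2 * ennreal (e / 4) + ennreal 2 * ennreal (e / 4)"
    using g(2) S(2) by (intro add_strict_mono) (auto intro!: ennreal_mult_strict_left_mono)
  also have "\<dots> = ennreal e"
    using e by (subst (1 2) ennreal_mult'[symmetric], simp, subst ennreal_plus[symmetric]) auto
  finally show "\<exists>S. simple_predictable M \<mu> N S \<and> L2dist f (simple_val S) < ennreal e" using S by auto
qed

lemma simple_approximable_add:
  assumes f: "simple_approximable f" and g: "simple_approximable g"
  shows "simple_approximable (\<lambda>z. f z + g z)"
proof -
  have fm: "f \<in> borel_measurable predictable_mark_algebra" and gm: "g \<in> borel_measurable predictable_mark_algebra"
    using f g by (auto simp: simple_approximable_def)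
  show ?thesis
  proof (rule simple_approximable_limit)
    show "(\<lambda>z. f z + g z) \<in> borel_measurable predictable_mark_algebra" using fm gm by (rule borel_measurable_add)
    fix e :: real assume e: "0 < e"
    obtain S T where S: "simple_predictable M \<mu> N S" "L2dist f (simple_val S) < ennreal (e / 4)"
      and T: "simple_predictable M \<mu> N T" "L2dist g (simple_val T) < ennreal (e / 4)"
      using e f g unfolding simple_approximable_def by (meson divide_pos_pos zero_less_numeral)
    have [measurable]: "f \<in> borel_measurable pred_measure" "g \<in> borel_measurable pred_measure"
       "simple_val S \<in> borel_measurable pred_measure" "simple_val T \<in> borel_measurable pred_measure"
      using fm gm simple_val_measurable[OF S(1)] simple_val_measurable[OF T(1)] by (simp_all add: borel_measurable_pred_measure)
    have ST: "simple_predictable M \<mu> N (S @ T)" using S T by (auto simp: simple_predictable_iff)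
    have v: "simple_val (S @ T) z = simple_val S z + simple_val T z" for z by (simp add: simple_val_eq)
    have "L2dist (\<lambda>z. f z + g z) (simple_val (S @ T)) = (\<integral>\<^sup>+z. ennreal (((f z - simple_val S z) + (g z - simple_val T z))\<^sup>2) \<partial>pred_measure)"
      unfolding L2dist_def v by (simp add: algebra_simps)
    also have "\<dots> \<le> 2 * L2dist f (simple_val S) + 2 * L2dist g (simple_val T)"
      unfolding L2dist_def using nn_integral_sq_add_le[of "\<lambda>z. f z - simple_val S z" pred_measure "\<lambda>z. g z - simple_val T z" 1] by simp
    also have "\<dots> < ennreal 2 * ennreal (e / 4) + ennreal 2 * ennreal (e / 4)"
      using S(2) T(2) by (intro add_strict_mono) (auto intro!: ennreal_mult_strict_left_mono)
    also have "\<dots> = ennreal e"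
      using e by (subst (1 2) ennreal_mult'[symmetric], simp, subst ennreal_plus[symmetric]) auto
    finally show "\<exists>h. simple_approximable h \<and> L2dist (\<lambda>z. f z + g z) h < ennreal e"
      using simple_approximable_val[OF ST] by auto
  qed
qed

lemma simple_approximable_cmult:
  assumes f: "simple_approximable f"
  shows "simple_approximable (\<lambda>z. a * f z)"
proof -
  have fm: "f \<in> borel_measurable predictable_mark_algebra" using f by (auto simp: simple_approximable_def)
  show ?thesis
  proof (rule simple_approximable_limit)
    show "(\<lambda>z. a * f z) \<in> borel_measurable predictable_mark_algebra" using fm by simp
    fix e :: real assume e: "0 < e"
    \<comment> \<open>The summand 1 admits \<open>a = 0\<close> and makes the final inequality
      strict.\<close>
    have pos: "0 < e / (a\<^sup>2 + 1)" using e by (intro divide_pos_pos) (auto intro: add_nonneg_pos)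
    then obtain S where S: "simple_predictable M \<mu> N S" "L2dist f (simple_val S) < ennreal (e / (a\<^sup>2 + 1))"
      using f unfolding simple_approximable_def by blast
    have [measurable]: "f \<in> borel_measurable pred_measure" "simple_val S \<in> borel_measurable pred_measure"
      using fm simple_val_measurable[OF S(1)] by (simp_all add: borel_measurable_pred_measure)
    define T where "T = map (\<lambda>(c, r). (a * c, r)) S"
    have T: "simple_predictable M \<mu> N T"
      using S(1) by (auto simp: simple_predictable_iff T_def valid_term_def)
    have v: "simple_val T z = a * simple_val S z" for z
      unfolding simple_val_eq T_def by (simp add: sum_list_const_mult[symmetric] o_def split_def term_val_def mult.assoc)
    have "L2dist (\<lambda>z. a * f z) (simple_val T) = (\<integral>\<^sup>+z. ennreal (a\<^sup>2) * ennreal ((f z - simple_val S z)\<^sup>2) \<partial>pred_measure)"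
      unfolding L2dist_def v by (intro nn_integral_cong) (simp add: ennreal_mult'[symmetric] power_mult_distrib[symmetric] right_diff_distrib)
    also have "\<dots> = ennreal (a\<^sup>2) * L2dist f (simple_val S)"
      unfolding L2dist_def by (simp add: nn_integral_cmult)
    also have "\<dots> \<le> ennreal (a\<^sup>2) * ennreal (e / (a\<^sup>2 + 1))"
      using S(2) by (intro mult_left_mono) auto
    also have "\<dots> < ennreal e"
    proof -
      have p: "0 < a\<^sup>2 + 1" by (intro add_nonneg_pos) auto
      have "a\<^sup>2 * (e / (a\<^sup>2 + 1)) < e"
        unfolding times_divide_eq_right using e by (subst pos_divide_less_eq[OF p]) (simp add: algebra_simps)
      then show ?thesis using e by (simp add: ennreal_mult'[symmetric] ennreal_less_iff)
    qed
    finally show "\<exists>h. simple_approximable h \<and> L2dist (\<lambda>z. a * f z) h < ennreal e"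
      using simple_approximable_val[OF T] by auto
  qed
qed

lemma simple_approximable_zero: "simple_approximable (\<lambda>z. 0)"
proof -
  have "simple_predictable M \<mu> N []" "simple_val [] = (\<lambda>z. 0)"
    by (auto simp: simple_predictable_iff simple_val_eq fun_eq_iff)
  then show ?thesis using simple_approximable_val[of "[]"] by simp
qed

lemma simple_approximable_sum:
  "finite I \<Longrightarrow> (\<And>i. i \<in> I \<Longrightarrow> simple_approximable (f i)) \<Longrightarrow> simple_approximable (\<lambda>z. \<Sum>i\<in>I. f i z)"
  by (induction I rule: finite_induct) (auto intro: simple_approximable_zero simple_approximable_add)

lemma L2dist_indicator:
  assumes "A \<subseteq> B" "A \<in> sets predictable_mark_algebra" "B \<in> sets predictable_mark_algebra"
  shows "L2dist (indicator B) (indicator A) = emeasure pred_measure (B - A)"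
proof -
  have "L2dist (indicator B) (indicator A) = (\<integral>\<^sup>+z. indicator (B - A) z \<partial>pred_measure)"
    unfolding L2dist_def using assms(1) by (intro nn_integral_cong) (auto simp: indicator_def)
  also have "\<dots> = emeasure pred_measure (B - A)" using assms by (intro nn_integral_indicator) auto
  finally show ?thesis .
qed

section \<open>Intersection-stable generators of the predictable sets\<close>

lemma space_noise_filtration: "space M \<in> sets (noise_filtration M \<mu> N s)"
  unfolding filtration_eq using sets.top[of "noise_algebra ({0..s} \<times> UNIV)"] by simp

lemma Int_stable_predictable_gen: "Int_stable predictable_gen"
proof (rule Int_stableI)
  fix a b assume "a \<in> predictable_gen" "b \<in> predictable_gen"
  \<comment> \<open>The empty set is a generator through the degenerate interval
    \<open>{0<..0}\<close>. It is the intersection of a slice at time 0 with any later rectangle,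
    and of two rectangles whose time intervals do not meet.\<close>
  have emp: "{} \<in> predictable_gen"
  proof -
    have "{} = {0<..0::real} \<times> (space M)" by simp
    then show ?thesis unfolding predictable_gen_def using space_noise_filtration[of 0] by blast
  qed
  consider (zz) F F' where "a = {0} \<times> F" "b = {0} \<times> F'" "F \<in> sets (noise_filtration M \<mu> N 0)" "F' \<in> sets (noise_filtration M \<mu> N 0)"
    | (disj) "a \<inter> b = {}"
    | (ii) s t F s' t' F' where "a = {s<..t} \<times> F" "b = {s'<..t'} \<times> F'" "0 \<le> s" "0 \<le> s'"
       "F \<in> sets (noise_filtration M \<mu> N s)" "F' \<in> sets (noise_filtration M \<mu> N s')"
    using \<open>a \<in> predictable_gen\<close> \<open>b \<in> predictable_gen\<close> unfolding predictable_gen_def by fastforce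
  then show "a \<inter> b \<in> predictable_gen"
  proof cases
    case zz
    then have "a \<inter> b = {0} \<times> (F \<inter> F')" "F \<inter> F' \<in> sets (noise_filtration M \<mu> N 0)" by auto
    then show ?thesis unfolding predictable_gen_def by blast
  next
    case disj
    then show ?thesis using emp by simp
  next
    case ii
    have eq: "a \<inter> b = {max s s'<..min t t'} \<times> (F \<inter> F')" using ii by auto
    show ?thesis
    proof (cases "max s s' \<le> min t t'")
      case True
      have "F \<inter> F' \<in> sets (noise_filtration M \<mu> N (max s s'))"
        using ii filtration_mono[of s "max s s'"] filtration_mono[of s' "max s s'"] by auto
      then show ?thesis unfolding eq predictable_gen_def using True ii(3)
        by (intro UnI2 CollectI exI[of _ "max s s'"] exI[of _ "min t t'"] exI[of _ "F \<inter> F'"]) simp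
    next
      case False
      then have "{max s s'<..min t t'} = {}" by (intro greaterThanAtMost_empty) linarith
      then show ?thesis unfolding eq using emp by (simp only: Sigma_empty1)
    qed
  qed
qed

definition rect_gen :: "((real \<times> 'w) \<times> 'a \<times> 'a) set set" where
  "rect_gen = {a \<times> b | a b. a \<in> predictable_gen \<and> b \<in> sets ((borel :: 'a measure) \<Otimes>\<^sub>M (borel :: 'a measure))}"

lemma Int_stable_rect_gen: "Int_stable rect_gen"
proof (rule Int_stableI)
  fix x y assume "x \<in> rect_gen" "y \<in> rect_gen"
  then obtain a b a' b' where "x = a \<times> b" "y = a' \<times> b'" "a \<in> predictable_gen" "a' \<in> predictable_gen"
    "b \<in> sets (borel \<Otimes>\<^sub>M borel)" "b' \<in> sets (borel \<Otimes>\<^sub>M borel)" unfolding rect_gen_def by auto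
  then have "x \<inter> y = (a \<inter> a') \<times> (b \<inter> b')" "a \<inter> a' \<in> predictable_gen" "b \<inter> b' \<in> sets (borel \<Otimes>\<^sub>M borel)"
    using Int_stable_predictable_gen by (auto simp: Int_stable_def)
  then show "x \<inter> y \<in> rect_gen" unfolding rect_gen_def by blast
qed

lemma rect_gen_Pow: "rect_gen \<subseteq> Pow (({0..} \<times> space M) \<times> UNIV)"
  unfolding rect_gen_def using predictable_gen_Pow by auto

lemma sets_predictable_mark: "sets predictable_mark_algebra = sigma_sets (({0..} \<times> space M) \<times> UNIV) rect_gen"
proof -
  have bb: "space ((borel :: 'a measure) \<Otimes>\<^sub>M (borel :: 'a measure)) = UNIV" by (simp add: space_pair_measure)
  have "sets predictable_mark_algebra = sets (sigma (space (predictable_algebra M \<mu> N) \<times> space ((borel :: 'a measure) \<Otimes>\<^sub>M (borel :: 'a measure)))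
     {a \<times> b | a b. a \<in> predictable_gen \<and> b \<in> sets ((borel :: 'a measure) \<Otimes>\<^sub>M (borel :: 'a measure))})"
  proof (rule sets_pair_eq)
    show "predictable_gen \<subseteq> Pow (space (predictable_algebra M \<mu> N))" using predictable_gen_Pow by simp
    show "sets (predictable_algebra M \<mu> N) = sigma_sets (space (predictable_algebra M \<mu> N)) predictable_gen"
      by (simp add: sets_predictable)
    \<comment> \<open>A countable cover of the whole space by generators. The slice at time 0 has to
      be listed separately, as the half-open intervals never contain 0.\<close>
    let ?C = "insert ({0} \<times> space M) (range (\<lambda>n::nat. {0<..real n} \<times> space M))"
    show "countable ?C" by simp
    show "?C \<subseteq> predictable_gen"
    proof -
      have "{0} \<times> space M \<in> predictable_gen" unfolding predictable_gen_def using space_noise_filtration[of 0] by blast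
      moreover have "{0<..real n} \<times> space M \<in> predictable_gen" for n
        unfolding predictable_gen_def using space_noise_filtration[of 0]
        by (intro UnI2 CollectI exI[of _ 0] exI[of _ "real n"] exI[of _ "space M"]) auto
      ultimately show ?thesis by auto
    qed
    show "\<Union>?C = space (predictable_algebra M \<mu> N)"
    proof -
      have "(r, \<omega>) \<in> \<Union>?C" if "0 \<le> r" "\<omega> \<in> space M" for r \<omega>
      proof (cases "r = 0")
        case False
        obtain n where "r \<le> real n" using real_arch_simple by blast
        then show ?thesis using False that by auto
      qed (use that in auto)
      note cover = this
      have "space (predictable_algebra M \<mu> N) \<subseteq> \<Union>?C"
      proof
        fix z assume "z \<in> space (predictable_algebra M \<mu> N)"
        then obtain r \<omega> where "z = (r, \<omega>)" "0 \<le> r" "\<omega> \<in> space M" by auto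
        then show "z \<in> \<Union>?C" using cover by (simp only:)
      qed
      moreover have "\<Union>?C \<subseteq> space (predictable_algebra M \<mu> N)" by auto
      ultimately show ?thesis by (rule antisym[rotated])
    qed
    show "sets ((borel :: 'a measure) \<Otimes>\<^sub>M (borel :: 'a measure)) \<subseteq> Pow (space (borel \<Otimes>\<^sub>M borel))"
      by (rule sets.space_closed)
    show "sets ((borel :: 'a measure) \<Otimes>\<^sub>M (borel :: 'a measure)) = sigma_sets (space (borel \<Otimes>\<^sub>M borel)) (sets (borel \<Otimes>\<^sub>M borel))"
      by (rule sets.sigma_sets_eq[symmetric])
    show "countable {UNIV :: ('a \<times> 'a) set}" "\<Union>{UNIV :: ('a \<times> 'a) set} = space (borel \<Otimes>\<^sub>M borel)"
      "{UNIV :: ('a \<times> 'a) set} \<subseteq> sets ((borel :: 'a measure) \<Otimes>\<^sub>M (borel :: 'a measure))"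
      using sets.top[of "(borel :: 'a measure) \<Otimes>\<^sub>M (borel :: 'a measure)"] by (auto simp: bb)
  qed
  also have "\<dots> = sigma_sets (({0..} \<times> space M) \<times> UNIV) rect_gen"
    unfolding bb space_predictable rect_gen_def[symmetric] by (rule sets_measure_of[OF rect_gen_Pow])
  finally show ?thesis .
qed

text \<open>Dynkin's argument inside a box of finite measure. Finiteness makes the indicator of the
  box itself simple, which handles complements, and allows continuity from above, which handles
  countable unions. Generators at time 0 do not meet the box.\<close>

lemma simple_approximable_indicator_box:
  assumes D0: "D0 \<in> sets (space_mark_measure \<mu>)" "emeasure (space_mark_measure \<mu>) D0 < \<infinity>" and T: "0 \<le> T"
    and A: "A \<in> sets predictable_mark_algebra"
  shows "simple_approximable (indicator (A \<inter> (({0<..T} \<times> space M) \<times> D0)))"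
proof -
  let ?Box = "({0<..T} \<times> space M) \<times> D0"
  have single: "simple_approximable (indicator (({s<..t} \<times> F) \<times> D))"
    if "0 \<le> s" "F \<in> sets (noise_filtration M \<mu> N s)" "D \<in> sets (space_mark_measure \<mu>)" "emeasure (space_mark_measure \<mu>) D < \<infinity>" for s t F D
  proof (cases "s \<le> t")
    case True
    have "simple_predictable M \<mu> N [(1, F, s, t, D)]" using that True by (simp add: simple_predictable_iff valid_term_def)
    moreover have "simple_val [(1, F, s, t, D)] = indicator (({s<..t} \<times> F) \<times> D)"
      by (simp add: fun_eq_iff simple_val_eq term_val_def)
    ultimately show ?thesis using simple_approximable_val by metis
  next
    case False
    then have "(indicator (({s<..t} \<times> F) \<times> D) :: _ \<Rightarrow> real) = (\<lambda>z. 0)" by (auto simp: fun_eq_iff)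
    then show ?thesis using simple_approximable_zero by simp
  qed
  have box: "?Box \<in> sets predictable_mark_algebra"
    using D0 T space_noise_filtration by (intro pair_measureI rectangle_predictable) (auto simp: sets_space_mark)
  have box_fin: "emeasure pred_measure ?Box < \<infinity>"
    using T D0 box region_finite[of 0 D0 T] by (subst emeasure_pred_measure_Times) (auto simp: emeasure_space_1)
  have "A \<in> sigma_sets (({0..} \<times> space M) \<times> UNIV) rect_gen" using A by (simp only: sets_predictable_mark)
  with Int_stable_rect_gen rect_gen_Pow show ?thesis
  proof (induction A rule: sigma_sets_induct_disjoint)
    case (basic A)
    then obtain a b where A: "A = a \<times> b" "a \<in> predictable_gen" "b \<in> sets ((borel :: 'a measure) \<Otimes>\<^sub>M (borel :: 'a measure))"
      unfolding rect_gen_def by auto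
    have b: "b \<inter> D0 \<in> sets (space_mark_measure \<mu>)" "emeasure (space_mark_measure \<mu>) (b \<inter> D0) < \<infinity>"
      using A(3) D0 emeasure_mono[of "b \<inter> D0" D0 "space_mark_measure \<mu>"] by (auto simp: sets_space_mark intro: order_le_less_trans)
    from A(2) consider (z) F where "a = {0} \<times> F"
      | (i) s t F where "a = {s<..t} \<times> F" "0 \<le> s" "F \<in> sets (noise_filtration M \<mu> N s)"
      unfolding predictable_gen_def by auto
    then show ?case
    proof cases
      case z
      then have "A \<inter> ?Box = {}" using A by auto
      then show ?thesis using simple_approximable_zero by (simp add: indicator_def[abs_def])
    next
      case i
      have "F \<subseteq> space M" using i(3) filtration_events sets.sets_into_space by blast
      then have "A \<inter> ?Box = ({s<..min t T} \<times> F) \<times> (b \<inter> D0)" using i A by auto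
      then show ?thesis using single[OF i(2,3) b] by simp
    qed
  next
    case empty
    show ?case using simple_approximable_zero by (simp add: indicator_def[abs_def])
  next
    case (compl A)
    have "indicator ((({0..} \<times> space M) \<times> UNIV - A) \<inter> ?Box) z = indicator ?Box z + (- 1) * (indicator (A \<inter> ?Box) z :: real)" for z
      by (auto simp: indicator_def)
    then show ?case
      using simple_approximable_add[OF single[OF order_refl space_noise_filtration D0] simple_approximable_cmult[OF compl(2), of "-1"]]
      by simp
  next
    case (union A)
    have As: "A i \<in> sets predictable_mark_algebra" for i using union(2) unfolding sets_predictable_mark by auto
    define B where "B k = (\<Union>i<k. A i \<inter> ?Box)" for k :: nat
    have Bs: "B k \<in> sets predictable_mark_algebra" for k unfolding B_def using As box by auto
    let ?U = "(\<Union>i. A i) \<inter> ?Box"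
    have Us: "?U \<in> sets predictable_mark_algebra" using As box by auto
    have BU: "B k \<subseteq> ?U" for k by (auto simp: B_def)
    have appB: "simple_approximable (indicator (B k))" for k
    proof -
      have "indicator (B k) = (\<lambda>z. \<Sum>i<k. indicator (A i \<inter> ?Box) z :: real)"
        unfolding B_def using union(1)
        by (intro ext indicator_UN_disjoint) (auto simp: disjoint_family_on_def)
      then show ?thesis using simple_approximable_sum[of "{..<k}"] union(3) by simp
    qed
    have lim: "(\<lambda>k. emeasure pred_measure (?U - B k)) \<longlonglongrightarrow> emeasure pred_measure (\<Inter>k. ?U - B k)"
    proof (rule Lim_emeasure_decseq)
      show "range (\<lambda>k. ?U - B k) \<subseteq> sets pred_measure" using Us Bs by auto
      show "decseq (\<lambda>k. ?U - B k)" unfolding decseq_def B_def by (auto dest: less_le_trans)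
      show "emeasure pred_measure (?U - B k) \<noteq> \<infinity>" for k
      proof -
        have "emeasure pred_measure (?U - B k) \<le> emeasure pred_measure ?Box"
          by (rule emeasure_mono) (use box in auto)
        also note box_fin
        finally show ?thesis by simp
      qed
    qed
    have "(\<Inter>k. ?U - B k) = {}" unfolding B_def by auto
    with lim have lim0: "(\<lambda>k. emeasure pred_measure (?U - B k)) \<longlonglongrightarrow> 0" by (simp only: emeasure_empty)
    show ?case
    proof (rule simple_approximable_limit)
      show "indicator ?U \<in> borel_measurable predictable_mark_algebra" using Us by simp
      fix e :: real assume "0 < e"
      then have "\<forall>\<^sub>F k in sequentially. emeasure pred_measure (?U - B k) < ennreal e"
        using order_tendstoD(2)[OF lim0, of "ennreal e"] by simp
      then obtain k where "emeasure pred_measure (?U - B k) < ennreal e" by (auto simp: eventually_sequentially)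
      then show "\<exists>g. simple_approximable g \<and> L2dist (indicator ?U) g < ennreal e"
        using appB[of k] L2dist_indicator[OF BU Bs Us] by auto
    qed
  qed
qed

text \<open>Simple integrands vanish at time 0, while general predictable ones may not; the
  discrepancy lies on a null set.\<close>

lemma AE_pred_measure_pos: "AE z in pred_measure. 0 < fst (fst z)"
proof -
  have "AE w in intensity \<mu> \<Otimes>\<^sub>M M. 0 < fst (fst (rearrange w))"
  proof (rule AE_I')
    let ?Z = "({0} \<times> UNIV) \<times> space M"
    have "{0::real} \<times> UNIV \<in> sets (intensity \<mu>)" "emeasure (intensity \<mu>) ({0} \<times> UNIV) = 0"
      using emeasure_intensity_Times[of "{0}" UNIV] sets.top[of "space_mark_measure \<mu>"] by auto
    then show "?Z \<in> null_sets (intensity \<mu> \<Otimes>\<^sub>M M)"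
      by (auto simp: null_sets_def emeasure_pair_measure_Times)
    show "{w \<in> space (intensity \<mu> \<Otimes>\<^sub>M M). \<not> 0 < fst (fst (rearrange w))} \<subseteq> ?Z"
      by (auto simp: rearrange_def space_pair_measure)
  qed
  moreover have "{z \<in> space predictable_mark_algebra. 0 < fst (fst z)} \<in> sets predictable_mark_algebra"
  proof -
    have "{z \<in> space predictable_mark_algebra. 0 < fst (fst z)} = (\<Union>n::nat. ({0<..real n} \<times> space M) \<times> UNIV)"
      using real_arch_simple by (auto simp: space_pair_measure)
    also have "\<dots> \<in> sets predictable_mark_algebra"
      using sets.top[of "(borel :: 'a measure) \<Otimes>\<^sub>M (borel :: 'a measure)"] space_noise_filtration
      by (intro sets.countable_UN image_subsetI pair_measureI rectangle_predictable) (auto simp: space_pair_measure)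
    finally show ?thesis .
  qed
  ultimately show ?thesis unfolding pred_measure_def by (subst AE_distr_iff) auto
qed

text \<open>\<open>f\<close> is approximated by measurable step functions \<open>Fs n\<close>
  restricted to growing boxes of finite measure. Each such function is a finite combination of
  indicators covered by the previous lemmas, and dominated convergence gives the limit in
  L^2.\<close>

theorem simple_dense:
  assumes f: "f \<in> borel_measurable predictable_mark_algebra" and fin: "(\<integral>\<^sup>+z. ennreal ((f z)\<^sup>2) \<partial>pred_measure) < \<infinity>"
  shows "simple_approximable f"
proof (rule simple_approximable_limit[OF f])
  fix e :: real assume e: "0 < e"
  obtain Fs where Fs: "\<And>i. simple_function predictable_mark_algebra (Fs i)"
    and Flim: "\<And>z. z \<in> space predictable_mark_algebra \<Longrightarrow> (\<lambda>i. Fs i z) \<longlonglongrightarrow> f z"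
    and Fbd: "\<And>i z. z \<in> space predictable_mark_algebra \<Longrightarrow> dist (Fs i z) 0 \<le> 2 * dist (f z) 0"
    using borel_measurable_implies_sequence_metric[OF f, of 0] by blast
  obtain D where D: "range D \<subseteq> sets (space_mark_measure \<mu>)" "(\<Union>i. D i) = UNIV"
    "\<And>i. emeasure (space_mark_measure \<mu>) (D i) \<noteq> \<infinity>" "incseq D"
    using space_mark.sigma_finite_incseq by auto
  let ?Box = "\<lambda>n::nat. ({0<..real n} \<times> space M) \<times> D n"
  have boxs: "?Box n \<in> sets predictable_mark_algebra" for n
    using D space_noise_filtration by (intro pair_measureI rectangle_predictable) (auto simp: sets_space_mark[symmetric])
  define h where "h n z = Fs n z * indicator (?Box n) z" for n z
  have Fm: "Fs n \<in> borel_measurable predictable_mark_algebra" for n using Fs by (rule borel_measurable_simple_function)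
  have hm: "h n \<in> borel_measurable predictable_mark_algebra" for n
    unfolding h_def using Fm boxs by (intro borel_measurable_times borel_measurable_indicator)
  have happ: "simple_approximable (h n)" for n
  proof -
    let ?R = "Fs n ` space predictable_mark_algebra"
    let ?g = "\<lambda>z. \<Sum>y\<in>?R. y * indicator ((Fs n -` {y} \<inter> space predictable_mark_algebra) \<inter> ?Box n) z"
    have "simple_approximable ?g"
    proof (intro simple_approximable_sum simple_approximable_cmult simple_approximable_indicator_box)
      show "finite ?R" using Fs by (rule simple_functionD)
      show "D n \<in> sets (space_mark_measure \<mu>)" "emeasure (space_mark_measure \<mu>) (D n) < \<infinity>"
        using D by (auto simp: less_top)
      show "Fs n -` {y} \<inter> space predictable_mark_algebra \<in> sets predictable_mark_algebra" for y
        using Fs by (rule simple_functionD)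
    qed simp
    moreover have "?g = h n"
    proof
      fix z
      show "?g z = h n z"
      proof (cases "z \<in> ?Box n")
        case True
        then have zs: "z \<in> space predictable_mark_algebra" using boxs sets.sets_into_space by blast
        have "?g z = (\<Sum>y\<in>?R. if y = Fs n z then y else 0)"
          using True zs by (intro sum.cong) (auto simp: indicator_def)
        also have "\<dots> = Fs n z" using zs Fs[of n] by (simp add: simple_functionD(1))
        finally show ?thesis using True by (simp add: h_def)
      next
        case False
        then show ?thesis by (simp add: h_def indicator_def)
      qed
    qed
    ultimately show ?thesis by simp
  qed
  have [measurable]: "f \<in> borel_measurable pred_measure" "h n \<in> borel_measurable pred_measure" for n
    using f hm by (simp_all add: borel_measurable_pred_measure)
  have "(\<lambda>n. L2dist f (h n)) \<longlonglongrightarrow> (\<integral>\<^sup>+z. 0 \<partial>pred_measure)"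
    unfolding L2dist_def
  proof (rule nn_integral_dominated_convergence)
    \<comment> \<open>The approximants satisfy
      \<open>\<bar>h n z\<bar> \<le> 2 * \<bar>f z\<bar>\<close>, so the error is at most
      \<open>3 * \<bar>f z\<bar>\<close>, with square \<open>9 * (f z)\<^sup>2\<close>.\<close>
    show "(\<integral>\<^sup>+z. ennreal 9 * ennreal ((f z)\<^sup>2) \<partial>pred_measure) < \<infinity>"
      using fin by (simp add: nn_integral_cmult ennreal_mult_less_top)
    show "AE z in pred_measure. ennreal ((f z - h n z)\<^sup>2) \<le> ennreal 9 * ennreal ((f z)\<^sup>2)" for n
      using AE_space
    proof eventually_elim
      fix z assume "z \<in> space pred_measure"
      then have "\<bar>Fs n z\<bar> \<le> 2 * \<bar>f z\<bar>" using Fbd[of z n] by (simp add: space_pair_measure)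
      then have "\<bar>h n z\<bar> \<le> 2 * \<bar>f z\<bar>" by (simp add: h_def indicator_def)
      then have "\<bar>f z - h n z\<bar> \<le> \<bar>3 * f z\<bar>" by linarith
      then have "(f z - h n z)\<^sup>2 \<le> (3 * f z)\<^sup>2" by (rule abs_le_square_iff[THEN iffD1])
      then show "ennreal ((f z - h n z)\<^sup>2) \<le> ennreal 9 * ennreal ((f z)\<^sup>2)"
        by (subst ennreal_mult'[symmetric]) (auto intro!: ennreal_leI simp: power2_eq_square)
    qed
    show "AE z in pred_measure. (\<lambda>n. ennreal ((f z - h n z)\<^sup>2)) \<longlonglongrightarrow> 0"
      using AE_space AE_pred_measure_pos
    proof eventually_elim
      fix z assume zs: "z \<in> space pred_measure" and pos: "0 < fst (fst z)"
      obtain n1 where n1: "fst (fst z) \<le> real n1" using real_arch_simple by blast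
      obtain n2 where n2: "snd z \<in> D n2" using D(2) by auto
      have "z \<in> ?Box n" if "n \<ge> max n1 n2" for n
      proof -
        have "snd z \<in> D n" using n2 D(4) that by (auto simp: incseq_def)
        moreover have "fst (fst z) \<le> real n" using n1 that by linarith
        ultimately show ?thesis using zs pos by (cases z) auto
      qed
      then have "\<forall>\<^sub>F n in sequentially. Fs n z = h n z"
        by (intro eventually_sequentiallyI[of "max n1 n2"]) (simp add: h_def)
      moreover have "(\<lambda>n. Fs n z) \<longlonglongrightarrow> f z" using zs by (intro Flim) (simp add: space_pair_measure)
      ultimately have "(\<lambda>n. h n z) \<longlonglongrightarrow> f z" by (rule Lim_transform_eventually[rotated])
      then have "(\<lambda>n. ennreal ((f z - h n z)\<^sup>2)) \<longlonglongrightarrow> ennreal ((f z - f z)\<^sup>2)" by (intro tendsto_intros)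
      then show "(\<lambda>n. ennreal ((f z - h n z)\<^sup>2)) \<longlonglongrightarrow> 0" by simp
    qed
  qed simp_all
  then have "(\<lambda>n. L2dist f (h n)) \<longlonglongrightarrow> 0" by simp
  then have "\<forall>\<^sub>F n in sequentially. L2dist f (h n) < ennreal e"
    using e by (intro order_tendstoD(2)) auto
  then obtain n where "L2dist f (h n) < ennreal e" by (auto simp: eventually_sequentially)
  then show "\<exists>g. simple_approximable g \<and> L2dist f g < ennreal e" using happ by auto
qed

end

section \<open>The stochastic integral\<close>

context levy_noise
begin

definition integrand_fun :: "(real \<Rightarrow> 'a \<Rightarrow> 'a \<Rightarrow> 'w \<Rightarrow> real) \<Rightarrow> (real \<times> 'w) \<times> 'a \<times> 'a \<Rightarrow> real" where
  "integrand_fun X = (\<lambda>((s, \<omega>), (y, h)). X s y h \<omega>)"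

lemma predictable_integrand_iff:
  "predictable_integrand M \<mu> N X \<longleftrightarrow> integrand_fun X \<in> borel_measurable predictable_mark_algebra"
  by (simp add: predictable_integrand_def integrand_fun_def)

lemma sq_norm_integrand_eq:
  assumes "integrand_fun X \<in> borel_measurable predictable_mark_algebra"
  shows "sq_norm_integrand M \<mu> X = (\<integral>\<^sup>+z. ennreal ((integrand_fun X z)\<^sup>2) \<partial>pred_measure)"
proof -
  note [measurable] = assms
  have "(\<integral>\<^sup>+z. ennreal ((integrand_fun X z)\<^sup>2) \<partial>pred_measure) = (\<integral>\<^sup>+w. ennreal ((integrand_fun X (rearrange w))\<^sup>2) \<partial>(intensity \<mu> \<Otimes>\<^sub>M M))"
    unfolding pred_measure_def by (subst nn_integral_distr) auto
  also have "\<dots> = (\<integral>\<^sup>+x. (\<integral>\<^sup>+\<omega>. ennreal ((integrand_fun X (rearrange (x, \<omega>)))\<^sup>2) \<partial>M) \<partial>intensity \<mu>)"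
    by (rule nn_integral_fst[symmetric]) measurable
  also have "\<dots> = sq_norm_integrand M \<mu> X"
    unfolding sq_norm_integrand_def by (intro nn_integral_cong) (auto simp: integrand_fun_def rearrange_def)
  finally show ?thesis by simp
qed

lemma sq_norm_integrand_diff_simple:
  assumes "integrand_fun X \<in> borel_measurable predictable_mark_algebra" "simple_predictable M \<mu> N S"
  shows "sq_norm_integrand M \<mu> (\<lambda>s y h \<omega>. X s y h \<omega> - simple_value S s y h \<omega>) = L2dist (integrand_fun X) (simple_val S)"
proof -
  have eq: "integrand_fun (\<lambda>s y h \<omega>. X s y h \<omega> - simple_value S s y h \<omega>) = (\<lambda>z. integrand_fun X z - simple_val S z)"
    by (auto simp: integrand_fun_def simple_val_def fun_eq_iff)
  have "(\<lambda>z. integrand_fun X z - simple_val S z) \<in> borel_measurable predictable_mark_algebra"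
    using assms simple_val_measurable by (intro borel_measurable_diff)
  then show ?thesis by (subst sq_norm_integrand_eq) (simp_all add: eq L2dist_def)
qed

lemma simple_integral_diff_isometry:
  assumes S: "simple_predictable M \<mu> N S" and T: "simple_predictable M \<mu> N T"
  shows "(\<integral>\<^sup>+\<omega>. ennreal ((simple_integral \<mu> N S \<omega> - simple_integral \<mu> N T \<omega>)\<^sup>2) \<partial>M) = L2dist (simple_val S) (simple_val T)"
proof -
  \<comment> \<open>The difference of two simple integrands is simple: append the second list with
    negated coefficients.\<close>
  define U where "U = S @ map (\<lambda>(c, r). (- c, r)) T"
  have "simple_predictable M \<mu> N U" using S T by (auto simp: U_def simple_predictable_iff valid_term_def)
  moreover have neg: "(\<Sum>x\<leftarrow>T. - f x) = - (\<Sum>x\<leftarrow>T. f x)" for f :: "_ \<Rightarrow> real" by (induction T) auto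
  have "simple_integral \<mu> N U \<omega> = simple_integral \<mu> N S \<omega> - simple_integral \<mu> N T \<omega>" for \<omega>
    by (simp add: U_def simple_integral_eq o_def split_def term_int_def neg)
  moreover have "simple_val U z = simple_val S z - simple_val T z" for z
    by (simp add: U_def simple_val_eq o_def split_def term_val_def neg)
  ultimately show ?thesis using simple_integral_isometry[of U] by (simp add: L2dist_def)
qed

lemma L2dist_commute: "L2dist f g = L2dist g f"
  unfolding L2dist_def by (simp add: power2_commute)

text \<open>Completeness of L^2, made explicit. Approximants are chosen so close to the integrand
  that the increments of their integrals are absolutely summable almost surely. The pointwise limit
  is then identified as the limit in L^2 by Fatou's lemma.\<close>

theorem has_stoch_integral_exists:
  assumes pred: "predictable_integrand M \<mu> N X" and fin: "sq_norm_integrand M \<mu> X < \<infinity>"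
  shows "\<exists>Y. has_stoch_integral M \<mu> N X Y"
proof -
  let ?f = "integrand_fun X"
  have f: "?f \<in> borel_measurable predictable_mark_algebra" using pred by (simp add: predictable_integrand_iff)
  have "simple_approximable ?f"
    using fin unfolding sq_norm_integrand_eq[OF f] by (rule simple_dense[OF f])
  \<comment> \<open>The rate has to absorb a factor \<open>2 ^ n\<close>: in the bound on the first
    moments of the increments, \<open>2 ^ n * (1 / 8) ^ n\<close> is still summable.\<close>
  then have "\<forall>n::nat. \<exists>S. simple_predictable M \<mu> N S \<and> L2dist ?f (simple_val S) < ennreal ((1 / 8) ^ n)"
    unfolding simple_approximable_def by simp
  then obtain S where S: "\<And>n. simple_predictable M \<mu> N (S n)" and Sd: "\<And>n. L2dist ?f (simple_val (S n)) < ennreal ((1 / 8) ^ n)"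
    by metis
  define I where "I n = simple_integral \<mu> N (S n)" for n
  have Im [measurable]: "I n \<in> borel_measurable M" for n unfolding I_def by (rule simple_integral_measurable[OF S])
  have dist: "(\<integral>\<^sup>+\<omega>. ennreal ((I m \<omega> - I n \<omega>)\<^sup>2) \<partial>M) \<le> ennreal (4 * (1 / 8) ^ n)" if "n \<le> m" for m n
  proof -
    have "(\<integral>\<^sup>+\<omega>. ennreal ((I m \<omega> - I n \<omega>)\<^sup>2) \<partial>M) = L2dist (simple_val (S m)) (simple_val (S n))"
      unfolding I_def by (rule simple_integral_diff_isometry[OF S S])
    also have "\<dots> \<le> 2 * L2dist (simple_val (S m)) ?f + 2 * L2dist ?f (simple_val (S n))"
      using S f by (intro L2dist_triangle simple_val_measurable)
    also have "\<dots> \<le> ennreal 2 * ennreal ((1 / 8) ^ n) + ennreal 2 * ennreal ((1 / 8) ^ n)"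
    proof -
      have "L2dist (simple_val (S m)) ?f \<le> ennreal ((1 / 8) ^ m)" using Sd[of m] by (simp add: L2dist_commute less_imp_le)
      also have "\<dots> \<le> ennreal ((1 / 8) ^ n)" using that by (intro ennreal_leI power_decreasing) auto
      finally show ?thesis using Sd[of n] by (intro add_mono mult_mono) (auto simp: less_imp_le)
    qed
    also have "\<dots> = ennreal (4 * (1 / 8) ^ n)"
      by (subst (1 2) ennreal_mult'[symmetric], simp, subst ennreal_plus[symmetric]) auto
    finally show ?thesis .
  qed
  have abs_bd: "(\<integral>\<^sup>+\<omega>. ennreal \<bar>I (Suc n) \<omega> - I n \<omega>\<bar> \<partial>M) \<le> ennreal (5 * (1 / 2) ^ n)" for n
  proof -
    \<comment> \<open>A weighted inequality of arithmetic and geometric means, which passes from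
      second to first moments: the first summand is summable and the second is controlled by the L^2
      rate.\<close>
    have am: "\<bar>x\<bar> \<le> (1 / 2) ^ n + 2 ^ n * x\<^sup>2" for x :: real
    proof -
      have p: "(2::real) ^ n > 0" by simp
      have "0 \<le> (2 ^ n * \<bar>x\<bar> - 1)\<^sup>2 / 2 ^ n" by simp
      also have "\<dots> = 2 ^ n * x\<^sup>2 - 2 * \<bar>x\<bar> + (1 / 2) ^ n"
        using p by (simp add: power2_eq_square field_simps)
      finally show ?thesis by (simp add: algebra_simps)
    qed
    have "(\<integral>\<^sup>+\<omega>. ennreal \<bar>I (Suc n) \<omega> - I n \<omega>\<bar> \<partial>M) \<le> (\<integral>\<^sup>+\<omega>. ennreal ((1 / 2) ^ n) + ennreal (2 ^ n) * ennreal ((I (Suc n) \<omega> - I n \<omega>)\<^sup>2) \<partial>M)"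
      using am by (intro nn_integral_mono) (simp add: ennreal_mult'[symmetric] ennreal_plus[symmetric] ennreal_leI del: ennreal_plus)
    also have "\<dots> = ennreal ((1 / 2) ^ n) + ennreal (2 ^ n) * (\<integral>\<^sup>+\<omega>. ennreal ((I (Suc n) \<omega> - I n \<omega>)\<^sup>2) \<partial>M)"
      by (simp add: nn_integral_add nn_integral_cmult emeasure_space_1)
    also have "\<dots> \<le> ennreal ((1 / 2) ^ n) + ennreal (2 ^ n) * ennreal (4 * (1 / 8) ^ n)"
      by (intro add_left_mono mult_left_mono dist) auto
    also have "\<dots> = ennreal ((1 / 2) ^ n + 4 * (1 / 4) ^ n)"
      by (simp add: ennreal_mult'[symmetric] ennreal_plus[symmetric] power_mult_distrib[symmetric] mult.left_commute del: ennreal_plus)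
    also have "\<dots> \<le> ennreal (5 * (1 / 2) ^ n)"
    proof (intro ennreal_leI)
      have "((1::real) / 4) ^ n \<le> (1 / 2) ^ n" by (intro power_mono) auto
      then show "((1::real) / 2) ^ n + 4 * (1 / 4) ^ n \<le> 5 * (1 / 2) ^ n" by simp
    qed
    finally show ?thesis .
  qed
  have "(\<integral>\<^sup>+\<omega>. (\<Sum>n. ennreal \<bar>I (Suc n) \<omega> - I n \<omega>\<bar>) \<partial>M) = (\<Sum>n. \<integral>\<^sup>+\<omega>. ennreal \<bar>I (Suc n) \<omega> - I n \<omega>\<bar> \<partial>M)"
    by (rule nn_integral_suminf) simp
  also have "\<dots> \<le> (\<Sum>n. ennreal (5 * (1 / 2) ^ n))" by (intro suminf_le abs_bd) auto
  also have "\<dots> < \<infinity>"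
  proof -
    have "(\<lambda>n. 5 * (1 / 2) ^ n :: real) sums (5 * (1 / (1 - 1 / 2)))" by (intro sums_mult geometric_sums) auto
    then have "(\<Sum>n. ennreal (5 * (1 / 2) ^ n)) = ennreal (5 * (1 / (1 - 1 / 2)))" by (intro suminf_ennreal_eq) auto
    then show ?thesis by simp
  qed
  finally have "AE \<omega> in M. (\<Sum>n. ennreal \<bar>I (Suc n) \<omega> - I n \<omega>\<bar>) \<noteq> \<infinity>"
    by (intro nn_integral_PInf_AE) auto
  then have conv: "AE \<omega> in M. convergent (\<lambda>n. I n \<omega>)"
  proof eventually_elim
    fix \<omega> assume "(\<Sum>n. ennreal \<bar>I (Suc n) \<omega> - I n \<omega>\<bar>) \<noteq> \<infinity>"
    then have "summable (\<lambda>n. \<bar>I (Suc n) \<omega> - I n \<omega>\<bar>)" by (intro summable_suminf_not_top) auto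
    then have "summable (\<lambda>n. I (Suc n) \<omega> - I n \<omega>)" by (rule summable_rabs_cancel)
    then have "convergent (\<lambda>n. \<Sum>i<n. I (Suc i) \<omega> - I i \<omega>)" by (simp add: summable_iff_convergent)
    then have "convergent (\<lambda>n. I n \<omega> - I 0 \<omega>)" by (simp only: sum_lessThan_telescope[of "\<lambda>i. I i \<omega>"])
    then have "convergent (\<lambda>n. (I n \<omega> - I 0 \<omega>) + I 0 \<omega>)" by (intro convergent_add convergent_const)
    then show "convergent (\<lambda>n. I n \<omega>)" by simp
  qed
  \<comment> \<open>Where the sequence diverges, a null set, \<open>lim\<close> is an unspecified
    number; \<open>Y\<close> is measurable nevertheless and all later uses are almost sure.\<close>
  define Y where "Y \<omega> = lim (\<lambda>n. I n \<omega>)" for \<omega>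
  have Ym [measurable]: "Y \<in> borel_measurable M" unfolding Y_def by (rule borel_measurable_lim_metric) simp
  have lim: "AE \<omega> in M. (\<lambda>n. I n \<omega>) \<longlonglongrightarrow> Y \<omega>"
    using conv by eventually_elim (simp add: Y_def convergent_LIMSEQ_iff)
  have Yd: "(\<integral>\<^sup>+\<omega>. ennreal ((Y \<omega> - I n \<omega>)\<^sup>2) \<partial>M) \<le> ennreal (4 * (1 / 8) ^ n)" for n
  proof -
    have "(\<integral>\<^sup>+\<omega>. ennreal ((Y \<omega> - I n \<omega>)\<^sup>2) \<partial>M) = (\<integral>\<^sup>+\<omega>. liminf (\<lambda>m. ennreal ((I m \<omega> - I n \<omega>)\<^sup>2)) \<partial>M)"
      using lim
    proof (intro nn_integral_cong_AE, eventually_elim)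
      fix \<omega> assume "(\<lambda>n. I n \<omega>) \<longlonglongrightarrow> Y \<omega>"
      then have "(\<lambda>m. ennreal ((I m \<omega> - I n \<omega>)\<^sup>2)) \<longlonglongrightarrow> ennreal ((Y \<omega> - I n \<omega>)\<^sup>2)" by (intro tendsto_intros)
      then show "ennreal ((Y \<omega> - I n \<omega>)\<^sup>2) = liminf (\<lambda>m. ennreal ((I m \<omega> - I n \<omega>)\<^sup>2))"
        by (intro lim_imp_Liminf[symmetric]) auto
    qed
    also have "\<dots> \<le> liminf (\<lambda>m. \<integral>\<^sup>+\<omega>. ennreal ((I m \<omega> - I n \<omega>)\<^sup>2) \<partial>M)"
      by (rule nn_integral_liminf) simp
    also have "\<dots> \<le> ennreal (4 * (1 / 8) ^ n)"
      using dist by (intro Liminf_le eventually_sequentiallyI[of n]) auto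
    finally show ?thesis .
  qed
  have null: "(\<lambda>n. ennreal (c * (1 / 8) ^ n)) \<longlonglongrightarrow> 0" for c
  proof -
    have "(\<lambda>n. c * (1 / 8) ^ n :: real) \<longlonglongrightarrow> c * 0" by (intro tendsto_mult tendsto_const LIMSEQ_realpow_zero) auto
    then have "(\<lambda>n. ennreal (c * (1 / 8) ^ n)) \<longlonglongrightarrow> ennreal (c * 0)" by (rule tendsto_ennrealI)
    then show ?thesis by simp
  qed
  have "has_stoch_integral M \<mu> N X Y"
    unfolding has_stoch_integral_def
  proof (intro conjI pred fin Ym exI[of _ S] allI S)
    show "(\<lambda>n. sq_norm_integrand M \<mu> (\<lambda>s y h \<omega>. X s y h \<omega> - simple_value (S n) s y h \<omega>)) \<longlonglongrightarrow> 0"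
      unfolding sq_norm_integrand_diff_simple[OF f S]
      using null[of 1] by (rule tendsto_sandwich[OF _ _ tendsto_const, rotated 2]) (auto intro!: always_eventually less_imp_le[OF Sd, THEN order_trans])
    show "(\<lambda>n. \<integral>\<^sup>+ \<omega>. ennreal ((Y \<omega> - simple_integral \<mu> N (S n) \<omega>)\<^sup>2) \<partial>M) \<longlonglongrightarrow> 0"
      using null[of 4] Yd unfolding I_def
      by (intro tendsto_sandwich[OF _ _ tendsto_const null[of 4]]) (auto intro!: always_eventually)
  qed
  then show ?thesis by blast
qed

text \<open>\<open>Y\<close> is compared with the integral of an approximant, the isometry moves to
  the approximant itself, and this is compared with \<open>X\<close>. Each comparison costs a factor
  \<open>1 + \<delta>\<close> and an error that vanishes as \<open>n\<close> grows; only afterwards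
  does \<open>\<delta>\<close> tend to 0.\<close>

theorem has_stoch_integral_sq_le:
  assumes Y: "has_stoch_integral M \<mu> N X Y"
  shows "(\<integral>\<^sup>+\<omega>. ennreal ((Y \<omega>)\<^sup>2) \<partial>M) \<le> sq_norm_integrand M \<mu> X"
proof -
  have f: "integrand_fun X \<in> borel_measurable predictable_mark_algebra" and fin: "sq_norm_integrand M \<mu> X < \<infinity>"
    and Ym [measurable]: "Y \<in> borel_measurable M"
    using Y by (auto simp: has_stoch_integral_def predictable_integrand_iff)
  obtain S where S: "\<And>n::nat. simple_predictable M \<mu> N (S n)"
    and lim0: "(\<lambda>n. sq_norm_integrand M \<mu> (\<lambda>s y h \<omega>. X s y h \<omega> - simple_value (S n) s y h \<omega>)) \<longlonglongrightarrow> 0"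
    and lim2: "(\<lambda>n. \<integral>\<^sup>+ \<omega>. ennreal ((Y \<omega> - simple_integral \<mu> N (S n) \<omega>)\<^sup>2) \<partial>M) \<longlonglongrightarrow> 0"
    using Y unfolding has_stoch_integral_def by blast
  have lim1: "(\<lambda>n. L2dist (integrand_fun X) (simple_val (S n))) \<longlonglongrightarrow> 0"
    using lim0 by (simp only: sq_norm_integrand_diff_simple[OF f S])
  let ?q = "sq_norm_integrand M \<mu> X" and ?a = "\<lambda>n. L2dist (integrand_fun X) (simple_val (S n))"
    and ?b = "\<lambda>n. \<integral>\<^sup>+ \<omega>. ennreal ((Y \<omega> - simple_integral \<mu> N (S n) \<omega>)\<^sup>2) \<partial>M"
  have q: "?q = (\<integral>\<^sup>+z. ennreal ((integrand_fun X z)\<^sup>2) \<partial>pred_measure)" by (rule sq_norm_integrand_eq[OF f])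
  have [measurable]: "integrand_fun X \<in> borel_measurable pred_measure" "simple_val (S n) \<in> borel_measurable pred_measure" for n
    using f simple_val_measurable[OF S] by (simp_all add: borel_measurable_pred_measure)
  have [measurable]: "simple_integral \<mu> N (S n) \<in> borel_measurable M" for n by (rule simple_integral_measurable[OF S])
  have bound: "(\<integral>\<^sup>+\<omega>. ennreal ((Y \<omega>)\<^sup>2) \<partial>M) \<le> ennreal (1 + \<delta>) * (ennreal (1 + \<delta>) * ?q)" if \<delta>: "0 < \<delta>" for \<delta>
  proof -
    have step: "(\<integral>\<^sup>+\<omega>. ennreal ((Y \<omega>)\<^sup>2) \<partial>M) \<le> ennreal (1 + \<delta>) * (ennreal (1 + \<delta>) * ?q + ennreal (1 + 1 / \<delta>) * ?a n) + ennreal (1 + 1 / \<delta>) * ?b n" for n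
    proof -
      have "(\<integral>\<^sup>+\<omega>. ennreal ((Y \<omega>)\<^sup>2) \<partial>M) \<le> ennreal (1 + \<delta>) * (\<integral>\<^sup>+\<omega>. ennreal ((simple_integral \<mu> N (S n) \<omega>)\<^sup>2) \<partial>M) + ennreal (1 + 1 / \<delta>) * ?b n"
        using nn_integral_sq_add_le[of "simple_integral \<mu> N (S n)" M "\<lambda>\<omega>. Y \<omega> - simple_integral \<mu> N (S n) \<omega>" \<delta>] \<delta> by simp
      also have "(\<integral>\<^sup>+\<omega>. ennreal ((simple_integral \<mu> N (S n) \<omega>)\<^sup>2) \<partial>M) = (\<integral>\<^sup>+z. ennreal ((simple_val (S n) z)\<^sup>2) \<partial>pred_measure)"
        by (rule simple_integral_isometry[OF S])
      also have "\<dots> \<le> ennreal (1 + \<delta>) * ?q + ennreal (1 + 1 / \<delta>) * ?a n"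
        unfolding q L2dist_commute[of "integrand_fun X"] unfolding L2dist_def
        using nn_integral_sq_add_le[of "integrand_fun X" pred_measure "\<lambda>z. simple_val (S n) z - integrand_fun X z" \<delta>] \<delta> by simp
      finally show ?thesis by (simp add: add_mono mult_left_mono)
    qed
    have "(\<lambda>n. ennreal (1 + \<delta>) * (ennreal (1 + \<delta>) * ?q + ennreal (1 + 1 / \<delta>) * ?a n) + ennreal (1 + 1 / \<delta>) * ?b n)
      \<longlonglongrightarrow> ennreal (1 + \<delta>) * (ennreal (1 + \<delta>) * ?q + ennreal (1 + 1 / \<delta>) * 0) + ennreal (1 + 1 / \<delta>) * 0"
      by (intro ennreal_tendsto_cmult tendsto_add tendsto_const lim1 lim2) auto
    then have "(\<integral>\<^sup>+\<omega>. ennreal ((Y \<omega>)\<^sup>2) \<partial>M) \<le> ennreal (1 + \<delta>) * (ennreal (1 + \<delta>) * ?q + ennreal (1 + 1 / \<delta>) * 0) + ennreal (1 + 1 / \<delta>) * 0"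
      by (rule tendsto_lowerbound) (use step in auto)
    then show ?thesis by simp
  qed
  have "(\<lambda>n. ennreal (1 + 1 / real (Suc n)) * (ennreal (1 + 1 / real (Suc n)) * ?q)) \<longlonglongrightarrow> ennreal 1 * (ennreal 1 * ?q)"
  proof -
    have "(\<lambda>n. 1 + 1 / real (Suc n)) \<longlonglongrightarrow> 1 + 0" by (intro tendsto_intros LIMSEQ_Suc[OF lim_1_over_n])
    then have 1: "(\<lambda>n. ennreal (1 + 1 / real (Suc n))) \<longlonglongrightarrow> ennreal 1" by (intro tendsto_ennrealI) simp
    then have "(\<lambda>n. ennreal (1 + 1 / real (Suc n)) * ennreal (1 + 1 / real (Suc n))) \<longlonglongrightarrow> ennreal 1 * ennreal 1"
      by (intro tendsto_mult_ennreal) auto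
    then have "(\<lambda>n. ?q * (ennreal (1 + 1 / real (Suc n)) * ennreal (1 + 1 / real (Suc n)))) \<longlonglongrightarrow> ?q * (ennreal 1 * ennreal 1)"
      using fin by (intro ennreal_tendsto_cmult) auto
    then show ?thesis by (simp add: mult.commute mult.left_commute)
  qed
  then have "(\<integral>\<^sup>+\<omega>. ennreal ((Y \<omega>)\<^sup>2) \<partial>M) \<le> ennreal 1 * (ennreal 1 * ?q)"
    by (rule tendsto_lowerbound) (use bound in auto)
  then show ?thesis by simp
qed

corollary stoch_integral_sq_le:
  assumes "predictable_integrand M \<mu> N X" "sq_norm_integrand M \<mu> X < \<infinity>"
  shows "(\<integral>\<^sup>+\<omega>. ennreal ((stoch_integral M \<mu> N X \<omega>)\<^sup>2) \<partial>M) \<le> sq_norm_integrand M \<mu> X"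
  unfolding stoch_integral_def
  using has_stoch_integral_sq_le someI_ex[OF has_stoch_integral_exists[OF assms]] by blast

end

section \<open>The estimate\<close>

lemma ennsqrt_mono: "a \<le> b \<Longrightarrow> ennsqrt a \<le> ennsqrt b"
  by (auto simp: ennsqrt_def top_unique less_top[symmetric] intro!: ennreal_leI real_sqrt_le_mono enn2real_mono)

lemma ennsqrt_mult_sq:
  assumes "0 \<le> c" "a < \<infinity>"
  shows "ennsqrt (ennreal (c\<^sup>2) * a) = ennreal c * ennsqrt a"
proof -
  obtain r where r: "a = ennreal r" "0 \<le> r" using assms(2) by (cases a) auto
  show ?thesis using assms(1) r
    by (simp add: ennsqrt_def ennreal_mult'[symmetric] real_sqrt_mult)
qed

lemma nn_integral_lborel_translate:
  fixes f :: "'a::euclidean_space \<Rightarrow> ennreal"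
  assumes [measurable]: "f \<in> borel_measurable borel"
  shows "(\<integral>\<^sup>+y. f (y - x) \<partial>lborel) = (\<integral>\<^sup>+y. f y \<partial>lborel)"
proof -
  have "(\<integral>\<^sup>+y. f y \<partial>lborel) = (\<integral>\<^sup>+y. f y \<partial>distr lborel borel ((+) (- x)))"
    by (simp add: lborel_distr_plus)
  also have "\<dots> = (\<integral>\<^sup>+y. f (y - x) \<partial>lborel)" by (simp add: nn_integral_distr)
  finally show ?thesis by simp
qed

text \<open>With \<open>r = t - s\<close> the factor \<open>exp (\<gamma> * t)\<close> splits off,
  and enlarging the range of \<open>r\<close> from \<open>(0, t)\<close> to the half-line gives the
  Laplace transform of \<open>r powr (- b)\<close> at \<open>\<gamma>\<close>, a bound whose
  remaining factor does not depend on \<open>t\<close>.\<close>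

lemma nn_integral_exp_convolution_le:
  assumes b: "b < 1" and "0 < \<gamma>"
  shows "(\<integral>\<^sup>+s\<in>{0<..<t}. ennreal (exp (\<gamma> * s) * (t - s) powr (- b)) \<partial>lborel) \<le>
    ennreal (exp (\<gamma> * t) * (Gamma (1 - b) / \<gamma> powr (1 - b)))"
proof -
  have "(\<integral>\<^sup>+s\<in>{0<..<t}. ennreal (exp (\<gamma> * s) * (t - s) powr (- b)) \<partial>lborel) =
    ennreal \<bar>- 1\<bar> * (\<integral>\<^sup>+r. ennreal (exp (\<gamma> * (t + (- 1) * r)) * (t - (t + (- 1) * r)) powr (- b)) * indicator {0<..<t} (t + (- 1) * r) \<partial>lborel)"
    by (rule nn_integral_real_affine) auto
  also have "\<dots> \<le> (\<integral>\<^sup>+r. ennreal (exp (\<gamma> * t)) * (ennreal (r powr (1 - b - 1) * exp (- (\<gamma> * r))) * indicator {0<..} r) \<partial>lborel)"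
    unfolding abs_minus_cancel abs_one ennreal_1 mult_1
  proof (intro nn_integral_mono)
    fix r :: real
    have "exp (\<gamma> * (t + (- 1) * r)) = exp (\<gamma> * t) * exp (- (\<gamma> * r))"
      by (simp add: exp_add[symmetric] algebra_simps)
    then show "ennreal (exp (\<gamma> * (t + (- 1) * r)) * (t - (t + (- 1) * r)) powr (- b)) * indicator {0<..<t} (t + (- 1) * r)
      \<le> ennreal (exp (\<gamma> * t)) * (ennreal (r powr (1 - b - 1) * exp (- (\<gamma> * r))) * indicator {0<..} r)"
      by (auto simp: ennreal_mult'[symmetric] mult_ac split: split_indicator)
  qed
  also have "\<dots> = ennreal (exp (\<gamma> * t)) * ennreal (Gamma (1 - b) * \<gamma> powr (- (1 - b)))"
    using nn_integral_Gamma[of "1 - b" \<gamma>] assms by (subst nn_integral_cmult) simp_all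
  also have "\<dots> = ennreal (exp (\<gamma> * t) * (Gamma (1 - b) / \<gamma> powr (1 - b)))"
    by (simp only: powr_minus_divide) (simp add: ennreal_mult'[symmetric])
  finally show ?thesis .
qed

section \<open>Measurability of the integrand of the stochastic convolution, and integration against
  the intensity\<close>

context levy_noise
begin

lemma predictable_time_measurable: "fst \<in> borel_measurable (predictable_algebra M \<mu> N)"
proof (rule borel_measurableI_le)
  fix a :: real
  show "{w \<in> space (predictable_algebra M \<mu> N). fst w \<le> a} \<in> sets (predictable_algebra M \<mu> N)"
  proof (cases "0 \<le> a")
    case True
    have "{w \<in> space (predictable_algebra M \<mu> N). fst w \<le> a} = ({0} \<times> space M) \<union> ({0<..a} \<times> space M)"
      using True by (auto simp: less_le)
    moreover have "{0} \<times> space M \<in> sets (predictable_algebra M \<mu> N)"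
      unfolding sets_predictable predictable_gen_def using space_noise_filtration[of 0] by (intro sigma_sets.Basic) blast
    ultimately show ?thesis using rectangle_predictable[OF order_refl True space_noise_filtration] by simp
  next
    case False
    then have "{w \<in> space (predictable_algebra M \<mu> N). fst w \<le> a} = {}" by auto
    then show ?thesis by (simp only: sets.empty_sets)
  qed
qed

lemma stoch_conv_integrand_predictable:
  assumes G: "(\<lambda>z. G (fst z) (snd z)) \<in> borel_measurable (borel \<Otimes>\<^sub>M borel)"
    and \<sigma>: "(\<lambda>(x, h). \<sigma> x h) \<in> borel_measurable (borel \<Otimes>\<^sub>M borel)"
    and u: "predictable_field M \<mu> N u"
  shows "predictable_integrand M \<mu> N (\<lambda>s y h \<omega>. indicator {0..t} s * (G (t - s) (y - x) * \<sigma> (u s y \<omega>) h))"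
  unfolding predictable_integrand_iff
proof -
  note [measurable] = predictable_time_measurable
  have "(\<lambda>z. (fst z, fst (snd z))) \<in> measurable predictable_mark_algebra (predictable_algebra M \<mu> N \<Otimes>\<^sub>M borel)"
    by measurable
  from measurable_compose[OF this u[unfolded predictable_field_def]]
  have um: "(\<lambda>z. u (fst (fst z)) (fst (snd z)) (snd (fst z))) \<in> borel_measurable predictable_mark_algebra"
    by (simp add: split_def)
  then have "(\<lambda>z. (u (fst (fst z)) (fst (snd z)) (snd (fst z)), snd (snd z))) \<in> measurable predictable_mark_algebra (borel \<Otimes>\<^sub>M borel)"
    by measurable
  from measurable_compose[OF this \<sigma>]
  have sm: "(\<lambda>z. \<sigma> (u (fst (fst z)) (fst (snd z)) (snd (fst z))) (snd (snd z))) \<in> borel_measurable predictable_mark_algebra"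
    by (simp add: split_def)
  have tm: "(\<lambda>z. fst (fst z)) \<in> borel_measurable predictable_mark_algebra" by measurable
  then have "(\<lambda>z. (t - fst (fst z), fst (snd z) - x)) \<in> measurable predictable_mark_algebra (borel \<Otimes>\<^sub>M borel)"
    by measurable
  from measurable_compose[OF this G]
  have Gm: "(\<lambda>z. G (t - fst (fst z)) (fst (snd z) - x)) \<in> borel_measurable predictable_mark_algebra" by simp
  have im: "(\<lambda>z. indicator {0..t} (fst (fst z)) :: real) \<in> borel_measurable predictable_mark_algebra"
    using tm by measurable
  have "(\<lambda>z. indicator {0..t} (fst (fst z)) * (G (t - fst (fst z)) (fst (snd z) - x) * \<sigma> (u (fst (fst z)) (fst (snd z)) (snd (fst z))) (snd (snd z)))) \<in> borel_measurable predictable_mark_algebra"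
    by (intro borel_measurable_times im Gm sm)
  then show "integrand_fun (\<lambda>s y h \<omega>. indicator {0..t} s * (G (t - s) (y - x) * \<sigma> (u s y \<omega>) h)) \<in> borel_measurable predictable_mark_algebra"
    by (simp add: integrand_fun_def split_def)
qed

text \<open>Applied at the two ends of the time interval: at time 0 the norm of \<open>u\<close>
  gives no control, its supremum being over positive times, and at time \<open>t\<close> the kernel
  has argument 0.\<close>

lemma AE_intensity_time: "AE w in intensity \<mu>. fst w \<noteq> a"
proof (cases "0 \<le> a")
  case True
  show ?thesis
  proof (rule AE_I')
    show "{a} \<times> UNIV \<in> null_sets (intensity \<mu>)"
      using True emeasure_intensity_Times[of "{a}" UNIV] sets.top[of "space_mark_measure \<mu>"] by (auto simp: null_sets_def)
  qed auto
next
  case False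
  then show ?thesis by (intro AE_I2) auto
qed

text \<open>Tonelli for an integrand that factors into a time weight, a kernel in time and space,
  and a function of the mark; the mark therefore decouples completely.\<close>

lemma nn_integral_intensity:
  assumes a: "a \<in> borel_measurable borel" and b: "(\<lambda>z. b (fst z) (snd z)) \<in> borel_measurable (borel \<Otimes>\<^sub>M borel)"
    and c: "c \<in> borel_measurable borel"
  shows "(\<integral>\<^sup>+w. a (fst w) * indicator {0<..<t} (fst w) * (b (fst w) (fst (snd w)) * c (snd (snd w))) \<partial>intensity \<mu>) =
    (\<integral>\<^sup>+s\<in>{0<..<t}. a s * (\<integral>\<^sup>+y. b s y \<partial>lborel) \<partial>lborel) * (\<integral>\<^sup>+h. c h \<partial>\<mu>)"
proof -
  note [measurable] = a c
  have bm [measurable]: "(\<lambda>z. b (f z) (k z)) \<in> borel_measurable Q"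
    if "f \<in> borel_measurable Q" "k \<in> borel_measurable Q" for Q :: "'z measure" and f k
    using measurable_compose[OF measurable_Pair[OF that] b] by simp
  have bs: "(\<lambda>y. b s y) \<in> borel_measurable lborel" for s by (rule bm) auto
  have "(\<integral>\<^sup>+w. a (fst w) * indicator {0<..<t} (fst w) * (b (fst w) (fst (snd w)) * c (snd (snd w))) \<partial>intensity \<mu>)
    = (\<integral>\<^sup>+s. (\<integral>\<^sup>+v. a s * indicator {0<..<t} s * (b s (fst v) * c (snd v)) \<partial>space_mark_measure \<mu>) \<partial>restrict_space lborel {0..})"
  proof -
    let ?Q = "restrict_space (lborel :: real measure) {0..} \<Otimes>\<^sub>M space_mark_measure \<mu>"
    have 1: "fst \<in> borel_measurable ?Q"
      by (rule measurable_compose[OF measurable_fst measurable_restrict_space1]) simp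
    have 2: "(\<lambda>w. fst (snd w)) \<in> borel_measurable ?Q" and 3: "(\<lambda>w. snd (snd w)) \<in> borel_measurable ?Q"
      by measurable
    have "(\<lambda>w. a (fst w) * indicator {0<..<t} (fst w) * (b (fst w) (fst (snd w)) * c (snd (snd w)))) \<in> borel_measurable ?Q"
    proof -
      note [measurable] = 1 2 3
      show ?thesis by measurable
    qed
    from space_mark.nn_integral_fst[OF this] show ?thesis by (simp add: intensity_def)
  qed
  also have "\<dots> = (\<integral>\<^sup>+s. a s * indicator {0<..<t} s * ((\<integral>\<^sup>+y. b s y \<partial>lborel) * (\<integral>\<^sup>+h. c h \<partial>\<mu>)) \<partial>restrict_space lborel {0..})"
  proof (intro nn_integral_cong)
    fix s
    have [measurable]: "b s \<in> borel_measurable borel" using bs[of s] by simp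
    have "(\<integral>\<^sup>+v. a s * indicator {0<..<t} s * (b s (fst v) * c (snd v)) \<partial>space_mark_measure \<mu>) =
       (\<integral>\<^sup>+y. (\<integral>\<^sup>+h. a s * indicator {0<..<t} s * (b s y * c h) \<partial>\<mu>) \<partial>lborel)"
      unfolding space_mark_measure_def by (subst marks.nn_integral_fst[symmetric]) auto
    also have "\<dots> = (\<integral>\<^sup>+y. a s * indicator {0<..<t} s * (b s y * (\<integral>\<^sup>+h. c h \<partial>\<mu>)) \<partial>lborel)"
      by (intro nn_integral_cong) (simp add: nn_integral_cmult)
    also have "\<dots> = a s * indicator {0<..<t} s * ((\<integral>\<^sup>+y. b s y \<partial>lborel) * (\<integral>\<^sup>+h. c h \<partial>\<mu>))"
      by (simp add: nn_integral_cmult nn_integral_multc)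
    finally show "(\<integral>\<^sup>+v. a s * indicator {0<..<t} s * (b s (fst v) * c (snd v)) \<partial>space_mark_measure \<mu>) =
      a s * indicator {0<..<t} s * ((\<integral>\<^sup>+y. b s y \<partial>lborel) * (\<integral>\<^sup>+h. c h \<partial>\<mu>))" .
  qed
  also have "\<dots> = (\<integral>\<^sup>+s. a s * indicator {0<..<t} s * ((\<integral>\<^sup>+y. b s y \<partial>lborel) * (\<integral>\<^sup>+h. c h \<partial>\<mu>)) * indicator {0..} s \<partial>lborel)"
    by (rule nn_integral_restrict_space) simp
  also have "\<dots> = (\<integral>\<^sup>+s. (a s * (\<integral>\<^sup>+y. b s y \<partial>lborel) * indicator {0<..<t} s) * (\<integral>\<^sup>+h. c h \<partial>\<mu>) \<partial>lborel)"
    by (intro nn_integral_cong) (auto simp: mult_ac split: split_indicator)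
  also have "\<dots> = (\<integral>\<^sup>+s\<in>{0<..<t}. a s * (\<integral>\<^sup>+y. b s y \<partial>lborel) \<partial>lborel) * (\<integral>\<^sup>+h. c h \<partial>\<mu>)"
    by (rule nn_integral_multc) measurable
  finally show ?thesis .
qed

end

theorem proposition4p1:
  fixes M :: "'w measure"
    and \<mu> :: "'a::euclidean_space measure"
    and N :: "'w \<Rightarrow> (real \<times> 'a \<times> 'a) measure"
    and \<sigma> :: "real \<Rightarrow> 'a \<Rightarrow> real"
    and J :: "'a \<Rightarrow> real"
    and p :: "real \<Rightarrow> 'a \<Rightarrow> real"
    and g :: "real \<Rightarrow> real"
    and u\<^sub>0 :: "'a \<Rightarrow> real"
    and u :: "real \<Rightarrow> 'a \<Rightarrow> 'w \<Rightarrow> real"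
    and \<alpha> \<beta> \<nu> \<gamma> Lip K :: real
  defines "G \<equiv> green_kernel \<beta> p g"
  assumes "prob_space M"
    and "levy_measure \<mu>"
    and "poisson_random_measure M (intensity \<mu>) N"
    and "0 < \<alpha>" "\<alpha> \<le> 2" "0 < \<beta>" "\<beta> < 1" "0 < \<nu>"
    and "real DIM('a) < min 2 (1 / \<beta>) * \<alpha>"
    and "stable_density \<alpha> \<nu> p"
    and "subordinator_density \<beta> g"
    and "(\<lambda>(x, h). \<sigma> x h) \<in> borel_measurable (borel \<Otimes>\<^sub>M borel)"
    and "J \<in> borel_measurable borel" "\<And>h. 0 \<le> J h"
    and "0 < Lip" "0 < K"
    and "\<And>h. \<sigma> 0 h = 0"
    and "\<And>x y h. \<bar>\<sigma> x h - \<sigma> y h\<bar> \<le> J h * Lip * \<bar>x - y\<bar>"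
    and "(\<integral>\<^sup>+ h. ennreal ((J h)\<^sup>2) \<partial>\<mu>) \<le> ennreal K"
    and "0 < \<gamma>"
    and "u\<^sub>0 \<in> borel_measurable borel" "bounded (range u\<^sub>0)"
    and "predictable_field M \<mu> N u"
    and "random_field_solution M \<mu> N \<sigma> G u\<^sub>0 u"
    and "field_norm M \<gamma> u < \<infinity>"
  shows "\<exists>C>0. C = C_star_star DIM('a) \<alpha> \<beta> \<nu> \<gamma> Lip K \<and>
           field_norm M \<gamma> (stoch_conv M \<mu> N \<sigma> G u) \<le> ennreal C * field_norm M \<gamma> u"
proof -
  note alpha = \<open>0 < \<alpha>\<close> and beta = \<open>0 < \<beta>\<close> \<open>\<beta> < 1\<close> and nu = \<open>0 < \<nu>\<close> and gamma = \<open>0 < \<gamma>\<close>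
  interpret levy_noise M \<mu> N
    using assms(2-4) by (intro levy_noise.intro levy_noise_axioms.intro)
  interpret subordinator \<beta> g
    using beta \<open>subordinator_density \<beta> g\<close> by (rule subordinator.intro)
  define b where "b = \<beta> * real DIM('a) / \<alpha>"
  have "min 2 (1 / \<beta>) * \<alpha> \<le> 2 * \<alpha>" "min 2 (1 / \<beta>) * \<alpha> \<le> 1 / \<beta> * \<alpha>"
    using alpha by (intro mult_right_mono; simp)+
  with \<open>real DIM('a) < min 2 (1 / \<beta>) * \<alpha>\<close> have "real DIM('a) < 2 * \<alpha>" and "real DIM('a) < 1 / \<beta> * \<alpha>"
    by linarith+
  then have d: "real DIM('a) < 2 * \<alpha>" and b: "b < 1"
    using alpha beta by (auto simp: b_def field_simps)
  define Cs where "Cs = C_star DIM('a) \<alpha> \<beta> \<nu>"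
  have Cs: "0 < Cs" unfolding Cs_def by (rule C_star_pos) (use alpha nu d in auto)
  define C where "C = C_star_star DIM('a) \<alpha> \<beta> \<nu> \<gamma> Lip K"
  \<comment> \<open>The value at \<open>\<gamma>\<close> of the Laplace transform of
    \<open>r powr (- b)\<close>.\<close>
  define R where "R = Gamma (1 - b) / \<gamma> powr (1 - b)"
  have R: "0 < R" using b gamma by (simp add: R_def)
  have C_eq: "C = Lip * sqrt (Cs * K * R)"
    unfolding C_def C_star_star_def Cs_def R_def b_def by simp
  have C: "0 < C" unfolding C_eq using \<open>0 < Lip\<close> \<open>0 < K\<close> Cs R by simp
  have C2: "C\<^sup>2 = Lip\<^sup>2 * K * Cs * R"
    unfolding C_eq power_mult_distrib using \<open>0 < K\<close> Cs R by (simp add: mult_ac)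
  \<comment> \<open>The squared norm. The moment bounds are linear in it, so the root is taken only
    at the very end.\<close>
  define A where "A = (SUP t\<in>{0<..}. SUP x. ennreal (exp (- \<gamma> * t)) * (\<integral>\<^sup>+ \<omega>. ennreal ((u t x \<omega>)\<^sup>2) \<partial>M))"
  have field_u: "field_norm M \<gamma> u = ennsqrt A" by (simp add: field_norm_def A_def)
  have A: "A < \<infinity>"
    using \<open>field_norm M \<gamma> u < \<infinity>\<close> unfolding field_u ennsqrt_def by (auto simp: less_top split: if_splits)
  have um: "u s y \<in> borel_measurable M" if "0 \<le> s" for s y
    using \<open>random_field_solution M \<mu> N \<sigma> G u\<^sub>0 u\<close> that by (simp add: random_field_solution_def)
  have u_le: "(\<integral>\<^sup>+ \<omega>. ennreal ((u s y \<omega>)\<^sup>2) \<partial>M) \<le> ennreal (exp (\<gamma> * s)) * A" if "0 < s" for s y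
  proof -
    have "ennreal (exp (- \<gamma> * s)) * (\<integral>\<^sup>+ \<omega>. ennreal ((u s y \<omega>)\<^sup>2) \<partial>M) \<le> A"
      unfolding A_def using that by (intro SUP_upper2[of s] SUP_upper) auto
    then have "ennreal (exp (\<gamma> * s)) * (ennreal (exp (- \<gamma> * s)) * (\<integral>\<^sup>+ \<omega>. ennreal ((u s y \<omega>)\<^sup>2) \<partial>M)) \<le> ennreal (exp (\<gamma> * s)) * A"
      by (rule mult_left_mono) simp
    then show ?thesis by (simp add: mult.assoc[symmetric] ennreal_mult'[symmetric] exp_add[symmetric])
  qed
  have sigma_le: "(\<sigma> v h)\<^sup>2 \<le> (J h)\<^sup>2 * Lip\<^sup>2 * v\<^sup>2" for v h
  proof -
    have "\<bar>\<sigma> v h\<bar> \<le> \<bar>J h * Lip * v\<bar>"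
      using assms(19)[of v h 0] assms(18)[of h] assms(15)[of h] \<open>0 < Lip\<close> by (simp add: abs_mult)
    then have "(\<sigma> v h)\<^sup>2 \<le> (J h * Lip * v)\<^sup>2" by (rule abs_le_square_iff[THEN iffD1])
    then show ?thesis by (simp add: power_mult_distrib)
  qed
  have Gm: "(\<lambda>z. G (fst z) (snd z)) \<in> borel_measurable (borel \<Otimes>\<^sub>M borel)"
    unfolding G_def by (rule green_kernel_measurable[OF alpha nu \<open>stable_density \<alpha> \<nu> p\<close>])
  have main: "(\<integral>\<^sup>+ \<omega>. ennreal ((stoch_conv M \<mu> N \<sigma> G u t x \<omega>)\<^sup>2) \<partial>M) \<le> ennreal (exp (\<gamma> * t)) * (ennreal (C\<^sup>2) * A)"
    if t: "0 < t" for t x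
  proof -
    let ?X = "\<lambda>s y h \<omega>. indicator {0..t} s * (G (t - s) (y - x) * \<sigma> (u s y \<omega>) h)"
    let ?a = "\<lambda>s. ennreal (Lip\<^sup>2) * A * ennreal (exp (\<gamma> * s))"
    let ?b = "\<lambda>s y. ennreal ((G (t - s) (y - x))\<^sup>2)" and ?c = "\<lambda>h. ennreal ((J h)\<^sup>2)"
    have pred: "predictable_integrand M \<mu> N ?X"
      by (rule stoch_conv_integrand_predictable[OF Gm assms(13) \<open>predictable_field M \<mu> N u\<close>])
    \<comment> \<open>The Lipschitz bound against \<open>\<sigma> 0 h = 0\<close> replaces
      \<open>\<sigma>\<close> by \<open>J h * Lip * \<bar>u\<bar>\<close>, and the norm replaces the
      second moment of \<open>u\<close> by \<open>exp (\<gamma> * s) * A\<close>. The majorant is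
      deterministic and has the product shape of \<open>nn_integral_intensity\<close>.\<close>
    have "sq_norm_integrand M \<mu> ?X \<le> (\<integral>\<^sup>+w. ?a (fst w) * indicator {0<..<t} (fst w) * (?b (fst w) (fst (snd w)) * ?c (snd (snd w))) \<partial>intensity \<mu>)"
      unfolding sq_norm_integrand_def
    proof (intro nn_integral_mono_AE, use AE_intensity_time[of 0] AE_intensity_time[of t] AE_space in eventually_elim)
      fix w assume w: "fst w \<noteq> 0" "fst w \<noteq> t" "w \<in> space (intensity \<mu>)"
      obtain s y h where w_eq: "w = (s, y, h)" by (cases w)
      have s: "0 < s" "s \<noteq> t" using w by (auto simp: w_eq)
      show "(case w of (s, y, h) \<Rightarrow> \<integral>\<^sup>+ \<omega>. ennreal ((?X s y h \<omega>)\<^sup>2) \<partial>M) \<le> ?a (fst w) * indicator {0<..<t} (fst w) * (?b (fst w) (fst (snd w)) * ?c (snd (snd w)))"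
      proof (cases "s < t")
        case True
        note [measurable] = um[OF less_imp_le[OF s(1)], of y]
        have "(\<integral>\<^sup>+ \<omega>. ennreal ((?X s y h \<omega>)\<^sup>2) \<partial>M) \<le> (\<integral>\<^sup>+ \<omega>. ennreal ((G (t - s) (y - x))\<^sup>2 * ((J h)\<^sup>2 * Lip\<^sup>2)) * ennreal ((u s y \<omega>)\<^sup>2) \<partial>M)"
        proof (intro nn_integral_mono)
          fix \<omega>
          have "(?X s y h \<omega>)\<^sup>2 = (G (t - s) (y - x))\<^sup>2 * (\<sigma> (u s y \<omega>) h)\<^sup>2"
            using s True by (simp add: power_mult_distrib)
          also have "\<dots> \<le> (G (t - s) (y - x))\<^sup>2 * ((J h)\<^sup>2 * Lip\<^sup>2 * (u s y \<omega>)\<^sup>2)"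
            by (intro mult_left_mono sigma_le) simp
          finally show "ennreal ((?X s y h \<omega>)\<^sup>2) \<le> ennreal ((G (t - s) (y - x))\<^sup>2 * ((J h)\<^sup>2 * Lip\<^sup>2)) * ennreal ((u s y \<omega>)\<^sup>2)"
            by (simp add: ennreal_mult''[symmetric] mult.assoc ennreal_leI)
        qed
        also have "\<dots> = ennreal ((G (t - s) (y - x))\<^sup>2 * ((J h)\<^sup>2 * Lip\<^sup>2)) * (\<integral>\<^sup>+ \<omega>. ennreal ((u s y \<omega>)\<^sup>2) \<partial>M)"
          by (rule nn_integral_cmult) measurable
        also have "\<dots> \<le> ennreal ((G (t - s) (y - x))\<^sup>2 * ((J h)\<^sup>2 * Lip\<^sup>2)) * (ennreal (exp (\<gamma> * s)) * A)"
          by (intro mult_left_mono u_le s) simp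
        also have "\<dots> = ?a s * (?b s y * ?c h)"
          by (simp add: ennreal_mult' mult_ac)
        finally show ?thesis using s True by (simp add: w_eq)
      next
        case False
        then show ?thesis using s by (simp add: w_eq)
      qed
    qed
    also have "\<dots> = (\<integral>\<^sup>+s\<in>{0<..<t}. ?a s * (\<integral>\<^sup>+y. ?b s y \<partial>lborel) \<partial>lborel) * (\<integral>\<^sup>+h. ?c h \<partial>\<mu>)"
    proof (rule nn_integral_intensity[where a="?a" and b="?b" and c="?c"])
      have "(\<lambda>z. (t - fst z, snd z - x)) \<in> measurable (borel \<Otimes>\<^sub>M borel) (borel \<Otimes>\<^sub>M borel)" by measurable
      from measurable_compose[OF this Gm]
      show "(\<lambda>z. ?b (fst z) (snd z)) \<in> borel_measurable (borel \<Otimes>\<^sub>M borel)" by simp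
      show "?c \<in> borel_measurable borel" using assms(14) by simp
    qed simp
    \<comment> \<open>By translation invariance the kernel integral does not depend on
      \<open>x\<close>, so the kernel bound at time \<open>t - s\<close> applies; the integral over
      the marks is at most \<open>K\<close>.\<close>
    also have "\<dots> \<le> (\<integral>\<^sup>+s. ennreal (Lip\<^sup>2) * A * ennreal Cs * (ennreal (exp (\<gamma> * s) * (t - s) powr (- b)) * indicator {0<..<t} s) \<partial>lborel) * ennreal K"
    proof (rule mult_mono, rule nn_integral_mono)
      fix s
      have "(\<integral>\<^sup>+y. ?b s y \<partial>lborel) \<le> ennreal (Cs * (t - s) powr (- b))" if "s < t"
      proof -
        have "(\<lambda>y. (t - s, y)) \<in> measurable borel (borel \<Otimes>\<^sub>M borel)" by measurable
        from measurable_compose[OF this Gm] have "(\<lambda>y. ennreal ((G (t - s) y)\<^sup>2)) \<in> borel_measurable borel" by simp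
        from nn_integral_lborel_translate[OF this, of x]
        have "(\<integral>\<^sup>+y. ?b s y \<partial>lborel) = (\<integral>\<^sup>+y. ennreal ((G (t - s) y)\<^sup>2) \<partial>lborel)" .
        also have "\<dots> \<le> ennreal (Cs * (t - s) powr (- b))"
          unfolding G_def Cs_def b_def
          by (rule nn_integral_green_kernel_sq[OF alpha nu \<open>stable_density \<alpha> \<nu> p\<close> _ d]) (use that in simp)
        finally show ?thesis .
      qed
      then have "?a s * (\<integral>\<^sup>+y. ?b s y \<partial>lborel) \<le> ?a s * ennreal (Cs * (t - s) powr (- b))" if "s < t"
        using that by (intro mult_left_mono) auto
      then show "?a s * (\<integral>\<^sup>+y. ?b s y \<partial>lborel) * indicator {0<..<t} s \<le>
        ennreal (Lip\<^sup>2) * A * ennreal Cs * (ennreal (exp (\<gamma> * s) * (t - s) powr (- b)) * indicator {0<..<t} s)"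
        using Cs by (auto simp: ennreal_mult' mult_ac split: split_indicator)
    qed (use assms(20) in auto)
    also have "(\<integral>\<^sup>+s. ennreal (Lip\<^sup>2) * A * ennreal Cs * (ennreal (exp (\<gamma> * s) * (t - s) powr (- b)) * indicator {0<..<t} s) \<partial>lborel)
      = ennreal (Lip\<^sup>2) * A * ennreal Cs * (\<integral>\<^sup>+s\<in>{0<..<t}. ennreal (exp (\<gamma> * s) * (t - s) powr (- b)) \<partial>lborel)"
      by (rule nn_integral_cmult) measurable
    also have "\<dots> * ennreal K \<le> ennreal (Lip\<^sup>2) * A * ennreal Cs * ennreal (exp (\<gamma> * t) * R) * ennreal K"
      unfolding R_def by (intro mult_right_mono mult_left_mono nn_integral_exp_convolution_le b gamma) auto
    also have "\<dots> = ennreal (exp (\<gamma> * t)) * (ennreal (C\<^sup>2) * A)"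
      unfolding C2 using Cs R \<open>0 < K\<close> by (simp add: ennreal_mult' mult_ac)
    \<comment> \<open>One bound serves two ends: being finite, it shows that the integral exists,
      and it is also the estimate sought.\<close>
    finally have bound: "sq_norm_integrand M \<mu> ?X \<le> ennreal (exp (\<gamma> * t)) * (ennreal (C\<^sup>2) * A)" .
    then have "sq_norm_integrand M \<mu> ?X < \<infinity>"
      by (rule order_le_less_trans) (use A in \<open>simp add: ennreal_mult_less_top\<close>)
    from stoch_integral_sq_le[OF pred this] bound show ?thesis
      unfolding stoch_conv_def by (rule order_trans)
  qed
  have "field_norm M \<gamma> (stoch_conv M \<mu> N \<sigma> G u) \<le> ennsqrt (ennreal (C\<^sup>2) * A)"
    unfolding field_norm_def
  proof (intro ennsqrt_mono SUP_least)
    fix t :: real and x :: 'a assume "t \<in> {0<..}"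
    then have "ennreal (exp (- \<gamma> * t)) * (\<integral>\<^sup>+ \<omega>. ennreal ((stoch_conv M \<mu> N \<sigma> G u t x \<omega>)\<^sup>2) \<partial>M)
      \<le> ennreal (exp (- \<gamma> * t)) * (ennreal (exp (\<gamma> * t)) * (ennreal (C\<^sup>2) * A))"
      by (intro mult_left_mono main) auto
    also have "\<dots> = ennreal (C\<^sup>2) * A"
      by (simp add: mult.assoc[symmetric] ennreal_mult'[symmetric] exp_add[symmetric])
    finally show "ennreal (exp (- \<gamma> * t)) * (\<integral>\<^sup>+ \<omega>. ennreal ((stoch_conv M \<mu> N \<sigma> G u t x \<omega>)\<^sup>2) \<partial>M) \<le> ennreal (C\<^sup>2) * A" .
  qed
  also have "\<dots> = ennreal C * field_norm M \<gamma> u"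
    unfolding field_u using C A by (intro ennsqrt_mult_sq) auto
  finally show ?thesis using C unfolding C_def by blast
qed

end
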